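(* Let $(\Omega,\mathscr A,\mathbb P)$ be a probability space with a complete filtration $\mathscr F=(\mathscr F_t)_{t\ge 0}$ and let $W$ be a (real, standard) Brownian motion with respect to $\mathscr F$. Let $E$ be a real Banach space, let $0\le a<b\le\infty$, and let $\xi:\Omega\to E$ be strongly measurable. Then there exists a strongly progressively measurable process $\phi:[a,b]\times\Omega\to E$ which is stochastically integrable and satisfies $$\int_a^b\phi\,dW=\xi\quad\text{almost surely}$$ if and only if $\xi$ is $\sigma(\mathscr F_t:t<b)$-measurable.
   Context: The filtration being complete, each $\mathscr F_t$ contains all $\mathbb P$-null sets. If $b=\infty$, then $[a,b]$ means $[a,\infty)$. $L^0(\Omega;X)$ denotes the space of (equivalence classes of) strongly measurable maps $\Omega\to X$ with the topology of convergence in probability. A strongly measurable process $\phi:[a,b]\times\Omega\to E$ is weakly in $L^0(\Omega;L^2(a,b))$ if for all $x^*\in E^*$ one has $\langle\phi,x^*\rangle\in L^0(\Omega;L^2(a,b))$. An adapted step process is a finite linear combination of processes $\mathbf 1_{(c,d]}\eta$ with $a\le c<d\le b$, $d<\infty$, and $\eta:\Omega\to E$ strongly $\mathscr F_c$-measurable; one sets $\int_a^t\mathbf 1_{(c,d]}\eta\,dW=(W(d\wedge t)-W(c\wedge t))\eta$ and extends by linearity. A strongly measurable adapted process $\phi:[a,b]\times\Omega\to E$ that is weakly in $L^0(\Omega;L^2(a,b))$ is stochastically integrable if there are adapted step processes $(\phi_n)_{n\ge1}$ such that (i) for all $x^*\in E^*$, $\langle\phi_n,x^*\rangle\to\langle\phi,x^*\rangle$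 in $L^0(\Omega;L^2(a,b))$, and (ii) there is $\zeta\in L^0(\Omega;C_b([a,b];E))$ with $\int_a^\cdot\phi_n\,dW\to\zeta$ in $L^0(\Omega;C_b([a,b];E))$. In that case $\int_a^t\phi\,dW:=\zeta(t)$, and $\int_a^b\phi\,dW:=\zeta(b)$, which for $b=\infty$ means $\lim_{t\to\infty}\zeta(t)$ (this limit exists a.s. by (ii)). *)

theory Defs
  imports "HOL-Probability.Probability"
begin

section \<open>Strong measurability and \<open>L\<^sup>0\<close> spaces\<close>

text \<open>Pointwise limits of simple functions. For non-separable target spaces this is stronger
  than Borel measurability.\<close>

definition strongly_measurable :: "'w measure \<Rightarrow> ('w \<Rightarrow> 'e::topological_space) \<Rightarrow> bool" where
  "strongly_measurable M f \<longleftrightarrow>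
     (\<exists>s :: nat \<Rightarrow> 'w \<Rightarrow> 'e. (\<forall>n. simple_function M (s n)) \<and>
        (\<forall>\<omega>\<in>space M. (\<lambda>n. s n \<omega>) \<longlonglongrightarrow> f \<omega>))"

text \<open>The target spaces \<open>L\<^sup>2(a,b)\<close> and \<open>C\<^sub>b([a,b];E)\<close> are given by a set \<open>V\<close> of functions on the
  whole real line, together with a pseudometric \<open>d\<close> on \<open>V\<close> identifying those functions that
  represent the same element. In \<open>L0 M V d\<close> a class modulo almost sure equality is given by any of
  its representatives; these need only take values in \<open>V\<close> almost surely, and the simple functions
  only have to converge almost surely.\<close>

definition L0 :: "'w measure \<Rightarrow> 'v set \<Rightarrow> ('v \<Rightarrow> 'v \<Rightarrow> real) \<Rightarrow> ('w \<Rightarrow> 'v) set" where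
  "L0 M V d = {X. (AE \<omega> in M. X \<omega> \<in> V) \<and>
     (\<exists>s :: nat \<Rightarrow> 'w \<Rightarrow> 'v. (\<forall>n. simple_function M (s n) \<and> s n ` space M \<subseteq> V) \<and>
        (AE \<omega> in M. (\<lambda>n. d (s n \<omega>) (X \<omega>)) \<longlonglongrightarrow> 0))}"

text \<open>Convergence in probability. For representatives as above, the event below is measurable up
  to an \<open>M\<close>-null set only, whence the completion (which equals \<open>M\<close> if \<open>M\<close> is complete).\<close>

definition tends_in_prob ::
    "'w measure \<Rightarrow> ('v \<Rightarrow> 'v \<Rightarrow> real) \<Rightarrow> (nat \<Rightarrow> 'w \<Rightarrow> 'v) \<Rightarrow> ('w \<Rightarrow> 'v) \<Rightarrow> bool" where
  "tends_in_prob M d X Y \<longleftrightarrow>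
     (\<forall>\<epsilon>>0. (\<lambda>n. measure (completion M) {\<omega>\<in>space M. d (X n \<omega>) (Y \<omega>) > \<epsilon>}) \<longlonglongrightarrow> 0)"

text \<open>\<open>[a,b]\<close>, to be read as \<open>[a,\<infinity>)\<close> if \<open>b = \<infinity>\<close>.\<close>

definition time_interval :: "real \<Rightarrow> ereal \<Rightarrow> real set" where
  "time_interval a b = {t. a \<le> t \<and> ereal t \<le> b}"

definition L2 :: "real \<Rightarrow> ereal \<Rightarrow> (real \<Rightarrow> real) set" where
  "L2 a b = {f. f \<in> borel_measurable (restrict_space lborel (time_interval a b)) \<and>
     integrable (restrict_space lborel (time_interval a b)) (\<lambda>t. (f t)\<^sup>2)}"

definition L2_dist :: "real \<Rightarrow> ereal \<Rightarrow> (real \<Rightarrow> real) \<Rightarrow> (real \<Rightarrow> real) \<Rightarrow> real" where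
  "L2_dist a b f g = sqrt (\<integral>t. (f t - g t)\<^sup>2 \<partial>restrict_space lborel (time_interval a b))"

definition Cb :: "real \<Rightarrow> ereal \<Rightarrow> (real \<Rightarrow> 'e::real_normed_vector) set" where
  "Cb a b = {f. continuous_on (time_interval a b) f \<and> bounded (f ` time_interval a b)}"

definition Cb_dist ::
    "real \<Rightarrow> ereal \<Rightarrow> (real \<Rightarrow> 'e::real_normed_vector) \<Rightarrow> (real \<Rightarrow> 'e) \<Rightarrow> real" where
  "Cb_dist a b f g = (SUP t\<in>time_interval a b. norm (f t - g t))"


section \<open>Filtrations and Brownian motion\<close>

text \<open>Only the time parameters \<open>t \<ge> 0\<close> matter.\<close>

locale complete_filtration = prob_space M for M :: "'w measure" +
  fixes F :: "real \<Rightarrow> 'w measure"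
  assumes subalgebra_F: "0 \<le> t \<Longrightarrow> subalgebra M (F t)"
    and sets_F_mono: "0 \<le> s \<Longrightarrow> s \<le> t \<Longrightarrow> sets (F s) \<subseteq> sets (F t)"
    and null_sets_F: "0 \<le> t \<Longrightarrow> null_sets M \<subseteq> sets (F t)"

locale brownian_motion = complete_filtration M F
  for M :: "'w measure" and F :: "real \<Rightarrow> 'w measure" +
  fixes W :: "real \<Rightarrow> 'w \<Rightarrow> real"
  assumes adapted_W: "0 \<le> t \<Longrightarrow> W t \<in> borel_measurable (F t)"
    and W_0: "AE \<omega> in M. W 0 \<omega> = 0"
    and increment_normal: "0 \<le> s \<Longrightarrow> s < t \<Longrightarrow>
      distributed M lborel (\<lambda>\<omega>. W t \<omega> - W s \<omega>) (normal_density 0 (sqrt (t - s)))"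
    and increment_indep: "0 \<le> s \<Longrightarrow> s < t \<Longrightarrow>
      indep_set (sets (vimage_algebra (space M) (\<lambda>\<omega>. W t \<omega> - W s \<omega>) borel)) (sets (F s))"
    and continuous_W: "AE \<omega> in M. continuous_on {0..} (\<lambda>t. W t \<omega>)"

definition sigma_before :: "'w measure \<Rightarrow> (real \<Rightarrow> 'w measure) \<Rightarrow> ereal \<Rightarrow> 'w measure" where
  "sigma_before M F b = sigma (space M) (\<Union>t\<in>{t. 0 \<le> t \<and> ereal t < b}. sets (F t))"


section \<open>Processes\<close>

definition strongly_measurable_process ::
    "'w measure \<Rightarrow> real \<Rightarrow> ereal \<Rightarrow> (real \<Rightarrow> 'w \<Rightarrow> 'e::topological_space) \<Rightarrow> bool" where
  "strongly_measurable_process M a b \<phi> \<longleftrightarrow>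
     strongly_measurable (restrict_space borel (time_interval a b) \<Otimes>\<^sub>M M) (\<lambda>(t, \<omega>). \<phi> t \<omega>)"

definition strongly_adapted ::
    "(real \<Rightarrow> 'w measure) \<Rightarrow> real \<Rightarrow> ereal \<Rightarrow> (real \<Rightarrow> 'w \<Rightarrow> 'e::topological_space) \<Rightarrow> bool" where
  "strongly_adapted F a b \<phi> \<longleftrightarrow> (\<forall>t\<in>time_interval a b. strongly_measurable (F t) (\<phi> t))"

definition strongly_progressively_measurable ::
    "(real \<Rightarrow> 'w measure) \<Rightarrow> real \<Rightarrow> ereal \<Rightarrow> (real \<Rightarrow> 'w \<Rightarrow> 'e::topological_space) \<Rightarrow> bool" where
  "strongly_progressively_measurable F a b \<phi> \<longleftrightarrow>
     (\<forall>t\<in>time_interval a b.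
        strongly_measurable (restrict_space borel {a..t} \<Otimes>\<^sub>M F t) (\<lambda>(s, \<omega>). \<phi> s \<omega>))"

definition weakly_L0_L2 ::
    "'w measure \<Rightarrow> real \<Rightarrow> ereal \<Rightarrow> (real \<Rightarrow> 'w \<Rightarrow> 'e::real_normed_vector) \<Rightarrow> bool" where
  "weakly_L0_L2 M a b \<phi> \<longleftrightarrow>
     (\<forall>x :: 'e \<Rightarrow>\<^sub>L real. (\<lambda>\<omega> t. blinfun_apply x (\<phi> t \<omega>)) \<in> L0 M (L2 a b) (L2_dist a b))"


section \<open>The stochastic integral\<close>

text \<open>A list of triples \<open>(c, d, \<eta>)\<close> stands for the sum of the processes \<open>1\<^bsub>(c,d]\<^esub> \<eta>\<close>; the scalar
  coefficients of a linear combination are absorbed into the \<open>\<eta>\<close>.\<close>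

type_synonym ('w, 'e) step = "(real \<times> real \<times> ('w \<Rightarrow> 'e)) list"

definition adapted_step ::
    "(real \<Rightarrow> 'w measure) \<Rightarrow> real \<Rightarrow> ereal \<Rightarrow> ('w, 'e::topological_space) step \<Rightarrow> bool" where
  "adapted_step F a b S \<longleftrightarrow>
     (\<forall>(c, d, \<eta>)\<in>set S. a \<le> c \<and> c < d \<and> ereal d \<le> b \<and> strongly_measurable (F c) \<eta>)"

definition step_process :: "('w, 'e::real_vector) step \<Rightarrow> real \<Rightarrow> 'w \<Rightarrow> 'e" where
  "step_process S t \<omega> = (\<Sum>(c, d, \<eta>)\<leftarrow>S. (indicator {c<..d} t :: real) *\<^sub>R \<eta> \<omega>)"

definition step_integral ::
    "(real \<Rightarrow> 'w \<Rightarrow> real) \<Rightarrow> ('w, 'e::real_vector) step \<Rightarrow> real \<Rightarrow> 'w \<Rightarrow> 'e" where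
  "step_integral W S t \<omega> = (\<Sum>(c, d, \<eta>)\<leftarrow>S. (W (min d t) \<omega> - W (min c t) \<omega>) *\<^sub>R \<eta> \<omega>)"

text \<open>\<open>\<zeta>\<close> is (a representative of) the process \<open>\<integral>\<^bsub>a\<^esub>\<^bsup>\<cdot>\<^esup> \<phi> dW\<close>, regarded as a map from \<open>\<Omega>\<close> to the
  space of paths. As with the \<open>has_integral\<close> predicates of the library, the integral, which is
  determined only up to almost sure equality, is expressed by a relation.\<close>

definition is_integral_process ::
    "'w measure \<Rightarrow> (real \<Rightarrow> 'w measure) \<Rightarrow> (real \<Rightarrow> 'w \<Rightarrow> real) \<Rightarrow> real \<Rightarrow> ereal \<Rightarrow>
     (real \<Rightarrow> 'w \<Rightarrow> 'e::banach) \<Rightarrow> ('w \<Rightarrow> real \<Rightarrow> 'e) \<Rightarrow> bool" where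
  "is_integral_process M F W a b \<phi> \<zeta> \<longleftrightarrow>
     strongly_measurable_process M a b \<phi> \<and>
     strongly_adapted F a b \<phi> \<and>
     weakly_L0_L2 M a b \<phi> \<and>
     \<zeta> \<in> L0 M (Cb a b) (Cb_dist a b) \<and>
     (\<exists>S :: nat \<Rightarrow> ('w, 'e) step.
        (\<forall>n. adapted_step F a b (S n)) \<and>
        (\<forall>x :: 'e \<Rightarrow>\<^sub>L real.
           tends_in_prob M (L2_dist a b)
             (\<lambda>n \<omega> t. blinfun_apply x (step_process (S n) t \<omega>))
             (\<lambda>\<omega> t. blinfun_apply x (\<phi> t \<omega>))) \<and>
        tends_in_prob M (Cb_dist a b) (\<lambda>n \<omega> t. step_integral W (S n) t \<omega>) \<zeta>)"

definition stochastically_integrable ::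
    "'w measure \<Rightarrow> (real \<Rightarrow> 'w measure) \<Rightarrow> (real \<Rightarrow> 'w \<Rightarrow> real) \<Rightarrow> real \<Rightarrow> ereal \<Rightarrow>
     (real \<Rightarrow> 'w \<Rightarrow> 'e::banach) \<Rightarrow> bool" where
  "stochastically_integrable M F W a b \<phi> \<longleftrightarrow> (\<exists>\<zeta>. is_integral_process M F W a b \<phi> \<zeta>)"

text \<open>\<open>\<integral>\<^bsub>a\<^esub>\<^bsup>b\<^esup> \<phi> dW = \<xi>\<close> almost surely.\<close>

definition has_stochastic_integral ::
    "'w measure \<Rightarrow> (real \<Rightarrow> 'w measure) \<Rightarrow> (real \<Rightarrow> 'w \<Rightarrow> real) \<Rightarrow> real \<Rightarrow> ereal \<Rightarrow>
     (real \<Rightarrow> 'w \<Rightarrow> 'e::banach) \<Rightarrow> ('w \<Rightarrow> 'e) \<Rightarrow> bool" where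
  "has_stochastic_integral M F W a b \<phi> \<xi> \<longleftrightarrow>
     (\<exists>\<zeta>. is_integral_process M F W a b \<phi> \<zeta> \<and>
        (AE \<omega> in M. if b = \<infinity> then (\<zeta> \<omega> \<longlongrightarrow> \<xi> \<omega>) at_top else \<zeta> \<omega> (real_of_ereal b) = \<xi> \<omega>))"

end

theory Submission
  imports Defs
begin

text \<open>If \<open>\<xi>\<close> is measurable with respect to the information before \<open>b\<close>, choose times \<open>s k\<close> increasing to
  \<open>b\<close> and simple \<open>F (s k)\<close>-measurable \<open>y k\<close> that approximate \<open>\<xi>\<close> geometrically fast. On
  \<open>(s k, s (Suc k)]\<close> let the integrand be the constant \<open>(I - y k) / (10 * sqrt (s (Suc k) - s k))\<close>, where
  \<open>I\<close> is the integral up to time \<open>s k\<close>. Apart from the changes of the target, the error \<open>I - y k\<close> is then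
  multiplied by independent factors \<open>1 + g / 10\<close> with \<open>g\<close> standard normal. As
  \<open>E (sqrt \<bar>1 + g / 10\<bar>) < 1\<close>, the errors are almost surely summable even after multiplication by \<open>k\<close>,
  which makes the integrand square integrable and, by a maximal inequality for the oscillation of \<open>W\<close>,
  forces the integral to converge to \<open>\<xi>\<close>.

  Conversely, the integral at time \<open>t\<close> is almost surely the limit of \<open>F t\<close>-measurable step integrals, and
  \<open>\<xi>\<close> is the limit of these values as \<open>t\<close> increases to \<open>b\<close>.\<close>

section \<open>Strong measurability and approximation by simple functions\<close>

text \<open>The filtration may be larger than that of the Brownian motion, \<xi> need not be
  integrable, and the values lie in an arbitrary Banach space; so neither martingale representation
  nor an isometry between integrands and integrals is at hand. Keeping the integrand a fixed vector
  on each interval reduces everything to norms and to scalar properties of \<open>W\<close>. The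
  square root has a reason: the expectation of \<bar>1 + g / 10\<bar> is at least \<bar>expectation
  of 1 + g / 10\<bar> = 1, so first moments of the error do not contract, although products of such
  factors decay along almost every path. A fractional moment sees this decay. The exponent 1/2 is
  also convenient because the square root is subadditive, which lets the moves of the target enter
  the recursion additively. The weight k pays for the oscillation of \<open>W\<close> inside the
  intervals: Chebyshev and Borel-Cantelli bound it only by about k times the square root of the
  interval length.\<close>

lemma strongly_measurable_simple: "simple_function M f \<Longrightarrow> strongly_measurable M f"
  unfolding strongly_measurable_def by (intro exI[of _ "\<lambda>_. f"]) auto

lemma strongly_measurable_const: "strongly_measurable M (\<lambda>_. c)"
  by (intro strongly_measurable_simple) simp

lemma strongly_measurable_borel:
  fixes f :: "'w \<Rightarrow> 'e::metric_space"
  assumes "strongly_measurable M f"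
  shows "f \<in> borel_measurable M"
proof -
  obtain s where s: "\<And>n. simple_function M (s n)" "\<And>\<omega>. \<omega> \<in> space M \<Longrightarrow> (\<lambda>n. s n \<omega>) \<longlonglongrightarrow> f \<omega>"
    using assms unfolding strongly_measurable_def by blast
  show ?thesis
    proof (rule borel_measurable_LIMSEQ_metric)
    show "s n \<in> borel_measurable M" for n
      by (rule measurable_compose[OF measurable_simple_function[OF s(1)], of "\<lambda>x. x"]) simp
  qed (rule s(2))
qed

lemma borel_strongly_measurable:
  fixes f :: "'w \<Rightarrow> 'e::{metric_space, second_countable_topology}"
  assumes "f \<in> borel_measurable M"
  shows "strongly_measurable M f"
proof -
  obtain s where "\<And>i. simple_function M (s i)" "\<And>x. x \<in> space M \<Longrightarrow> (\<lambda>i. s i x) \<longlonglongrightarrow> f x"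
    using borel_measurable_implies_sequence_metric[OF assms, of undefined] by blast
  then show ?thesis unfolding strongly_measurable_def by blast
qed

lemma strongly_measurable_compose2:
  assumes "strongly_measurable M f" "strongly_measurable M g"
    and h: "\<And>x y. isCont (\<lambda>p. h (fst p) (snd p)) (x, y)"
  shows "strongly_measurable M (\<lambda>\<omega>. h (f \<omega>) (g \<omega>))"
proof -
  obtain s where s: "\<And>n. simple_function M (s n)" "\<And>\<omega>. \<omega> \<in> space M \<Longrightarrow> (\<lambda>n. s n \<omega>) \<longlonglongrightarrow> f \<omega>"
    using assms(1) unfolding strongly_measurable_def by blast
  obtain s' where s': "\<And>n. simple_function M (s' n)" "\<And>\<omega>. \<omega> \<in> space M \<Longrightarrow> (\<lambda>n. s' n \<omega>) \<longlonglongrightarrow> g \<omega>"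
    using assms(2) unfolding strongly_measurable_def by blast
  show ?thesis
    unfolding strongly_measurable_def
  proof (intro exI[of _ "\<lambda>n \<omega>. h (s n \<omega>) (s' n \<omega>)"] conjI allI ballI)
    fix \<omega> assume w: "\<omega> \<in> space M"
    show "(\<lambda>n. h (s n \<omega>) (s' n \<omega>)) \<longlonglongrightarrow> h (f \<omega>) (g \<omega>)"
      using isCont_tendsto_compose[OF h tendsto_Pair[OF s(2)[OF w] s'(2)[OF w]]] by simp
  qed (rule simple_function_compose2[OF s(1) s'(1)])
qed

lemma strongly_measurable_add:
  fixes f g :: "'w \<Rightarrow> 'e::real_normed_vector"
  shows "strongly_measurable M f \<Longrightarrow> strongly_measurable M g \<Longrightarrow> strongly_measurable M (\<lambda>\<omega>. f \<omega> + g \<omega>)"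
  by (rule strongly_measurable_compose2) (auto intro!: continuous_intros)

lemma strongly_measurable_diff:
  fixes f g :: "'w \<Rightarrow> 'e::real_normed_vector"
  shows "strongly_measurable M f \<Longrightarrow> strongly_measurable M g \<Longrightarrow> strongly_measurable M (\<lambda>\<omega>. f \<omega> - g \<omega>)"
  by (rule strongly_measurable_compose2) (auto intro!: continuous_intros)

lemma strongly_measurable_scaleR:
  fixes g :: "'w \<Rightarrow> 'e::real_normed_vector"
  assumes "f \<in> borel_measurable M" "strongly_measurable M g"
  shows "strongly_measurable M (\<lambda>\<omega>. f \<omega> *\<^sub>R g \<omega>)"
  by (rule strongly_measurable_compose2[OF borel_strongly_measurable[OF assms(1)] assms(2)])
    (auto intro!: continuous_intros)

lemma strongly_measurable_sum:
  fixes f :: "'i \<Rightarrow> 'w \<Rightarrow> 'e::real_normed_vector"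
  assumes "\<And>i. i \<in> I \<Longrightarrow> strongly_measurable M (f i)"
  shows "strongly_measurable M (\<lambda>\<omega>. \<Sum>i\<in>I. f i \<omega>)"
  using assms
  by (induction I rule: infinite_finite_induct)
     (auto intro: strongly_measurable_const strongly_measurable_add)

lemma strongly_measurable_sum_list:
  fixes f :: "'i \<Rightarrow> 'w \<Rightarrow> 'e::real_normed_vector"
  assumes "\<And>i. i \<in> set S \<Longrightarrow> strongly_measurable M (f i)"
  shows "strongly_measurable M (\<lambda>\<omega>. \<Sum>i\<leftarrow>S. f i \<omega>)"
  using assms
  by (induction S) (auto intro: strongly_measurable_const strongly_measurable_add)

lemma strongly_measurable_blinfun:
  fixes f :: "'w \<Rightarrow> 'e::real_normed_vector" and x :: "'e \<Rightarrow>\<^sub>L 'f::real_normed_vector"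
  assumes "strongly_measurable M f"
  shows "strongly_measurable M (\<lambda>\<omega>. blinfun_apply x (f \<omega>))"
  by (rule strongly_measurable_compose2[OF assms assms, where h="\<lambda>u v. blinfun_apply x u"])
    (auto intro!: continuous_intros)

lemma simple_function_mono_sets:
  assumes "simple_function N f" "space N = space M" "sets N \<subseteq> sets M"
  shows "simple_function M f"
  using assms unfolding simple_function_def by auto

lemma strongly_measurable_mono_sets:
  assumes "strongly_measurable N f" "space N = space M" "sets N \<subseteq> sets M"
  shows "strongly_measurable M f"
  using assms simple_function_mono_sets[OF _ assms(2,3)] unfolding strongly_measurable_def by metis

text \<open>Borel measurability of \<open>f\<close> and \<open>g\<close> would not do: in a
  non-separable space the difference of two Borel maps can fail to be Borel. This is why strong
  measurability is carried through the whole proof.\<close>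

lemma strongly_measurable_norm_diff:
  fixes f g :: "'w \<Rightarrow> 'e::real_normed_vector"
  assumes "strongly_measurable M f" "strongly_measurable M g"
  shows "(\<lambda>\<omega>. norm (f \<omega> - g \<omega>)) \<in> borel_measurable M"
  by (rule measurable_compose[OF strongly_measurable_borel[OF strongly_measurable_diff[OF assms]]]) simp

section \<open>Convergence in probability and approximation by simple functions\<close>

lemma (in finite_measure) measure_tendsto_0:
  assumes [measurable]: "\<And>n. A n \<in> sets M"
    and ev: "AE \<omega> in M. \<forall>\<^sub>F n in sequentially. \<omega> \<notin> A n"
  shows "(\<lambda>n. measure M (A n)) \<longlonglongrightarrow> 0"
proof -
  have "(\<lambda>n. \<integral>\<omega>. indicator (A n) \<omega> \<partial>M) \<longlonglongrightarrow> (\<integral>\<omega>. 0 \<partial>M :: real)"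
  proof (rule integral_dominated_convergence[where w="\<lambda>_. 1"])
    show "AE \<omega> in M. (\<lambda>n. indicator (A n) \<omega> :: real) \<longlonglongrightarrow> 0"
      using ev
    proof eventually_elim
      case (elim \<omega>)
      then have "\<forall>\<^sub>F n in sequentially. indicator (A n) \<omega> = (0::real)"
        by eventually_elim auto
      then show ?case by (rule tendsto_eventually)
    qed
  qed (auto simp: indicator_def)
  then show ?thesis by simp
qed

text \<open>Events that are not measurable have measure \<open>0\<close> by convention, so that only the measurable ones
  among those in \<open>tends_in_prob\<close> matter.\<close>

lemma (in prob_space) tends_in_prob_AE:
  assumes lim: "AE \<omega> in M. (\<lambda>n. d (X n \<omega>) (Y \<omega>)) \<longlonglongrightarrow> 0"
  shows "tends_in_prob M d X Y"
  unfolding tends_in_prob_def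
proof (intro allI impI)
  fix \<epsilon> :: real assume "\<epsilon> > 0"
  interpret C: prob_space "completion M" by (rule prob_space_completion)
  define B where "B n = {\<omega>\<in>space M. d (X n \<omega>) (Y \<omega>) > \<epsilon>}" for n
  define A where "A n = (if B n \<in> sets (completion M) then B n else {})" for n
  have "AE \<omega> in M. \<forall>\<^sub>F n in sequentially. \<omega> \<notin> A n"
    using lim
  proof eventually_elim
    case (elim \<omega>)
    from order_tendstoD(2)[OF elim \<open>\<epsilon> > 0\<close>] show ?case
      by eventually_elim (auto simp: A_def B_def)
  qed
  then have "(\<lambda>n. measure (completion M) (A n)) \<longlonglongrightarrow> 0"
    by (intro C.measure_tendsto_0) (auto simp: A_def AE_completion)
  moreover have "measure (completion M) (A n) = measure (completion M) (B n)" for n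
    by (auto simp: A_def measure_notin_sets)
  ultimately show "(\<lambda>n. measure (completion M) {\<omega> \<in> space M. \<epsilon> < d (X n \<omega>) (Y \<omega>)}) \<longlonglongrightarrow> 0"
    by (simp add: B_def)
qed

lemma (in prob_space) simple_approx:
  fixes f :: "'a \<Rightarrow> 'e::real_normed_vector"
  assumes f: "strongly_measurable M f" and "0 < \<epsilon>" "0 < \<delta>"
  shows "\<exists>g. simple_function M g \<and> prob {\<omega>\<in>space M. norm (g \<omega> - f \<omega>) > \<epsilon>} < \<delta>"
proof -
  obtain s where s: "\<And>n. simple_function M (s n)" "\<And>\<omega>. \<omega> \<in> space M \<Longrightarrow> (\<lambda>n. s n \<omega>) \<longlonglongrightarrow> f \<omega>"
    using f unfolding strongly_measurable_def by blast
  have [measurable]: "(\<lambda>\<omega>. norm (s n \<omega> - f \<omega>)) \<in> borel_measurable M" for n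
    by (intro strongly_measurable_norm_diff strongly_measurable_simple s f)
  have "(\<lambda>n. prob {\<omega>\<in>space M. norm (s n \<omega> - f \<omega>) > \<epsilon>}) \<longlonglongrightarrow> 0"
  proof (rule measure_tendsto_0)
    show "AE \<omega> in M. \<forall>\<^sub>F n in sequentially. \<omega> \<notin> {\<omega> \<in> space M. \<epsilon> < norm (s n \<omega> - f \<omega>)}"
    proof (rule AE_I2)
      fix \<omega> assume "\<omega> \<in> space M"
      then have "(\<lambda>n. norm (s n \<omega> - f \<omega>)) \<longlonglongrightarrow> 0"
        using s(2) by (simp add: LIM_zero tendsto_norm_zero)
      from order_tendstoD(2)[OF this \<open>0 < \<epsilon>\<close>]
      show "\<forall>\<^sub>F n in sequentially. \<omega> \<notin> {\<omega> \<in> space M. \<epsilon> < norm (s n \<omega> - f \<omega>)}"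
        by eventually_elim auto
    qed
  qed measurable
  from order_tendstoD(2)[OF this \<open>0 < \<delta>\<close>] obtain n
    where "prob {\<omega>\<in>space M. norm (s n \<omega> - f \<omega>) > \<epsilon>} < \<delta>"
    by (auto simp: eventually_sequentially)
  with s(1) show ?thesis by blast
qed

text \<open>Borel-Cantelli over the rows. The n-th approximant of a path is built from the
  \<open>N n\<close> entries of row n: coefficients of a step function in one application, values at
  interpolation nodes in the other.\<close>

lemma (in prob_space) simple_approx_array:
  fixes f :: "nat \<Rightarrow> nat \<Rightarrow> 'a \<Rightarrow> 'e::real_normed_vector"
  assumes f: "\<And>n k. strongly_measurable M (f n k)" and e: "\<And>n. 0 < e n"
  shows "\<exists>g. (\<forall>n k. simple_function M (g n k)) \<and>
     (AE \<omega> in M. \<forall>\<^sub>F n in sequentially. \<forall>k<N n. norm (g n k \<omega> - f n k \<omega>) \<le> e n)"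
proof -
  \<comment> \<open>The budget \<open>(1/2)^(n+k)\<close> sums over k to at most
    \<open>2 * (1/2)^n\<close> whatever the row length, and this is summable in n.\<close>
  have "\<exists>g. simple_function M g \<and> prob {\<omega>\<in>space M. norm (g \<omega> - f n k \<omega>) > e n} < (1/2)^(n+k)" for n k
    by (intro simple_approx f e) simp
  then obtain g where g: "\<And>n k. simple_function M (g n k)"
    and gp: "\<And>n k. prob {\<omega>\<in>space M. norm (g n k \<omega> - f n k \<omega>) > e n} < (1/2)^(n+k)"
    by metis
  have [measurable]: "(\<lambda>\<omega>. norm (g n k \<omega> - f n k \<omega>)) \<in> borel_measurable M" for n k
    by (intro strongly_measurable_norm_diff strongly_measurable_simple g f)
  define A where "A n k = {\<omega>\<in>space M. norm (g n k \<omega> - f n k \<omega>) > e n}" for n k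
  have [measurable]: "A n k \<in> sets M" for n k unfolding A_def by measurable
  have bound: "prob (\<Union>k<N n. A n k) \<le> 2 * (1/2)^n" for n
  proof -
    have "prob (\<Union>k<N n. A n k) \<le> (\<Sum>k<N n. prob (A n k))"
      by (intro finite_measure_subadditive_finite) auto
    also have "\<dots> \<le> (\<Sum>k<N n. (1/2)^n * (1/2)^k)"
      using gp by (intro sum_mono) (auto simp: A_def power_add less_imp_le)
    also have "\<dots> = (1/2)^n * (\<Sum>k<N n. (1/2)^k)" by (simp add: sum_distrib_left)
    also have "\<dots> \<le> (1/2)^n * 2"
      unfolding sum_gp_strict by (intro mult_left_mono) (auto simp: field_simps)
    finally show ?thesis by simp
  qed
  have "summable (\<lambda>n. prob (\<Union>k<N n. A n k))"
    by (rule summable_comparison_test'[of "\<lambda>n. 2 * (1/2)^n" 0])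
      (use bound in \<open>auto intro!: summable_mult summable_geometric\<close>)
  then have "AE \<omega> in M. \<forall>\<^sub>F n in sequentially. \<omega> \<in> space M - (\<Union>k<N n. A n k)"
    by (intro borel_cantelli_AE1) (auto simp: emeasure_eq_measure)
  then have "AE \<omega> in M. \<forall>\<^sub>F n in sequentially. \<forall>k<N n. norm (g n k \<omega> - f n k \<omega>) \<le> e n"
  proof eventually_elim
    case (elim \<omega>) then show ?case
      by eventually_elim (auto simp: A_def not_less)
  qed
  with g show ?thesis by blast
qed

text \<open>The values are functions of t. With deterministic weights, finiteness of the range and
  measurability of the level sets come from the \<open>g i\<close> alone; this yields the simple
  path-valued maps demanded by \<open>L0\<close>.\<close>

lemma simple_function_linear_combination:
  fixes g :: "nat \<Rightarrow> 'w \<Rightarrow> 'e::real_vector"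
  assumes "\<And>i. simple_function M (g i)"
  shows "simple_function M (\<lambda>\<omega> t. \<Sum>i<n::nat. w i t *\<^sub>R g i \<omega>)"
proof (induction n)
  case (Suc n)
  from simple_function_compose2[OF Suc assms[of n], of "\<lambda>f v t. f t + w n t *\<^sub>R v"]
  show ?case by simp
qed simp


section \<open>Step functions on a time grid\<close>

definition step_fun :: "(nat \<Rightarrow> real) \<Rightarrow> (nat \<Rightarrow> 'e::real_normed_vector) \<Rightarrow> real \<Rightarrow> 'e" where
  "step_fun s c t = (\<Sum>k. (indicator {s k<..s (Suc k)} t :: real) *\<^sub>R c k)"

text \<open>The pathwise integral of \<open>step_fun s c\<close> against \<open>w\<close>. For
  \<open>t \<le> s n\<close> the terms from n on vanish, so before \<open>b\<close> the series is a
  finite sum; its convergence at \<open>b\<close> itself is a separate matter.\<close>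

definition step_path ::
    "(nat \<Rightarrow> real) \<Rightarrow> (real \<Rightarrow> real) \<Rightarrow> (nat \<Rightarrow> 'e::real_normed_vector) \<Rightarrow> real \<Rightarrow> 'e" where
  "step_path s w c t = (\<Sum>k. (w (min (s (Suc k)) t) - w (min (s k) t)) *\<^sub>R c k)"

text \<open>Cofinality of the grid below \<open>b\<close> treats finite and infinite
  \<open>b\<close> alike. \<open>s 0\<close> may lie to the right of \<open>a\<close>; step
  functions on the grid vanish in between.\<close>

locale time_grid =
  fixes s :: "nat \<Rightarrow> real" and a :: real and b :: ereal
  assumes a_nonneg: "0 \<le> a" and s_strict_mono: "strict_mono s" and a_le_s0: "a \<le> s 0"
    and s_less_b: "ereal (s n) < b" and s_cofinal: "ereal t < b \<Longrightarrow> \<exists>n. t < s n"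
begin

abbreviation T :: "real set" where "T \<equiv> time_interval a b"

abbreviation mesh :: "nat \<Rightarrow> real" where "mesh k \<equiv> s (Suc k) - s k"

lemma s_less: "m < n \<Longrightarrow> s m < s n"
  using s_strict_mono by (simp add: strict_mono_less)

lemma s_le: "m \<le> n \<Longrightarrow> s m \<le> s n"
  using s_strict_mono by (simp add: strict_mono_less_eq)

lemma a_le_s: "a \<le> s n"
  using a_le_s0 s_le[of 0 n] by simp

lemma s_nonneg: "0 \<le> s n"
  using a_le_s a_nonneg by (meson order_trans)

lemma mesh_pos: "0 < mesh k"
  using s_less[of k "Suc k"] by simp

lemma s_in_T: "s n \<in> T"
  using a_le_s s_less_b[of n] by (auto simp: time_interval_def)

lemma T_nonempty: "T \<noteq> {}"
  using s_in_T by blast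

lemma interval_subset_T: "{a..s n} \<subseteq> T"
  using s_less_b[of n] by (auto simp: time_interval_def) (meson ereal_less_eq(3) less_imp_le order_trans)

lemma step_index_unique:
  assumes "s j < t" "t \<le> s (Suc j)" "s k < t" "t \<le> s (Suc k)"
  shows "j = k"
proof (rule linorder_cases[of j k])
  assume "j < k" then show ?thesis using s_le[of "Suc j" k] assms by simp
next
  assume "k < j" then show ?thesis using s_le[of "Suc k" j] assms by simp
qed

lemma step_fun_sums: "(\<lambda>k. (indicator {s k<..s (Suc k)} t :: real) *\<^sub>R c k) sums step_fun s c t"
proof (cases "\<exists>j. s j < t \<and> t \<le> s (Suc j)")
  case True
  then obtain j where j: "s j < t" "t \<le> s (Suc j)" by blast
  have "(\<lambda>k. (indicator {s k<..s (Suc k)} t :: real) *\<^sub>R c k) sums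
      (\<Sum>k\<in>{j}. (indicator {s k<..s (Suc k)} t :: real) *\<^sub>R c k)"
    by (rule sums_finite) (use step_index_unique[OF j] in \<open>auto simp: indicator_def\<close>)
  then show ?thesis unfolding step_fun_def by (rule sums_summable[THEN summable_sums])
next
  case False
  then have "(\<lambda>k. (indicator {s k<..s (Suc k)} t :: real) *\<^sub>R c k) = (\<lambda>_. 0)"
    by (auto simp: indicator_def fun_eq_iff)
  then show ?thesis unfolding step_fun_def by simp
qed

lemma step_fun_eq:
  assumes "s j < t" "t \<le> s (Suc j)"
  shows "step_fun s c t = c j"
proof -
  have "(\<lambda>k. (indicator {s k<..s (Suc k)} t :: real) *\<^sub>R c k) sums
      (\<Sum>k\<in>{j}. (indicator {s k<..s (Suc k)} t :: real) *\<^sub>R c k)"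
    by (rule sums_finite) (use step_index_unique[OF assms] in \<open>auto simp: indicator_def\<close>)
  with step_fun_sums[of t c] have "step_fun s c t = (\<Sum>k\<in>{j}. (indicator {s k<..s (Suc k)} t :: real) *\<^sub>R c k)"
    by (rule sums_unique2)
  then show ?thesis using assms by simp
qed

lemma step_fun_eq_0:
  assumes "\<And>j. \<not> (s j < t \<and> t \<le> s (Suc j))"
  shows "step_fun s c t = 0"
proof -
  have "(\<lambda>k. (indicator {s k<..s (Suc k)} t :: real) *\<^sub>R c k) = (\<lambda>_. 0)"
    using assms by (auto simp: indicator_def fun_eq_iff)
  then show ?thesis unfolding step_fun_def by simp
qed

text \<open>Which interval contains \<open>t\<close> does not depend on the coefficients, so a
  single index serves vector-valued and real coefficients at once. Hence functionals and squares can
  be moved to the coefficients.\<close>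

lemma step_fun_cases:
  obtains j where "s j < t" "t \<le> s (Suc j)" "\<And>c :: nat \<Rightarrow> 'e::real_normed_vector. step_fun s c t = c j"
      "\<And>c :: nat \<Rightarrow> real. step_fun s c t = c j"
  | "\<And>c :: nat \<Rightarrow> 'e. step_fun s c t = 0" "\<And>c :: nat \<Rightarrow> real. step_fun s c t = 0"
  using step_fun_eq step_fun_eq_0 by metis

lemma step_fun_blinfun:
  "blinfun_apply x (step_fun s c t) = step_fun s (\<lambda>k. blinfun_apply x (c k)) t"
  for x :: "'e::real_normed_vector \<Rightarrow>\<^sub>L real"
  by (rule step_fun_cases[of t, where 'e='e]) simp_all

lemma step_fun_power2_diff:
  "(step_fun s c t - step_fun s c' t)\<^sup>2 = step_fun s (\<lambda>k. (c k - c' k)\<^sup>2) t" for c c' :: "nat \<Rightarrow> real"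
  by (rule step_fun_cases[of t, where 'e=real]) simp_all

lemma step_fun_finite:
  assumes "\<And>k. n \<le> k \<Longrightarrow> c k = 0"
  shows "step_fun s c t = (\<Sum>k<n. (indicator {s k<..s (Suc k)} t :: real) *\<^sub>R c k)"
  unfolding step_fun_def by (rule suminf_finite) (use assms in auto)

lemma step_process_eq:
  "step_process (map (\<lambda>k. (s k, s (Suc k), \<eta> k)) [0..<n]) t \<omega> =
   step_fun s (\<lambda>k. if k < n then \<eta> k \<omega> else 0) t"
proof -
  have "step_fun s (\<lambda>k. if k < n then \<eta> k \<omega> else 0) t =
      (\<Sum>k<n. (indicator {s k<..s (Suc k)} t :: real) *\<^sub>R (if k < n then \<eta> k \<omega> else 0))"
    by (rule step_fun_finite) simp
  also have "\<dots> = (\<Sum>k<n. (indicator {s k<..s (Suc k)} t :: real) *\<^sub>R \<eta> k \<omega>)"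
    by (intro sum.cong) auto
  finally show ?thesis
    by (simp add: step_process_def comp_def interv_sum_list_conv_sum_set_nat atLeast0LessThan)
qed

lemma step_fun_measurable [measurable]: "step_fun s c \<in> borel_measurable borel" for c :: "nat \<Rightarrow> real"
  unfolding step_fun_def[abs_def] by measurable

lemma step_fun_nonneg: "(\<And>k. 0 \<le> c k) \<Longrightarrow> 0 \<le> step_fun s c t" for c :: "nat \<Rightarrow> real"
  by (rule step_fun_cases[of t, where 'e=real]) simp_all

lemma step_fun_outside_T: "t \<notin> T \<Longrightarrow> step_fun s c t = 0"
proof (rule step_fun_eq_0)
  fix j assume "t \<notin> T"
  then show "\<not> (s j < t \<and> t \<le> s (Suc j))"
    using interval_subset_T[of "Suc j"] a_le_s[of j] by (auto dest!: subsetD[of _ _ t])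
qed

lemma step_fun_has_integral:
  fixes c :: "nat \<Rightarrow> real"
  assumes c: "\<And>k. 0 \<le> c k" and sum: "summable (\<lambda>k. c k * mesh k)"
  shows "has_bochner_integral (restrict_space lborel T) (step_fun s c) (\<Sum>k. c k * mesh k)"
proof -
  have cm: "0 \<le> c k * mesh k" for k using c[of k] mesh_pos[of k] by simp
  have T: "T \<in> sets borel"
  proof -
    have "{t. a \<le> t \<and> ereal t \<le> b} \<in> sets borel" by measurable
    then show ?thesis by (simp add: time_interval_def)
  qed
  have "(\<integral>\<^sup>+t. ennreal (step_fun s c t) \<partial>lborel) =
      (\<integral>\<^sup>+t. (\<Sum>k. ennreal (indicator {s k<..s (Suc k)} t * c k)) \<partial>lborel)"
  proof (intro nn_integral_cong)
    fix t
    have "(\<lambda>k. indicator {s k<..s (Suc k)} t * c k) sums step_fun s c t"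
      using step_fun_sums[of t c] by simp
    then show "ennreal (step_fun s c t) = (\<Sum>k. ennreal (indicator {s k<..s (Suc k)} t * c k))"
      by (intro suminf_ennreal_eq[symmetric]) (simp_all add: c)
  qed
  also have "\<dots> = (\<Sum>k. \<integral>\<^sup>+t. ennreal (indicator {s k<..s (Suc k)} t * c k) \<partial>lborel)"
    by (rule nn_integral_suminf) measurable
  also have "\<dots> = (\<Sum>k. ennreal (c k * mesh k))"
  proof (intro suminf_cong)
    fix k
    have "(\<integral>\<^sup>+t. ennreal (indicator {s k<..s (Suc k)} t * c k) \<partial>lborel) =
        (\<integral>\<^sup>+t. ennreal (c k) * indicator {s k<..s (Suc k)} t \<partial>lborel)"
      by (intro nn_integral_cong) (auto simp: indicator_def)
    also have "\<dots> = ennreal (c k * mesh k)"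
      using c[of k] mesh_pos[of k] by (simp add: nn_integral_cmult_indicator ennreal_mult'')
    finally show "(\<integral>\<^sup>+t. ennreal (indicator {s k<..s (Suc k)} t * c k) \<partial>lborel) = ennreal (c k * mesh k)" .
  qed
  also have "\<dots> = ennreal (\<Sum>k. c k * mesh k)"
    by (rule suminf_ennreal_eq) (rule cm, rule summable_sums[OF sum])
  finally have "has_bochner_integral lborel (step_fun s c) (\<Sum>k. c k * mesh k)"
    by (intro has_bochner_integral_nn_integral)
       (auto intro!: step_fun_nonneg suminf_nonneg sum cm c)
  moreover have "(\<lambda>t. indicator T t *\<^sub>R step_fun s c t) = step_fun s c"
    using step_fun_outside_T[of _ c] by (auto simp: indicator_def fun_eq_iff)
  ultimately show ?thesis
    using T by (simp add: has_bochner_integral_restrict_space)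
qed

lemma step_fun_L2:
  fixes c :: "nat \<Rightarrow> real"
  assumes "summable (\<lambda>k. (c k)\<^sup>2 * mesh k)"
  shows "step_fun s c \<in> L2 a b"
proof -
  have "has_bochner_integral (restrict_space lborel T) (step_fun s (\<lambda>k. (c k)\<^sup>2)) (\<Sum>k. (c k)\<^sup>2 * mesh k)"
    by (intro step_fun_has_integral assms) simp
  moreover have "step_fun s (\<lambda>k. (c k)\<^sup>2) = (\<lambda>t. (step_fun s c t)\<^sup>2)"
    using step_fun_power2_diff[of c _ "\<lambda>_. 0"] by (simp add: fun_eq_iff step_fun_def)
  ultimately have "integrable (restrict_space lborel T) (\<lambda>t. (step_fun s c t)\<^sup>2)"
    by (auto dest: has_bochner_integral_iff[THEN iffD1])
  moreover have "step_fun s c \<in> borel_measurable (restrict_space lborel T)"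
    by (intro measurable_restrict_space1) simp
  ultimately show ?thesis by (simp add: L2_def)
qed

lemma step_fun_L2_dist:
  fixes c c' :: "nat \<Rightarrow> real"
  assumes "summable (\<lambda>k. (c k - c' k)\<^sup>2 * mesh k)"
  shows "L2_dist a b (step_fun s c) (step_fun s c') = sqrt (\<Sum>k. (c k - c' k)\<^sup>2 * mesh k)"
  using has_bochner_integral_integral_eq[OF step_fun_has_integral[OF _ assms]]
  by (simp add: L2_dist_def step_fun_power2_diff)

text \<open>The two errors of an approximation are separated: the neglected tail of
  \<open>c\<close>, and the replacement of \<open>c\<close> by \<open>c'\<close> on the first n
  intervals. Simple coefficients use both terms, pure truncation has \<open>c' = c\<close>.\<close>

lemma truncation_sums:
  fixes c c' :: "nat \<Rightarrow> real"
  assumes "summable (\<lambda>k. (c k)\<^sup>2 * mesh k)"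
  shows "(\<lambda>k. ((if k < n then c' k else 0) - c k)\<^sup>2 * mesh k) sums
    ((\<Sum>k. (c (k + n))\<^sup>2 * mesh (k + n)) + (\<Sum>k<n. (c' k - c k)\<^sup>2 * mesh k))"
proof -
  let ?f = "\<lambda>k. ((if k < n then c' k else 0) - c k)\<^sup>2 * mesh k"
  have "(\<lambda>k. (c (k + n))\<^sup>2 * mesh (k + n)) sums (\<Sum>k. (c (k + n))\<^sup>2 * mesh (k + n))"
    using summable_ignore_initial_segment[OF assms, of n] by (intro summable_sums) simp
  then have "(\<lambda>k. ?f (k + n)) sums (\<Sum>k. (c (k + n))\<^sup>2 * mesh (k + n))" by simp
  then have "?f sums ((\<Sum>k. (c (k + n))\<^sup>2 * mesh (k + n)) + (\<Sum>k<n. ?f k))"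
    by (subst (asm) sums_iff_shift) simp
  then show ?thesis by simp
qed

lemma L2_dist_truncation:
  fixes c c' :: "nat \<Rightarrow> real"
  assumes "summable (\<lambda>k. (c k)\<^sup>2 * mesh k)"
  shows "L2_dist a b (step_fun s (\<lambda>k. if k < n then c' k else 0)) (step_fun s c) =
    sqrt ((\<Sum>k. (c (k + n))\<^sup>2 * mesh (k + n)) + (\<Sum>k<n. (c' k - c k)\<^sup>2 * mesh k))"
  using truncation_sums[OF assms, of n c'] by (subst step_fun_L2_dist) (auto simp: sums_iff)

end

lemma (in prob_space) step_fun_L0_L2:
  fixes c :: "nat \<Rightarrow> 'a \<Rightarrow> real"
  assumes "time_grid s a b" and c: "\<And>k. c k \<in> borel_measurable M"
    and sum: "AE \<omega> in M. summable (\<lambda>k. (c k \<omega>)\<^sup>2 * (s (Suc k) - s k))"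
  shows "(\<lambda>\<omega>. step_fun s (\<lambda>k. c k \<omega>)) \<in> L0 M (L2 a b) (L2_dist a b)"
proof -
  interpret time_grid s a b by fact
  \<comment> \<open>The total length \<open>s n - s 0\<close> is unbounded if
    \<open>b = \<infinity>\<close>, so the admissible coefficient error must shrink with it:
    \<open>(e n)\<^sup>2 * (s n - s 0) \<le> 1 / real (Suc n)\<close>. The added 1 keeps the
    denominator positive at n = 0.\<close>
  define e where "e n = 1 / (real (Suc n) * (1 + (s n - s 0)))" for n
  have pos: "0 < 1 + (s n - s 0)" for n using s_le[of 0 n] by simp
  have e_pos: "0 < e n" for n using pos[of n] by (simp add: e_def)
  obtain g where g: "\<And>n k. simple_function M (g n k)"
    and g_ae: "AE \<omega> in M. \<forall>\<^sub>F n in sequentially. \<forall>k<n. norm (g n k \<omega> - c k \<omega>) \<le> e n"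
    using simple_approx_array[of "\<lambda>n k. c k" e "\<lambda>n. n"] e_pos borel_strongly_measurable[OF c] by auto
  define S where "S n \<omega> = step_fun s (\<lambda>k. if k < n then g n k \<omega> else 0)" for n \<omega>
  have S_simple: "simple_function M (S n)" for n
  proof -
    have "S n = (\<lambda>\<omega> t. \<Sum>k<n. (indicator {s k<..s (Suc k)} t :: real) *\<^sub>R g n k \<omega>)"
      unfolding S_def by (intro ext, subst step_fun_finite[of n]) (auto intro!: sum.cong)
    then show ?thesis by (simp only:) (rule simple_function_linear_combination[OF g])
  qed
  have S_L2: "S n \<omega> \<in> L2 a b" for n \<omega>
    unfolding S_def
    by (intro step_fun_L2 summable_finite[of "{..<n}"]) auto
  have lim: "AE \<omega> in M. (\<lambda>n. L2_dist a b (S n \<omega>) (step_fun s (\<lambda>k. c k \<omega>))) \<longlonglongrightarrow> 0"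
    using sum g_ae
  proof eventually_elim
    case (elim \<omega>)
    let ?R = "\<lambda>n. (\<Sum>k. (c (k + n) \<omega>)\<^sup>2 * mesh (k + n))"
    let ?Q = "\<lambda>n. (\<Sum>k<n. (g n k \<omega> - c k \<omega>)\<^sup>2 * mesh k)"
    have "?R \<longlonglongrightarrow> 0"
      using suminf_exist_split2[OF elim(1)] by simp
    moreover have "?Q \<longlonglongrightarrow> 0"
    proof (rule tendsto_sandwich)
      show "\<forall>\<^sub>F n in sequentially. 0 \<le> ?Q n"
        using mesh_pos by (intro always_eventually allI sum_nonneg mult_nonneg_nonneg) (auto intro: less_imp_le)
      show "\<forall>\<^sub>F n in sequentially. ?Q n \<le> 1 / real (Suc n)"
        using elim(2)
      proof eventually_elim
        case (elim n)
        have "?Q n \<le> (\<Sum>k<n. (e n)\<^sup>2 * mesh k)"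
        proof (intro sum_mono mult_right_mono)
          fix k assume "k \<in> {..<n}"
          then have "\<bar>g n k \<omega> - c k \<omega>\<bar> \<le> e n" using elim by simp
          then show "(g n k \<omega> - c k \<omega>)\<^sup>2 \<le> (e n)\<^sup>2"
            using e_pos[of n] by (simp add: abs_le_square_iff[symmetric])
        qed (use mesh_pos less_imp_le in blast)
        also have "\<dots> = (e n)\<^sup>2 * (s n - s 0)"
          by (simp add: sum_distrib_left[symmetric] sum_lessThan_telescope)
        also have "\<dots> = e n * (1 / real (Suc n)) * ((s n - s 0) / (1 + (s n - s 0)))"
          by (simp add: e_def power2_eq_square)
        also have "\<dots> \<le> 1 * (1 / real (Suc n)) * 1"
        proof (intro mult_mono)
          have "1 * 1 \<le> real (Suc n) * (1 + (s n - s 0))"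
            using s_le[of 0 n] by (intro mult_mono) auto
          then show "e n \<le> 1" unfolding e_def by (simp add: divide_le_eq_1)
        qed (use s_le[of 0 n] e_pos[of n] in \<open>auto intro!: mult_nonneg_nonneg\<close>)
        finally show ?case by simp
      qed
      show "(\<lambda>n. 1 / real (Suc n)) \<longlonglongrightarrow> 0" using LIMSEQ_inverse_real_of_nat by (simp add: inverse_eq_divide)
    qed simp
    ultimately have "(\<lambda>n. sqrt (?R n + ?Q n)) \<longlonglongrightarrow> sqrt (0 + 0)"
      by (intro tendsto_intros)
    then show ?case
      by (simp add: S_def L2_dist_truncation[OF elim(1)])
  qed
  show ?thesis
    unfolding L0_def
  proof (intro CollectI conjI exI[of _ S] allI)
    show "AE \<omega> in M. step_fun s (\<lambda>k. c k \<omega>) \<in> L2 a b"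
      using sum by eventually_elim (rule step_fun_L2)
  qed (use S_simple S_L2 lim in auto)
qed


section \<open>Paths in \<open>C\<^sub>b\<close>\<close>

text \<open>The uniform bound also makes the set of norms bounded above, without which the real
  supremum would carry no information.\<close>

lemma Cb_dist_le:
  assumes "time_interval a b \<noteq> {}" "\<And>t. t \<in> time_interval a b \<Longrightarrow> norm (f t - g t) \<le> e"
  shows "\<bar>Cb_dist a b f g\<bar> \<le> e"
proof -
  have "Cb_dist a b f g \<le> e"
    unfolding Cb_dist_def by (rule cSUP_least) (use assms in auto)
  moreover have "0 \<le> Cb_dist a b f g"
  proof -
    obtain t where t: "t \<in> time_interval a b" using assms(1) by blast
    have "norm (f t - g t) \<le> Cb_dist a b f g"
      unfolding Cb_dist_def by (rule cSUP_upper[OF t]) (use assms(2) in \<open>auto intro!: bdd_aboveI\<close>)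
    then show ?thesis by (meson norm_ge_zero order_trans)
  qed
  ultimately show ?thesis by simp
qed

context time_grid
begin

text \<open>If \<open>b\<close> is finite, then \<open>b\<close> itself is one of the times \<open>t\<close>.\<close>

definition tail_limit :: "(real \<Rightarrow> 'e::real_normed_vector) \<Rightarrow> 'e \<Rightarrow> bool" where
  "tail_limit z x \<longleftrightarrow> (\<forall>\<epsilon>>0. \<exists>n. \<forall>t\<in>T. s n \<le> t \<longrightarrow> norm (z t - x) < \<epsilon>)"

lemma tail_limit_end:
  assumes "tail_limit z x"
  shows "if b = \<infinity> then (z \<longlongrightarrow> x) at_top else z (real_of_ereal b) = x"
proof (cases b)
  case (real r)
  have "norm (z r - x) \<le> 0 + e" if "e > 0" for e
  proof -
    from assms that obtain n where "\<forall>t\<in>T. s n \<le> t \<longrightarrow> norm (z t - x) < e"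
      unfolding tail_limit_def by blast
    moreover have "r \<in> T" "s n \<le> r"
      using s_less_b[of n] a_le_s[of n] real by (auto simp: time_interval_def)
    ultimately show ?thesis by auto
  qed
  then have "norm (z r - x) \<le> 0" by (rule field_le_epsilon)
  then show ?thesis using real by simp
next
  case PInf
  have "(z \<longlongrightarrow> x) at_top"
  proof (rule tendstoI)
    fix e :: real assume "e > 0"
    with assms obtain n where n: "\<forall>t\<in>T. s n \<le> t \<longrightarrow> norm (z t - x) < e"
      unfolding tail_limit_def by blast
    show "\<forall>\<^sub>F t in at_top. dist (z t) x < e"
      using eventually_ge_at_top[of "s n"]
    proof eventually_elim
      case (elim t)
      then have "t \<in> T" using a_le_s[of n] PInf by (auto simp: time_interval_def)
      with n elim show ?case by (simp add: dist_norm)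
    qed
  qed
  with PInf show ?thesis by simp
next
  case MInf then show ?thesis using s_less_b[of 0] by simp
qed

lemma tail_limit_uniformly_continuous:
  assumes cont: "\<And>n. continuous_on {a..s n} z" and tail: "tail_limit z x"
  shows "uniformly_continuous_on T z"
  unfolding uniformly_continuous_on_def
proof (intro allI impI)
  fix e :: real assume "e > 0"
  then obtain n where n: "\<And>t. t \<in> T \<Longrightarrow> s n \<le> t \<Longrightarrow> norm (z t - x) < e / 2"
    using tail unfolding tail_limit_def by (meson half_gt_zero)
  have "uniformly_continuous_on {a..s (Suc n)} z"
    by (intro compact_uniformly_continuous cont) simp
  then obtain d where d: "d > 0"
    "\<And>t u. t \<in> {a..s (Suc n)} \<Longrightarrow> u \<in> {a..s (Suc n)} \<Longrightarrow> dist u t < d \<Longrightarrow> dist (z u) (z t) < e"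
    using \<open>e > 0\<close> unfolding uniformly_continuous_on_def by metis
  \<comment> \<open>The compact range \<open>{a..s (Suc n)}\<close> and the tail beyond
    \<open>s n\<close> overlap in an interval of length \<open>mesh n\<close>; two closer points
    therefore lie together in one of them.\<close>
  have "dist (z u) (z t) < e" if tu: "t \<in> T" "u \<in> T" "dist u t < min d (mesh n)" for t u
  proof (cases "t \<le> s (Suc n) \<and> u \<le> s (Suc n)")
    case True
    then show ?thesis using tu by (intro d(2)) (auto simp: time_interval_def)
  next
    case False
    then have "s n \<le> t" "s n \<le> u" using tu(3) by (auto simp: dist_real_def)
    then have "norm (z t - x) < e / 2" "norm (z u - x) < e / 2" using n tu by auto
    then show ?thesis by (metis dist_norm dist_triangle_half_r dist_commute)
  qed
  then show "\<exists>d>0. \<forall>t\<in>T. \<forall>u\<in>T. dist u t < d \<longrightarrow> dist (z u) (z t) < e"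
    using d(1) mesh_pos[of n] by (intro exI[of _ "min d (mesh n)"]) auto
qed

lemma tail_limit_Cb:
  assumes cont: "\<And>n. continuous_on {a..s n} z" and tail: "tail_limit z x"
  shows "z \<in> Cb a b"
proof -
  obtain n where n: "\<And>t. t \<in> T \<Longrightarrow> s n \<le> t \<Longrightarrow> norm (z t - x) < 1"
    using tail unfolding tail_limit_def by (meson zero_less_one)
  have "bounded (z ` {a..s n})"
    by (intro compact_imp_bounded compact_continuous_image cont) simp
  moreover have "bounded (cball x 1)" by simp
  moreover have "z ` T \<subseteq> z ` {a..s n} \<union> cball x 1"
    using n by (force simp: time_interval_def dist_norm norm_minus_commute not_le)
  ultimately have "bounded (z ` T)" by (meson bounded_Un bounded_subset)
  then show ?thesis
    using uniformly_continuous_imp_continuous[OF tail_limit_uniformly_continuous[OF assms]]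
    by (simp add: Cb_def)
qed

text \<open>The integral of the integrand truncated after n intervals is the limiting path frozen at
  \<open>s n\<close>; this gives convergence of the step integrals in \<open>Cb\<close>.\<close>

lemma tail_limit_stopped:
  assumes tail: "tail_limit z x"
  shows "(\<lambda>n. Cb_dist a b (\<lambda>t. z (min t (s n))) z) \<longlonglongrightarrow> 0"
proof (rule LIMSEQ_I)
  fix e :: real assume "e > 0"
  then obtain n0 where n0: "\<And>t. t \<in> T \<Longrightarrow> s n0 \<le> t \<Longrightarrow> norm (z t - x) < e / 4"
    using tail unfolding tail_limit_def by (meson divide_pos_pos zero_less_numeral)
  have "\<bar>Cb_dist a b (\<lambda>t. z (min t (s n))) z\<bar> \<le> e / 2" if "n0 \<le> n" for n
  proof (rule Cb_dist_le[OF T_nonempty])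
    fix t assume t: "t \<in> T"
    show "norm (z (min t (s n)) - z t) \<le> e / 2"
    proof (cases "t \<le> s n")
      case False
      have "norm (z (s n) - x) < e / 4" "norm (z t - x) < e / 4"
        using n0[of t] n0[of "s n"] t False s_le[OF that] s_in_T[of n] by auto
      moreover have "norm (z (s n) - z t) \<le> norm (z (s n) - x) + norm (z t - x)"
        by (metis dist_norm dist_triangle2)
      ultimately show ?thesis using False by simp
    qed (use \<open>e > 0\<close> in simp)
  qed
  then show "\<exists>no. \<forall>n\<ge>no. norm (Cb_dist a b (\<lambda>t. z (min t (s n))) z - 0) < e"
    using \<open>e > 0\<close> by (intro exI[of _ n0]) (smt (verit) field_sum_of_halves real_norm_def diff_zero)
qed

section \<open>Interpolation of continuous paths from finitely many values\<close>

definition node :: "nat \<Rightarrow> nat \<Rightarrow> real" where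
  "node n i = min (s n) (a + real i / real (Suc n))"

text \<open>The largest index is the integer part of the rescaled length of \<open>{a..s n}\<close>,
  so that every time up to \<open>s n\<close> has a node at most one spacing to its left.\<close>

definition nodes :: "nat \<Rightarrow> nat" where
  "nodes n = Suc (nat \<lfloor>real (Suc n) * (s n - a)\<rfloor>)"

definition hat :: "nat \<Rightarrow> nat \<Rightarrow> real \<Rightarrow> real" where
  "hat n i t = max 0 (1 - \<bar>real (Suc n) * (min t (s n) - a) - real i\<bar>)"

text \<open>Neighbouring tents add up to one except behind the last node, where the next tent is
  missing. Division by this sum restores a partition of unity.\<close>

definition hat_sum :: "nat \<Rightarrow> real \<Rightarrow> real" where
  "hat_sum n t = (\<Sum>i<nodes n. hat n i t)"

text \<open>\<open>Cb\<close> need not be separable, so simple path-valued approximants are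
  constructed explicitly: a fixed linear map sends finitely many vectors to a path, and simple
  vectors to a simple map. The path is frozen after \<open>s n\<close> because \<open>hat\<close>
  sees only \<open>min t (s n)\<close>.\<close>

definition interpolate :: "nat \<Rightarrow> (nat \<Rightarrow> 'e::real_normed_vector) \<Rightarrow> real \<Rightarrow> 'e" where
  "interpolate n v t = (\<Sum>i<nodes n. (hat n i t / hat_sum n t) *\<^sub>R v i)"

lemma hat_nonneg: "0 \<le> hat n i t"
  by (simp add: hat_def)

lemma hat_sum_pos:
  assumes "a \<le> t"
  shows "0 < hat_sum n t"
proof -
  define r where "r = real (Suc n) * (min t (s n) - a)"
  have r: "0 \<le> r" using assms a_le_s[of n] by (simp add: r_def)
  have "r \<le> real (Suc n) * (s n - a)" unfolding r_def by (intro mult_left_mono) auto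
  then have "nat \<lfloor>r\<rfloor> < nodes n" unfolding nodes_def by (simp add: floor_mono nat_mono less_Suc_eq_le)
  moreover have "0 < hat n (nat \<lfloor>r\<rfloor>) t"
    using r unfolding hat_def r_def[symmetric] by (simp add: abs_if) linarith
  ultimately show ?thesis
    unfolding hat_sum_def by (intro sum_pos2[of _ "nat \<lfloor>r\<rfloor>"]) (auto simp: hat_nonneg)
qed

lemma node_in_T: "node n i \<in> T"
  using interval_subset_T[of n] a_le_s[of n] by (auto simp: node_def)

lemma node_close:
  assumes "0 < hat n i t"
  shows "\<bar>node n i - min t (s n)\<bar> < 1 / real (Suc n)"
proof -
  have "real (Suc n) * \<bar>a + real i / real (Suc n) - min t (s n)\<bar> =
      \<bar>real (Suc n) * (min t (s n) - a) - real i\<bar>"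
  proof -
    have "real (Suc n) * \<bar>a + real i / real (Suc n) - min t (s n)\<bar> =
        \<bar>real (Suc n) * (a + real i / real (Suc n) - min t (s n))\<bar>" by (simp add: abs_mult)
    also have "real (Suc n) * (a + real i / real (Suc n) - min t (s n)) =
        - (real (Suc n) * (min t (s n) - a) - real i)"
      by (simp add: ring_distribs del: of_nat_Suc)
    finally show ?thesis by (simp only: abs_minus_cancel)
  qed
  also have "\<dots> < 1" using assms by (simp add: hat_def split: if_splits)
  finally have "\<bar>a + real i / real (Suc n) - min t (s n)\<bar> < 1 / real (Suc n)"
    by (simp add: field_simps)
  then show ?thesis unfolding node_def by (auto simp: min_def abs_if split: if_splits)
qed

lemma interpolate_close:
  assumes t: "a \<le> t" and v: "\<And>i. i < nodes n \<Longrightarrow> norm (v i - z (node n i)) \<le> e1"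
    and z: "\<And>u. u \<in> T \<Longrightarrow> \<bar>u - min t (s n)\<bar> < 1 / real (Suc n) \<Longrightarrow> norm (z u - z (min t (s n))) \<le> e2"
  shows "norm (interpolate n v t - z (min t (s n))) \<le> e1 + e2"
proof -
  let ?w = "\<lambda>i. hat n i t / hat_sum n t"
  have pos: "0 < hat_sum n t" by (rule hat_sum_pos[OF t])
  have w1: "(\<Sum>i<nodes n. ?w i) = 1"
    using pos by (simp add: sum_divide_distrib[symmetric] hat_sum_def[symmetric])
  have "interpolate n v t - z (min t (s n)) = (\<Sum>i<nodes n. ?w i *\<^sub>R (v i - z (min t (s n))))"
    using w1 by (simp add: interpolate_def scaleR_diff_right sum_subtractf scaleR_left.sum[symmetric])
  also have "norm \<dots> \<le> (\<Sum>i<nodes n. ?w i * (e1 + e2))"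
  proof (rule sum_norm_le)
    fix i assume i: "i \<in> {..<nodes n}"
    \<comment> \<open>Nodes far from \<open>min t (s n)\<close> carry weight zero; only for the
      others does closeness to the node bound the value.\<close>
    show "norm (?w i *\<^sub>R (v i - z (min t (s n)))) \<le> ?w i * (e1 + e2)"
    proof (cases "hat n i t = 0")
      case False
      then have "0 < hat n i t" using hat_nonneg[of n i t] by simp
      then have "norm (z (node n i) - z (min t (s n))) \<le> e2"
        by (intro z node_in_T node_close)
      moreover have "norm (v i - z (min t (s n))) \<le>
          norm (v i - z (node n i)) + norm (z (node n i) - z (min t (s n)))"
        by (metis dist_norm dist_triangle)
      ultimately have "norm (v i - z (min t (s n))) \<le> e1 + e2" using v[of i] i by simp
      then show ?thesis using pos hat_nonneg[of n i t] by (simp add: mult_left_mono divide_right_mono)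
    qed simp
  qed
  also have "\<dots> = e1 + e2" unfolding sum_distrib_right[symmetric] w1 by simp
  finally show ?thesis .
qed

lemma interpolate_Cb: "interpolate n v \<in> Cb a b"
proof -
  have le1: "norm (hat n i t / hat_sum n t) \<le> 1" if "t \<in> T" "i < nodes n" for i t
  proof -
    have "hat n i t \<le> hat_sum n t"
      unfolding hat_sum_def by (rule member_le_sum) (use that hat_nonneg in auto)
    moreover have "0 < hat_sum n t" using that by (intro hat_sum_pos) (auto simp: time_interval_def)
    ultimately show ?thesis using hat_nonneg[of n i t] by simp
  qed
  have "continuous_on T (hat n i)" for i
    unfolding hat_def[abs_def] by (intro continuous_intros)
  moreover have "\<forall>t\<in>T. hat_sum n t \<noteq> 0"
  proof
    fix t assume "t \<in> T"
    then have "0 < hat_sum n t" by (intro hat_sum_pos) (simp add: time_interval_def)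
    then show "hat_sum n t \<noteq> 0" by simp
  qed
  ultimately have "continuous_on T (interpolate n v)"
    unfolding interpolate_def[abs_def] hat_sum_def by (intro continuous_intros) auto
  moreover have "norm (interpolate n v t) \<le> (\<Sum>i<nodes n. norm (v i))" if "t \<in> T" for t
    unfolding interpolate_def
  proof (rule sum_norm_le)
    fix i assume "i \<in> {..<nodes n}"
    then show "norm ((hat n i t / hat_sum n t) *\<^sub>R v i) \<le> norm (v i)"
      using mult_right_mono[OF le1[OF that, of i], of "norm (v i)"] by simp
  qed
  then have "bounded (interpolate n v ` T)" by (auto simp: bounded_iff)
  ultimately show ?thesis by (simp add: Cb_def)
qed

end

text \<open>Three errors are made small together: rounding the values at the nodes to simple
  functions, interpolating a uniformly continuous path on a finer and finer mesh, and freezing the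
  path at \<open>s n\<close>, which is harmless by the tail limit.\<close>

lemma (in prob_space) L0_Cb:
  fixes X :: "'a \<Rightarrow> real \<Rightarrow> 'e::real_normed_vector"
  assumes "time_grid s a b"
    and X: "\<And>t. t \<in> time_interval a b \<Longrightarrow> strongly_measurable M (\<lambda>\<omega>. X \<omega> t)"
    and cont: "AE \<omega> in M. \<forall>n. continuous_on {a..s n} (X \<omega>)"
    and tail: "AE \<omega> in M. time_grid.tail_limit s a b (X \<omega>) (x \<omega>)"
  shows "X \<in> L0 M (Cb a b) (Cb_dist a b)"
proof -
  interpret time_grid s a b by fact
  have "\<exists>g. (\<forall>n k. simple_function M (g n k)) \<and>
     (AE \<omega> in M. \<forall>\<^sub>F n in sequentially. \<forall>k<nodes n. norm (g n k \<omega> - X \<omega> (node n k)) \<le> 1 / real (Suc n))"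
    by (rule simple_approx_array[of "\<lambda>n k \<omega>. X \<omega> (node n k)"]) (auto intro: X node_in_T)
  then obtain g where g: "\<And>n k. simple_function M (g n k)"
    and g_ae: "AE \<omega> in M. \<forall>\<^sub>F n in sequentially. \<forall>k<nodes n. norm (g n k \<omega> - X \<omega> (node n k)) \<le> 1 / real (Suc n)"
    by blast
  define S where "S n \<omega> = interpolate n (\<lambda>i. g n i \<omega>)" for n \<omega>
  have "simple_function M (\<lambda>\<omega>. S n \<omega>)" for n
    unfolding S_def interpolate_def[abs_def] by (rule simple_function_linear_combination[OF g])
  then have S_simple: "simple_function M (S n)" for n by simp
  have "AE \<omega> in M. (\<lambda>n. Cb_dist a b (S n \<omega>) (X \<omega>)) \<longlonglongrightarrow> 0"
    using cont tail g_ae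
  proof eventually_elim
    case (elim \<omega>)
    show ?case
    proof (rule LIMSEQ_I)
      fix e :: real assume e: "e > 0"
      have "uniformly_continuous_on T (X \<omega>)"
        using elim by (intro tail_limit_uniformly_continuous) auto
      then obtain d where d: "d > 0"
        "\<And>t u. t \<in> T \<Longrightarrow> u \<in> T \<Longrightarrow> dist u t < d \<Longrightarrow> dist (X \<omega> u) (X \<omega> t) < e / 4"
        using e unfolding uniformly_continuous_on_def by (metis divide_pos_pos zero_less_numeral)
      obtain n0 where n0: "\<And>t. t \<in> T \<Longrightarrow> s n0 \<le> t \<Longrightarrow> norm (X \<omega> t - x \<omega>) < e / 8"
        using elim(2) e unfolding tail_limit_def by (meson divide_pos_pos zero_less_numeral)
      have e4: "0 < e / 4" using e by simp
      have lim0: "(\<lambda>n. 1 / real (Suc n)) \<longlonglongrightarrow> 0" using LIMSEQ_inverse_real_of_nat by (simp add: inverse_eq_divide)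
      have "\<forall>\<^sub>F n in sequentially. norm (Cb_dist a b (S n \<omega>) (X \<omega>) - 0) < e"
        using elim(3) order_tendstoD(2)[OF lim0 d(1)] order_tendstoD(2)[OF lim0 e4]
          eventually_ge_at_top[of n0]
      proof eventually_elim
        case (elim n)
        have "\<bar>Cb_dist a b (S n \<omega>) (X \<omega>)\<bar> \<le> e / 4 + e / 4 + e / 4"
        proof (rule Cb_dist_le[OF T_nonempty])
          fix t assume t: "t \<in> T"
          have ts: "min t (s n) \<in> T"
            using t s_in_T[of n] by (auto simp: min_def)
          have "norm (S n \<omega> t - X \<omega> (min t (s n))) \<le> e / 4 + e / 4"
            unfolding S_def
          proof (rule interpolate_close)
            show "a \<le> t" using t by (simp add: time_interval_def)
            show "norm (g n i \<omega> - X \<omega> (node n i)) \<le> e / 4" if "i < nodes n" for i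
              using elim(1,3) e that by force
            show "norm (X \<omega> u - X \<omega> (min t (s n))) \<le> e / 4"
              if "u \<in> T" "\<bar>u - min t (s n)\<bar> < 1 / real (Suc n)" for u
              using d(2)[OF ts that(1)] that(2) elim(2) by (auto simp: dist_norm)
          qed
          moreover have "norm (X \<omega> (min t (s n)) - X \<omega> t) \<le> e / 4"
          proof (cases "t \<le> s n")
            case False
            have "norm (X \<omega> (s n) - x \<omega>) < e / 8" "norm (X \<omega> t - x \<omega>) < e / 8"
              using n0[of t] n0[of "s n"] t False s_le[OF elim(4)] s_in_T[of n] by auto
            moreover have "norm (X \<omega> (s n) - X \<omega> t) \<le> norm (X \<omega> (s n) - x \<omega>) + norm (X \<omega> t - x \<omega>)"
              by (metis dist_norm dist_triangle2)
            ultimately show ?thesis using False by simp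
          qed (use e in simp)
          moreover have "norm (S n \<omega> t - X \<omega> t) \<le>
              norm (S n \<omega> t - X \<omega> (min t (s n))) + norm (X \<omega> (min t (s n)) - X \<omega> t)"
            by (metis dist_norm dist_triangle)
          ultimately show "norm (S n \<omega> t - X \<omega> t) \<le> e / 4 + e / 4 + e / 4" by linarith
        qed
        then show ?case using e by simp
      qed
      then show "\<exists>no. \<forall>n\<ge>no. norm (Cb_dist a b (S n \<omega>) (X \<omega>) - 0) < e"
        by (simp add: eventually_sequentially)
    qed
  qed
  moreover have "AE \<omega> in M. X \<omega> \<in> Cb a b"
    using cont tail by eventually_elim (auto intro: tail_limit_Cb)
  ultimately show ?thesis
    unfolding L0_def using S_simple by (auto simp: S_def intro!: exI[of _ S] interpolate_Cb)
qed

section \<open>Integral paths of step functions and their extension to the end point\<close>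

context time_grid
begin

lemma step_path_finite:
  assumes "t \<le> s n"
  shows "step_path s w c t = (\<Sum>k<n. (w (min (s (Suc k)) t) - w (min (s k) t)) *\<^sub>R c k)"
  unfolding step_path_def
proof (rule suminf_finite)
  fix k assume "k \<notin> {..<n}"
  then have "t \<le> s k" "t \<le> s (Suc k)" using assms s_le[of n k] s_le[of n "Suc k"] by auto
  then show "(w (min (s (Suc k)) t) - w (min (s k) t)) *\<^sub>R c k = 0" by (simp add: min_absorb2)
qed simp

lemma step_path_grid: "step_path s w c (s n) = (\<Sum>k<n. (w (s (Suc k)) - w (s k)) *\<^sub>R c k)"
  unfolding step_path_finite[OF order_refl]
  by (intro sum.cong) (auto simp: min_absorb1 s_le less_imp_le)

lemma step_path_between:
  assumes "s n \<le> t" "t \<le> s (Suc n)"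
  shows "step_path s w c t = step_path s w c (s n) + (w t - w (s n)) *\<^sub>R c n"
proof -
  have "(\<Sum>k<n. (w (min (s (Suc k)) t) - w (min (s k) t)) *\<^sub>R c k) =
      (\<Sum>k<n. (w (s (Suc k)) - w (s k)) *\<^sub>R c k)"
  proof (intro sum.cong refl)
    fix k assume "k \<in> {..<n}"
    then have "s k \<le> t" "s (Suc k) \<le> t" using s_le[of k n] s_le[of "Suc k" n] assms by auto
    then show "(w (min (s (Suc k)) t) - w (min (s k) t)) *\<^sub>R c k = (w (s (Suc k)) - w (s k)) *\<^sub>R c k"
      by (simp add: min_absorb1)
  qed
  then show ?thesis
    using assms by (simp add: step_path_finite[OF assms(2)] step_path_grid min_absorb1 min_absorb2)
qed

lemma step_path_continuous:
  assumes w: "continuous_on {0..} w"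
  shows "continuous_on {a..s n} (step_path s w c)"
proof -
  have "continuous_on {a..s n} (\<lambda>t. w (min r t))" if "0 \<le> r" for r
    by (rule continuous_on_compose2[OF w]) (use that a_nonneg in \<open>auto intro!: continuous_intros\<close>)
  then have "continuous_on {a..s n} (\<lambda>t. \<Sum>k<n. (w (min (s (Suc k)) t) - w (min (s k) t)) *\<^sub>R c k)"
    using s_nonneg by (intro continuous_intros) auto
  then show ?thesis
    by (rule continuous_on_eq) (simp add: step_path_finite[of _ n])
qed

text \<open>Omitting the terms from n on amounts to stopping the time argument at
  \<open>s n\<close>. The right-hand side keeps all coefficients, so one path serves every
  n.\<close>

lemma step_integral_eq:
  "step_integral W (map (\<lambda>k. (s k, s (Suc k), \<eta> k)) [0..<n]) t \<omega> =
   step_path s (\<lambda>u. W u \<omega>) (\<lambda>k. \<eta> k \<omega>) (min t (s n))"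
proof -
  have "step_integral W (map (\<lambda>k. (s k, s (Suc k), \<eta> k)) [0..<n]) t \<omega> =
      (\<Sum>k<n. (W (min (s (Suc k)) t) \<omega> - W (min (s k) t) \<omega>) *\<^sub>R \<eta> k \<omega>)"
    by (simp add: step_integral_def comp_def interv_sum_list_conv_sum_set_nat atLeast0LessThan)
  also have "\<dots> = (\<Sum>k<n. (W (min (s (Suc k)) (min t (s n))) \<omega> - W (min (s k) (min t (s n))) \<omega>) *\<^sub>R \<eta> k \<omega>)"
  proof (intro sum.cong refl)
    fix k assume "k \<in> {..<n}"
    then have "min (s (Suc k)) (min t (s n)) = min (s (Suc k)) t" "min (s k) (min t (s n)) = min (s k) t"
      using s_le[of "Suc k" n] s_le[of k n] by auto
    then show "(W (min (s (Suc k)) t) \<omega> - W (min (s k) t) \<omega>) *\<^sub>R \<eta> k \<omega> =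
        (W (min (s (Suc k)) (min t (s n))) \<omega> - W (min (s k) (min t (s n))) \<omega>) *\<^sub>R \<eta> k \<omega>" by simp
  qed
  finally show ?thesis by (simp add: step_path_finite[of _ n])
qed

text \<open>At a finite \<open>b\<close> the series would have infinitely many non-zero terms, so
  the target is inserted there by hand; \<open>closed_path_tail_limit\<close> justifies it. For
  \<open>b = \<infinity>\<close> the second branch is never taken.\<close>

definition closed_path :: "(real \<Rightarrow> real) \<Rightarrow> (nat \<Rightarrow> 'e::real_normed_vector) \<Rightarrow> 'e \<Rightarrow> real \<Rightarrow> 'e" where
  "closed_path w c x t = (if ereal t < b then step_path s w c t else x)"

lemma closed_path_min: "closed_path w c x (min t (s n)) = step_path s w c (min t (s n))"
proof -
  have "ereal (min t (s n)) < b" using s_less_b[of n] by (simp add: min_def) (meson ereal_less_eq(3) le_less_trans)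
  then show ?thesis by (simp add: closed_path_def)
qed

lemma closed_path_continuous:
  assumes "continuous_on {0..} w"
  shows "continuous_on {a..s n} (closed_path w c x)"
  using closed_path_min[of w c x _ n]
  by (intro continuous_on_eq[OF step_path_continuous[OF assms, of n c]]) (metis atLeastAtMost_iff min_absorb1)

lemma closed_path_tail_limit:
  assumes lim: "(\<lambda>n. step_path s w c (s n)) \<longlonglongrightarrow> x" and o0: "osc \<longlonglongrightarrow> 0"
    and osc: "\<forall>\<^sub>F n in sequentially. \<forall>t\<in>{s n..s (Suc n)}. norm ((w t - w (s n)) *\<^sub>R c n) \<le> osc n"
  shows "tail_limit (closed_path w c x) x"
  unfolding tail_limit_def
proof (intro allI impI)
  fix e :: real assume "e > 0"
  have "\<forall>\<^sub>F n in sequentially. norm (step_path s w c (s n) - x) < e / 2"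
    using \<open>e > 0\<close> by (intro order_tendstoD(2)[OF tendsto_norm_zero[OF LIM_zero[OF lim]]]) simp
  moreover have "\<forall>\<^sub>F n in sequentially. osc n < e / 2"
    using \<open>e > 0\<close> by (intro order_tendstoD(2)[OF o0]) simp
  ultimately have "\<forall>\<^sub>F n in sequentially. \<forall>t\<in>{s n..s (Suc n)}. norm (step_path s w c t - x) < e"
    using osc
  proof eventually_elim
    case (elim n)
    show ?case
    proof
      fix t assume t: "t \<in> {s n..s (Suc n)}"
      have "step_path s w c t - x = (step_path s w c (s n) - x) + (w t - w (s n)) *\<^sub>R c n"
        using t by (simp add: step_path_between)
      also have "norm \<dots> \<le> norm (step_path s w c (s n) - x) + norm ((w t - w (s n)) *\<^sub>R c n)"
        by (rule norm_triangle_ineq)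
      finally show "norm (step_path s w c t - x) < e" using elim t by fastforce
    qed
  qed
  then obtain n0 where n0: "\<And>n t. n0 \<le> n \<Longrightarrow> t \<in> {s n..s (Suc n)} \<Longrightarrow> norm (step_path s w c t - x) < e"
    unfolding eventually_sequentially by blast
  show "\<exists>n. \<forall>t\<in>T. s n \<le> t \<longrightarrow> norm (closed_path w c x t - x) < e"
  proof (intro exI[of _ n0] ballI impI)
    fix t assume t: "t \<in> T" "s n0 \<le> t"
    show "norm (closed_path w c x t - x) < e"
    proof (cases "ereal t < b")
      case True
      \<comment> \<open>The predecessor of the least grid index beyond \<open>t\<close> gives the
        interval containing \<open>t\<close>; it exists and is at least \<open>n0\<close> because
        \<open>s n0 \<le> t\<close>.\<close>
      define m where "m = (LEAST m. t < s m)"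
      have m: "t < s m" unfolding m_def using s_cofinal[OF True] by (rule LeastI_ex)
      have m0: "n0 < m" using t m s_le[of m n0] by (cases "n0 < m") auto
      then obtain n where n: "m = Suc n" by (cases m) auto
      have "\<not> t < s n" using not_less_Least[of n "\<lambda>m. t < s m"] n by (simp add: m_def)
      then show ?thesis using n0[of n t] m n m0 True by (simp add: closed_path_def)
    qed (use \<open>e > 0\<close> in \<open>simp add: closed_path_def\<close>)
  qed
qed

end


section \<open>Maximal inequality and the majorant\<close>

text \<open>The cubic Taylor polynomial of the square root at 1 lies above it as far as
  \<open>-1 \<le> x\<close>. The added \<open>x ^ 4\<close> pays for the reflected branch
  \<open>x < -1\<close>, and its expectation remains small after scaling.\<close>

lemma sqrt_abs_le_quartic:
  fixes x :: real
  shows "sqrt \<bar>1 + x\<bar> \<le> 1 + x / 2 - x\<^sup>2 / 8 + x ^ 3 / 16 + x ^ 4"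
proof (cases "0 \<le> 1 + x")
  case True
  define u where "u = sqrt \<bar>1 + x\<bar>"
  have u: "0 \<le> u" "u\<^sup>2 = 1 + x" using True by (simp_all add: u_def)
  then have x: "x = u\<^sup>2 - 1" by simp
  \<comment> \<open>In the variable u the difference is a polynomial with a fourfold zero at u = 1,
    the point of contact x = 0; the remaining quadratic factor is positive for u \<ge> 0.\<close>
  have "1 + x / 2 - x\<^sup>2 / 8 + x ^ 3 / 16 - u = (u - 1) ^ 4 * (u\<^sup>2 + 4 * u + 5) / 16"
    unfolding x by (simp add: eval_nat_numeral field_simps)
  also have "\<dots> \<ge> 0" using u(1) by simp
  finally have "u \<le> 1 + x / 2 - x\<^sup>2 / 8 + x ^ 3 / 16" by simp
  also have "\<dots> \<le> 1 + x / 2 - x\<^sup>2 / 8 + x ^ 3 / 16 + x ^ 4" by simp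
  finally show ?thesis by (simp add: u_def)
next
  case False
  define z where "z = - 1 - x"
  have z: "0 < z" "x = - 1 - z" using False by (simp_all add: z_def)
  \<comment> \<open>On this branch \<bar>1 + x\<bar> = z. After the arithmetic-geometric mean bound,
    what is missing to the quartic is a polynomial in z with positive coefficients.\<close>
  have "sqrt (z * 1) \<le> (z + 1) / 2" by (rule arith_geo_mean_sqrt) (use z in auto)
  also have "\<dots> \<le> (z + 1) / 2 + (13/16 + 41/16 * z + 91/16 * z\<^sup>2 + 63/16 * z ^ 3 + z ^ 4)"
    using z(1) by simp
  also have "\<dots> = 1 + x / 2 - x\<^sup>2 / 8 + x ^ 3 / 16 + x ^ 4"
    unfolding z(2) by (simp add: eval_nat_numeral field_simps)
  finally show ?thesis using z by (simp add: abs_if)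
qed

lemma (in prob_space) std_normal_moments:
  assumes X: "distributed M lborel X std_normal_density"
  shows "integrable M (\<lambda>\<omega>. X \<omega> ^ k)"
    and "expectation X = 0" and "expectation (\<lambda>\<omega>. X \<omega> ^ 2) = 1"
    and "expectation (\<lambda>\<omega>. X \<omega> ^ 3) = 0" and "expectation (\<lambda>\<omega>. X \<omega> ^ 4) = 3"
proof -
  show "integrable M (\<lambda>\<omega>. X \<omega> ^ k)"
    using distributed_integrable[OF X, of "\<lambda>x. x ^ k"] integrable_std_normal_moment[of k] by simp
  show "expectation X = 0" by (rule standard_normal_distributed_expectation[OF X])
  show "expectation (\<lambda>\<omega>. X \<omega> ^ 2) = 1"
    using distributed_integral[OF X, of "\<lambda>x. x ^ 2"] integral_std_normal_moment_even[of 1]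
    by (simp add: eval_nat_numeral)
  show "expectation (\<lambda>\<omega>. X \<omega> ^ 3) = 0"
    using distributed_integral[OF X, of "\<lambda>x. x ^ 3"] integral_std_normal_moment_odd[of 1]
    by simp
  show "expectation (\<lambda>\<omega>. X \<omega> ^ 4) = 3"
    using distributed_integral[OF X, of "\<lambda>x. x ^ 4"] integral_std_normal_moment_even[of 2]
    by (simp add: eval_nat_numeral)
qed

text \<open>The odd moments vanish, leaving 1 - 1/800 + 3/10000 = 0.99905. The scale 1/10 is small
  enough for the negative quadratic term to outweigh the quartic one.\<close>

lemma (in prob_space) std_normal_sqrt_affine:
  assumes X: "distributed M lborel X std_normal_density"
  shows "integrable M (\<lambda>\<omega>. sqrt \<bar>1 + X \<omega> / 10\<bar>)"
    and "expectation (\<lambda>\<omega>. sqrt \<bar>1 + X \<omega> / 10\<bar>) \<le> 9991 / 10000"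
proof -
  let ?p = "\<lambda>\<omega>. 1 + (1/20) * X \<omega> - (1/800) * X \<omega> ^ 2 + (1/16000) * X \<omega> ^ 3 + (1/10000) * X \<omega> ^ 4"
  have [measurable]: "random_variable borel X"
    using distributed_measurable[OF X] by simp
  have le: "sqrt \<bar>1 + X \<omega> / 10\<bar> \<le> ?p \<omega>" for \<omega>
    using sqrt_abs_le_quartic[of "X \<omega> / 10"] by (simp add: power_divide)
  note m = std_normal_moments[OF X]
  have X1: "integrable M X" using m(1)[of 1] by simp
  have p: "integrable M ?p"
    by (intro Bochner_Integration.integrable_add Bochner_Integration.integrable_diff
        integrable_mult_right m(1) X1) simp
  show int: "integrable M (\<lambda>\<omega>. sqrt \<bar>1 + X \<omega> / 10\<bar>)"
    by (rule Bochner_Integration.integrable_bound[OF p])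
       (auto intro!: AE_I2 order_trans[OF le])
  have "expectation (\<lambda>\<omega>. sqrt \<bar>1 + X \<omega> / 10\<bar>) \<le> expectation ?p"
    by (rule integral_mono[OF int p le])
  also have "\<dots> = 1 + (1/20) * 0 - (1/800) * 1 + (1/16000) * 0 + (1/10000) * 3"
    using m(1)[of 2] m(1)[of 3] m(1)[of 4] X1 m(2-) by (simp add: prob_space)
  also have "\<dots> \<le> 9991 / 10000" by simp
  finally show "expectation (\<lambda>\<omega>. sqrt \<bar>1 + X \<omega> / 10\<bar>) \<le> 9991 / 10000" .
qed

section \<open>Filtrations, Brownian increments and their maximal oscillation\<close>

context complete_filtration
begin

lemma space_F: "0 \<le> t \<Longrightarrow> space (F t) = space M"
  using subalgebra_F by (simp add: subalgebra_def)

lemma sets_F: "0 \<le> t \<Longrightarrow> sets (F t) \<subseteq> sets M"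
  using subalgebra_F by (simp add: subalgebra_def)

lemma F_measurable_mono:
  assumes "f \<in> measurable (F s) N" "0 \<le> s" "s \<le> t"
  shows "f \<in> measurable (F t) N"
  using assms sets_F_mono[of s t] space_F[of s] space_F[of t] unfolding measurable_def by auto

lemma F_measurable_M: "f \<in> measurable (F s) N \<Longrightarrow> 0 \<le> s \<Longrightarrow> f \<in> measurable M N"
  using sets_F[of s] space_F[of s] unfolding measurable_def by auto

lemma F_strongly_measurable_mono:
  "strongly_measurable (F s) f \<Longrightarrow> 0 \<le> s \<Longrightarrow> s \<le> t \<Longrightarrow> strongly_measurable (F t) f"
  by (erule strongly_measurable_mono_sets) (simp_all add: sets_F_mono space_F)

lemma F_strongly_measurable_M:
  "strongly_measurable (F s) f \<Longrightarrow> 0 \<le> s \<Longrightarrow> strongly_measurable M f"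
  by (erule strongly_measurable_mono_sets) (simp_all add: sets_F space_F)

end

context brownian_motion
begin

lemma W_measurable_F: "0 \<le> s \<Longrightarrow> s \<le> t \<Longrightarrow> W s \<in> borel_measurable (F t)"
  using F_measurable_mono adapted_W by blast

lemma W_measurable: "0 \<le> t \<Longrightarrow> W t \<in> borel_measurable M"
  using F_measurable_M adapted_W by blast

lemma increment_std_normal:
  assumes "0 \<le> s" "s < t"
  shows "distributed M lborel (\<lambda>\<omega>. (W t \<omega> - W s \<omega>) / sqrt (t - s)) std_normal_density"
  using increment_normal[OF assms] normal_standard_normal_convert[of "sqrt (t - s)" "\<lambda>\<omega>. W t \<omega> - W s \<omega>" 0] assms
  by simp

text \<open>Chebyshev's inequality for the normalised increment. The quadratic decay is what makes
  the exceptional probabilities of successive intervals summable later.\<close>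

lemma increment_tail:
  assumes "0 \<le> s" "s < t" "0 < e"
  shows "prob {\<omega>\<in>space M. e \<le> \<bar>W t \<omega> - W s \<omega>\<bar>} \<le> (t - s) / e\<^sup>2"
proof -
  let ?X = "\<lambda>\<omega>. (W t \<omega> - W s \<omega>) / sqrt (t - s)"
  note m = std_normal_moments[OF increment_std_normal[OF assms(1,2)]]
  have pos: "0 < sqrt (t - s)" using assms by simp
  have "{\<omega>\<in>space M. e \<le> \<bar>W t \<omega> - W s \<omega>\<bar>} = {\<omega>\<in>space M. e / sqrt (t - s) \<le> \<bar>?X \<omega>\<bar>}"
    using pos by (auto simp: abs_divide divide_le_cancel)
  also have "prob \<dots> \<le> expectation (\<lambda>\<omega>. ?X \<omega> ^ 2) / (e / sqrt (t - s))\<^sup>2"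
    using assms pos W_measurable
    by (intro second_moment_method m(1)) (auto intro!: borel_measurable_divide borel_measurable_diff)
  also have "\<dots> = (t - s) / e\<^sup>2"
    unfolding m(3) using assms by (simp add: power_divide)
  finally show ?thesis .
qed

lemma increment_event_indep:
  assumes "0 \<le> s" "s < t" "A \<in> sets (F s)" "B \<in> sets borel"
  shows "prob (A \<inter> {\<omega>\<in>space M. W t \<omega> - W s \<omega> \<in> B}) = prob A * prob {\<omega>\<in>space M. W t \<omega> - W s \<omega> \<in> B}"
proof -
  have "{\<omega>\<in>space M. W t \<omega> - W s \<omega> \<in> B} = (\<lambda>\<omega>. W t \<omega> - W s \<omega>) -` B \<inter> space M" by auto
  also have "\<dots> \<in> sets (vimage_algebra (space M) (\<lambda>\<omega>. W t \<omega> - W s \<omega>) borel)"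
    using assms(4) by (rule in_vimage_algebra)
  finally have "prob ({\<omega>\<in>space M. W t \<omega> - W s \<omega> \<in> B} \<inter> A) = prob {\<omega>\<in>space M. W t \<omega> - W s \<omega> \<in> B} * prob A"
    using increment_indep[OF assms(1,2)] assms(3) unfolding indep_sets2_eq by blast
  then show ?thesis by (simp only: Int_commute mult.commute)
qed

lemma increment_indep_var:
  assumes "0 \<le> s" "s < t" "R \<in> borel_measurable (F s)"
  shows "indep_var borel (\<lambda>\<omega>. W t \<omega> - W s \<omega>) borel R"
  unfolding indep_var_eq
proof (intro conjI)
  show "random_variable borel (\<lambda>\<omega>. W t \<omega> - W s \<omega>)"
    using W_measurable assms by (intro borel_measurable_diff) auto
  show "random_variable borel R" using F_measurable_M assms by blast
  have "indep_set (sets (vimage_algebra (space M) (\<lambda>\<omega>. W t \<omega> - W s \<omega>) borel)) (sets (F s))"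
    by (rule increment_indep[OF assms(1,2)])
  moreover have "sigma_sets (space M) {(\<lambda>\<omega>. W t \<omega> - W s \<omega>) -` A \<inter> space M |A. A \<in> sets borel} \<subseteq>
      sets (vimage_algebra (space M) (\<lambda>\<omega>. W t \<omega> - W s \<omega>) borel)"
    by (simp add: sets_vimage_algebra)
  moreover have "sigma_sets (space M) {R -` A \<inter> space M |A. A \<in> sets borel} \<subseteq> sets (F s)"
  proof -
    have "{R -` A \<inter> space M |A. A \<in> sets borel} \<subseteq> sets (F s)"
      using measurable_sets[OF assms(3)] space_F[OF assms(1)] by auto
    from sets.sigma_sets_subset[OF this] show ?thesis by (simp add: space_F[OF assms(1)])
  qed
  ultimately show "indep_set (sigma_sets (space M) {(\<lambda>\<omega>. W t \<omega> - W s \<omega>) -` A \<inter> space M |A. A \<in> sets borel})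
      (sigma_sets (space M) {R -` A \<inter> space M |A. A \<in> sets borel})"
    unfolding indep_sets2_eq by (meson subsetD subset_trans)
qed

text \<open>Ottaviani's inequality: from the first time at which the path has left the interval of radius
  \<open>K * sqrt (t - s)\<close>, the rest of the path brings it back by half of this radius with
  probability at most \<open>1/2\<close>.\<close>

lemma finite_maximal_inequality:
  fixes u :: "nat \<Rightarrow> real"
  assumes s: "0 \<le> s" "s < t" and K: "3 \<le> K" and u: "\<And>i j. i \<le> j \<Longrightarrow> u i \<le> u j" "\<And>i. s \<le> u i" "\<And>i. u i \<le> t"
  shows "prob {\<omega>\<in>space M. \<exists>i<N. K * sqrt (t - s) < \<bar>W (u i) \<omega> - W s \<omega>\<bar>} \<le> 8 / K\<^sup>2"
proof -
  define c where "c = K * sqrt (t - s)"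
  have c: "0 < c" "c\<^sup>2 = K\<^sup>2 * (t - s)" using K s by (auto simp: c_def power_mult_distrib)
  have ratio: "(t - s) / (c / 2)\<^sup>2 = 4 / K\<^sup>2"
  proof -
    have "d / (K\<^sup>2 * d / 4) = 4 / K\<^sup>2" if "0 < d" for d
      using that K by (simp add: field_simps)
    from this[of "t - s"] show ?thesis using s by (simp add: power_divide c(2))
  qed
  have u0: "0 \<le> u i" for i using u(2)[of i] s by simp
  define A where "A i = {\<omega>\<in>space M. c < \<bar>W (u i) \<omega> - W s \<omega>\<bar> \<and> (\<forall>j\<in>{..<i}. \<bar>W (u j) \<omega> - W s \<omega>\<bar> \<le> c)}" for i
  define B where "B i = {\<omega>\<in>space M. W t \<omega> - W (u i) \<omega> \<in> {- (c/2)<..<c/2}}" for i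
  have in_B: "x \<in> {- (c/2)<..<c/2} \<longleftrightarrow> \<not> c / 2 \<le> \<bar>x\<bar>" for x
    by (simp only: greaterThanLessThan_iff) linarith
  have [measurable]: "W (u i) \<in> borel_measurable M" "W s \<in> borel_measurable M" "W t \<in> borel_measurable M" for i
    using W_measurable u0 s by auto
  have A_F: "A i \<in> sets (F (u i))" for i
  proof -
    have Wu: "W (u j) \<in> borel_measurable (F (u i))" if "j \<le> i" for j
      using W_measurable_F[OF u0 u(1)[OF that]] .
    have [measurable]: "W s \<in> borel_measurable (F (u i))"
      using W_measurable_F[OF s(1) u(2)] .
    have "A i = {\<omega>\<in>space (F (u i)). c < \<bar>W (u i) \<omega> - W s \<omega>\<bar>} \<inter>
       {\<omega>\<in>space (F (u i)). \<forall>j\<in>{..<i}. \<bar>W (u j) \<omega> - W s \<omega>\<bar> \<le> c}"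
      using space_F[OF u0] by (auto simp: A_def)
    also have "\<dots> \<in> sets (F (u i))"
    proof (intro sets.Int sets.sets_Collect_finite_All)
      have *: "W (u i) \<in> borel_measurable (F (u i))" by (rule Wu[OF order_refl])
      from * show "{\<omega>\<in>space (F (u i)). c < \<bar>W (u i) \<omega> - W s \<omega>\<bar>} \<in> sets (F (u i))" by measurable
    next
      fix j assume "j \<in> {..<i}"
      then have *: "W (u j) \<in> borel_measurable (F (u i))" by (intro Wu) simp
      from * show "{\<omega>\<in>space (F (u i)). \<bar>W (u j) \<omega> - W s \<omega>\<bar> \<le> c} \<in> sets (F (u i))" by measurable
    qed simp
    finally show ?thesis .
  qed
  have [measurable]: "A i \<in> sets M" for i using A_F sets_F[OF u0] by blast
  have [measurable]: "B i \<in> sets M" for i unfolding B_def by measurable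
  have half: "prob (A i) \<le> 2 * prob (A i \<inter> B i)" for i
  proof (cases "u i = t")
    \<comment> \<open>The laws of increments are available only for \<open>u i < t\<close>. At
      \<open>u i = t\<close> the remaining increment is zero, so \<open>B i\<close> is the whole
      space.\<close>
    case True
    then have "A i \<inter> B i = A i" using c(1) by (auto simp: A_def B_def)
    then show ?thesis by simp
  next
    case False
    then have ut: "u i < t" using u(3)[of i] by simp
    have "prob (space M - B i) = prob {\<omega>\<in>space M. c / 2 \<le> \<bar>W t \<omega> - W (u i) \<omega>\<bar>}"
      unfolding B_def in_B by (intro arg_cong[where f=prob]) blast
    also have "\<dots> \<le> (t - u i) / (c / 2)\<^sup>2"
      by (rule increment_tail) (use u0 ut c in auto)
    also have "\<dots> \<le> (t - s) / (c / 2)\<^sup>2"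
      using u(2)[of i] by (intro divide_right_mono) auto
    also have "\<dots> = 4 / K\<^sup>2" by (rule ratio)
    \<comment> \<open>Here \<open>3 \<le> K\<close> enters: 4/9 is below 1/2, so the remaining
      increment stays inside radius \<open>c / 2\<close> with probability at least 1/2.\<close>
    also have "\<dots> \<le> 4 / 3\<^sup>2" using K by (intro divide_left_mono power_mono) auto
    finally have "1 / 2 \<le> prob (B i)" by (simp add: prob_compl)
    moreover have "prob (A i \<inter> B i) = prob (A i) * prob (B i)"
      unfolding B_def by (rule increment_event_indep) (use u0 ut A_F in auto)
    ultimately show ?thesis using mult_left_mono[of "1/2" "prob (B i)" "prob (A i)"] by simp
  qed
  have A_unique: "i = j" if "\<omega> \<in> A i" "\<omega> \<in> A j" for i j \<omega>
    using that by (cases i j rule: linorder_cases) (force simp: A_def)+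
  have "{\<omega>\<in>space M. \<exists>i<N. c < \<bar>W (u i) \<omega> - W s \<omega>\<bar>} \<subseteq> (\<Union>i<N. A i)"
  proof
    fix \<omega> assume "\<omega> \<in> {\<omega>\<in>space M. \<exists>i<N. c < \<bar>W (u i) \<omega> - W s \<omega>\<bar>}"
    then obtain i where i: "\<omega> \<in> space M" "i < N" "c < \<bar>W (u i) \<omega> - W s \<omega>\<bar>" by blast
    define m where "m = (LEAST i. c < \<bar>W (u i) \<omega> - W s \<omega>\<bar>)"
    have "c < \<bar>W (u m) \<omega> - W s \<omega>\<bar>" unfolding m_def using i(3) by (rule LeastI)
    moreover have "m \<le> i" unfolding m_def using i(3) by (rule Least_le)
    moreover have "\<bar>W (u j) \<omega> - W s \<omega>\<bar> \<le> c" if "j < m" for j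
      using not_less_Least[OF that[unfolded m_def]] by simp
    ultimately show "\<omega> \<in> (\<Union>i<N. A i)" using i by (auto simp: A_def intro!: bexI[of _ m])
  qed
  then have "prob {\<omega>\<in>space M. \<exists>i<N. c < \<bar>W (u i) \<omega> - W s \<omega>\<bar>} \<le> prob (\<Union>i<N. A i)"
    by (intro finite_measure_mono) auto
  also have "\<dots> \<le> (\<Sum>i<N. prob (A i))"
    by (intro finite_measure_subadditive_finite) auto
  also have "\<dots> \<le> (\<Sum>i<N. 2 * prob (A i \<inter> B i))"
    by (intro sum_mono half)
  \<comment> \<open>First exits at different indices are disjoint, so the sum becomes the
    probability of a union again, on which the final increment is still at least
    \<open>c - c / 2\<close>.\<close>
  also have "\<dots> = 2 * prob (\<Union>i<N. A i \<inter> B i)"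
    using A_unique
    by (subst finite_measure_finite_Union) (auto simp: disjoint_family_on_def sum_distrib_left)
  also have "prob (\<Union>i<N. A i \<inter> B i) \<le> prob {\<omega>\<in>space M. c / 2 \<le> \<bar>W t \<omega> - W s \<omega>\<bar>}"
  proof (intro finite_measure_mono subsetI)
    fix \<omega> assume "\<omega> \<in> (\<Union>i<N. A i \<inter> B i)"
    then obtain i where i: "\<omega> \<in> space M" "c < \<bar>W (u i) \<omega> - W s \<omega>\<bar>" "\<not> c / 2 \<le> \<bar>W t \<omega> - W (u i) \<omega>\<bar>"
      unfolding A_def B_def in_B by blast
    then have "c / 2 \<le> \<bar>W t \<omega> - W s \<omega>\<bar>" by linarith
    with i(1) show "\<omega> \<in> {\<omega>\<in>space M. c / 2 \<le> \<bar>W t \<omega> - W s \<omega>\<bar>}" by blast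
  qed measurable
  also have "\<dots> \<le> (t - s) / (c / 2)\<^sup>2"
    by (rule increment_tail) (use s c in auto)
  also have "\<dots> = 4 / K\<^sup>2" by (rule ratio)
  finally show ?thesis by (simp add: c_def)
qed

text \<open>By continuity, an exceedance at any time shows on all sufficiently fine grids. It is
  stated through a measurable \<open>A\<close>, as the exceedance event involves uncountably many
  times.\<close>

lemma maximal_inequality:
  assumes s: "0 \<le> s" "s < t" and K: "3 \<le> K"
  shows "\<exists>A\<in>sets M. prob A \<le> 8 / K\<^sup>2 \<and>
    (AE \<omega> in M. \<omega> \<notin> A \<longrightarrow> (\<forall>v\<in>{s..t}. \<bar>W v \<omega> - W s \<omega>\<bar> \<le> K * sqrt (t - s)))"
proof -
  define c where "c = K * sqrt (t - s)"
  \<comment> \<open>The minimum keeps \<open>u n i\<close> in \<open>{s..t}\<close> for every index,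
    as the finite inequality requires; the index \<open>Suc n\<close> yields the end point
    \<open>t\<close>, hence the range \<open>i < Suc (Suc n)\<close> below.\<close>
  define u where "u n i = s + (t - s) * min 1 (real i / real (Suc n))" for n i
  have u: "i \<le> j \<Longrightarrow> u n i \<le> u n j" "s \<le> u n i" "u n i \<le> t" for n i j
  proof -
    show "i \<le> j \<Longrightarrow> u n i \<le> u n j"
      using s unfolding u_def by (intro add_left_mono mult_left_mono min.mono divide_right_mono) auto
    show "s \<le> u n i" using s by (simp add: u_def)
    have "(t - s) * min 1 (real i / real (Suc n)) \<le> (t - s) * 1"
      using s by (intro mult_left_mono) auto
    then show "u n i \<le> t" by (simp add: u_def)
  qed
  define E where "E n = {\<omega>\<in>space M. \<exists>i<Suc (Suc n). c < \<bar>W (u n i) \<omega> - W s \<omega>\<bar>}" for n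
  \<comment> \<open>The grids are not nested and the \<open>E n\<close> not monotone. The tail
    intersections \<open>G m\<close> do increase, and each is contained in \<open>E m\<close>, so
    the bound survives the limit.\<close>
  define G where "G m = (\<Inter>n\<in>{m..}. E n)" for m
  have [measurable]: "W (u n i) \<in> borel_measurable M" "W s \<in> borel_measurable M" for n i
    using W_measurable s order_trans[OF s(1) u(2)] by auto
  have [measurable]: "E n \<in> sets M" for n unfolding E_def by measurable
  have [measurable]: "G m \<in> sets M" for m unfolding G_def by measurable
  have G_le: "prob (G m) \<le> 8 / K\<^sup>2" for m
  proof -
    have "prob (G m) \<le> prob (E m)" by (intro finite_measure_mono) (auto simp: G_def)
    also have "\<dots> \<le> 8 / K\<^sup>2" unfolding E_def c_def by (intro finite_maximal_inequality s K u)
    finally show ?thesis .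
  qed
  have "(\<lambda>m. prob (G m)) \<longlonglongrightarrow> prob (\<Union>m. G m)"
    by (rule finite_Lim_measure_incseq) (auto simp: incseq_def G_def)
  then have "prob (\<Union>m. G m) \<le> 8 / K\<^sup>2"
    by (rule LIMSEQ_le_const2) (use G_le in auto)
  moreover have "AE \<omega> in M. \<omega> \<notin> (\<Union>m. G m) \<longrightarrow> (\<forall>v\<in>{s..t}. \<bar>W v \<omega> - W s \<omega>\<bar> \<le> c)"
    using continuous_W AE_space
  proof eventually_elim
    case (elim \<omega>)
    have "\<omega> \<in> (\<Union>m. G m)" if v: "v \<in> {s..t}" "c < \<bar>W v \<omega> - W s \<omega>\<bar>" for v
    proof -
      define r where "r = (v - s) / (t - s)"
      have r: "0 \<le> r" "r \<le> 1" "v = s + (t - s) * r" using v s by (auto simp: r_def)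
      define i where "i n = nat \<lfloor>r * real (Suc n)\<rfloor>" for n
      have i_le: "i n \<le> Suc n" for n
      proof -
        have "r * real (Suc n) \<le> real (Suc n)" using r by (intro mult_left_le_one_le) auto
        moreover have "real (i n) \<le> r * real (Suc n)"
          unfolding i_def using r by (intro of_nat_floor) auto
        ultimately have "real (i n) \<le> real (Suc n)" by (rule order_trans[rotated])
        then show ?thesis by (simp only: of_nat_le_iff)
      qed
      have ri: "\<bar>real (i n) / real (Suc n) - r\<bar> \<le> 1 / real (Suc n)" for n
      proof -
        have "0 \<le> r * real (Suc n)" using r by simp
        then have "\<bar>real (i n) - r * real (Suc n)\<bar> \<le> 1" unfolding i_def by linarith
        moreover have "real (i n) / real (Suc n) - r = (real (i n) - r * real (Suc n)) / real (Suc n)"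
          by (simp add: field_simps)
        ultimately show ?thesis by (simp add: abs_divide divide_right_mono)
      qed
      have "(\<lambda>n. real (i n) / real (Suc n) - r) \<longlonglongrightarrow> 0"
        by (rule Lim_null_comparison[OF _ LIMSEQ_inverse_real_of_nat])
           (use ri in \<open>simp add: inverse_eq_divide\<close>)
      then have "(\<lambda>n. real (i n) / real (Suc n)) \<longlonglongrightarrow> r" by (rule LIM_zero_cancel)
      then have "(\<lambda>n. u n (i n)) \<longlonglongrightarrow> s + (t - s) * min 1 r"
        unfolding u_def by (intro tendsto_intros)
      then have "(\<lambda>n. u n (i n)) \<longlonglongrightarrow> v" using r by simp
      then have "(\<lambda>n. W (u n (i n)) \<omega>) \<longlonglongrightarrow> W v \<omega>"
        using s v u by (intro continuous_on_tendsto_compose[OF elim(1)])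
          (auto intro!: always_eventually order_trans[OF s(1)])
      then have "(\<lambda>n. \<bar>W (u n (i n)) \<omega> - W s \<omega>\<bar>) \<longlonglongrightarrow> \<bar>W v \<omega> - W s \<omega>\<bar>"
        by (intro tendsto_intros)
      from order_tendstoD(1)[OF this v(2)] obtain m where
        "\<And>n. m \<le> n \<Longrightarrow> c < \<bar>W (u n (i n)) \<omega> - W s \<omega>\<bar>" unfolding eventually_sequentially by blast
      then have "\<omega> \<in> G m" using i_le elim(2) by (force simp: G_def E_def less_Suc_eq_le)
      then show ?thesis by blast
    qed
    then show ?case by (meson not_le)
  qed
  ultimately show ?thesis unfolding c_def by (intro bexI[of _ "\<Union>m. G m"]) auto
qed

text \<open>Borel-Cantelli with radius K = k + 3 on the k-th interval:
  \<open>8 / (real k + 3)\<^sup>2\<close> is summable, and the shift by 3 meets the condition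
  \<open>3 \<le> K\<close> from the start.\<close>

lemma oscillation_eventually_le:
  assumes s: "\<And>k. 0 \<le> s k" "\<And>k. s k < s (Suc k)"
  shows "AE \<omega> in M. \<forall>\<^sub>F k in sequentially. \<forall>v\<in>{s k..s (Suc k)}.
    \<bar>W v \<omega> - W (s k) \<omega>\<bar> \<le> (real k + 3) * sqrt (s (Suc k) - s k)"
proof -
  define P where "P k \<omega> \<longleftrightarrow> (\<forall>v\<in>{s k..s (Suc k)}. \<bar>W v \<omega> - W (s k) \<omega>\<bar> \<le> (real k + 3) * sqrt (s (Suc k) - s k))"
    for k \<omega>
  have "\<exists>A\<in>sets M. prob A \<le> 8 / (real k + 3)\<^sup>2 \<and> (AE \<omega> in M. \<omega> \<notin> A \<longrightarrow> P k \<omega>)" for k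
    unfolding P_def by (intro maximal_inequality s) simp
  then obtain A where A [measurable]: "\<And>k. A k \<in> sets M" and pA: "\<And>k. prob (A k) \<le> 8 / (real k + 3)\<^sup>2"
    and ae: "\<And>k. AE \<omega> in M. \<omega> \<notin> A k \<longrightarrow> P k \<omega>"
    by metis
  have "summable (\<lambda>k. 8 * (1 / (real (k + 3))\<^sup>2))"
    using summable_ignore_initial_segment[OF inverse_power_summable[of 2, where 'a=real], of 3]
    by (intro summable_mult) (simp add: inverse_eq_divide)
  then have "summable (\<lambda>k. prob (A k))"
    by (rule summable_comparison_test') (use pA in simp)
  then have "AE \<omega> in M. \<forall>\<^sub>F k in sequentially. \<omega> \<in> space M - A k"
    by (intro borel_cantelli_AE1) (auto simp: emeasure_eq_measure)
  moreover have "AE \<omega> in M. \<forall>k. \<omega> \<notin> A k \<longrightarrow> P k \<omega>"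
    using ae by (simp add: AE_all_countable)
  ultimately show ?thesis
    unfolding P_def[symmetric]
  proof eventually_elim
    case (elim \<omega>)
    from elim(1) show ?case by eventually_elim (use elim(2) in auto)
  qed
qed

text \<open>Pathwise majorant of the square root of the distance between the integral and its target:
  the step from \<open>s k\<close> to \<open>s (Suc k)\<close> multiplies this distance by \<open>\<bar>1 + g / 10\<bar>\<close> with \<open>g\<close> standard
  normal, and moves the target by a geometrically small amount.\<close>

primrec majorant :: "(nat \<Rightarrow> real) \<Rightarrow> nat \<Rightarrow> 'w \<Rightarrow> real" where
  "majorant s 0 \<omega> = 1"
| "majorant s (Suc k) \<omega> =
    sqrt \<bar>1 + (W (s (Suc k)) \<omega> - W (s k) \<omega>) / sqrt (s (Suc k) - s k) / 10\<bar> * majorant s k \<omega> + (1/2) ^ k"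

lemma majorant_nonneg: "0 \<le> majorant s k \<omega>"
  by (induction k) auto

lemma majorant_measurable:
  assumes s: "\<And>k. 0 \<le> s k" "\<And>k. s k < s (Suc k)"
  shows "majorant s k \<in> borel_measurable (F (s k))"
proof (induction k)
  case 0 show ?case by (simp add: measurable_def)
next
  case (Suc k)
  have [measurable]: "majorant s k \<in> borel_measurable (F (s (Suc k)))"
    using F_measurable_mono[OF Suc] s less_imp_le by blast
  have [measurable]: "W (s k) \<in> borel_measurable (F (s (Suc k)))" "W (s (Suc k)) \<in> borel_measurable (F (s (Suc k)))"
    using W_measurable_F s less_imp_le by blast+
  show ?case by simp
qed

text \<open>Independence turns the recursion into a scalar one with factor at most 0.9991 and
  inhomogeneity \<open>(1/2) ^ k\<close>, which is below \<open>(9995/10000) ^ k\<close>. The ansatz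
  C times 0.9995 to the power k closes if 0.9991 C + 1 \<le> 0.9995 C, that is, from C = 2500
  on.\<close>

lemma majorant_expectation:
  assumes s: "\<And>k. 0 \<le> s k" "\<And>k. s k < s (Suc k)"
  shows "integrable M (majorant s k) \<and> expectation (majorant s k) \<le> 2500 * (9995/10000) ^ k"
proof (induction k)
  case 0 then show ?case by (simp add: prob_space)
next
  case (Suc k)
  let ?X = "\<lambda>\<omega>. (W (s (Suc k)) \<omega> - W (s k) \<omega>) / sqrt (s (Suc k) - s k)"
  let ?Y = "\<lambda>\<omega>. sqrt \<bar>1 + ?X \<omega> / 10\<bar>"
  note Y = std_normal_sqrt_affine[OF increment_std_normal[OF s]]
  have "indep_var borel (\<lambda>\<omega>. W (s (Suc k)) \<omega> - W (s k) \<omega>) borel (majorant s k)"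
    by (intro increment_indep_var s majorant_measurable)
  then have "indep_var borel ((\<lambda>x. sqrt \<bar>1 + x / sqrt (s (Suc k) - s k) / 10\<bar>) \<circ> (\<lambda>\<omega>. W (s (Suc k)) \<omega> - W (s k) \<omega>))
      borel (id \<circ> majorant s k)"
    by (rule indep_var_compose) auto
  then have ind: "indep_var borel ?Y borel (majorant s k)" by (simp add: comp_def)
  have int: "integrable M (\<lambda>\<omega>. ?Y \<omega> * majorant s k \<omega>)"
    using Suc by (intro indep_var_integrable[OF ind Y(1)]) simp
  have eq: "majorant s (Suc k) = (\<lambda>\<omega>. ?Y \<omega> * majorant s k \<omega> + (1/2) ^ k)"
    by (rule ext) simp
  have "expectation (majorant s (Suc k)) = expectation ?Y * expectation (majorant s k) + (1/2) ^ k"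
    unfolding eq using int indep_var_lebesgue_integral[OF ind Y(1)] Suc by (simp add: prob_space)
  also have "\<dots> \<le> 9991/10000 * (2500 * (9995/10000) ^ k) + (9995/10000) ^ k"
    using Suc Y(2) by (intro add_mono mult_mono power_mono) (auto intro!: integral_nonneg_AE majorant_nonneg)
  also have "\<dots> = 2500 * (9995/10000) ^ Suc k" by simp
  finally show ?case unfolding eq using int by simp
qed

text \<open>The geometric decay survives the weight: by the differentiated geometric series and
  monotone convergence, the random series has finite expectation.\<close>

lemma majorant_summable:
  assumes s: "\<And>k. 0 \<le> s k" "\<And>k. s k < s (Suc k)"
  shows "AE \<omega> in M. summable (\<lambda>k. (real k + 1) * majorant s k \<omega>)"
proof -
  let ?f = "\<lambda>k \<omega>. (real k + 1) * majorant s k \<omega>"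
  have [measurable]: "majorant s k \<in> borel_measurable M" for k
    using F_measurable_M[OF majorant_measurable[of s k]] s by blast
  note e = majorant_expectation[of s, OF s]
  have f0: "0 \<le> ?f k \<omega>" for k \<omega> by (simp add: majorant_nonneg)
  have "summable (\<lambda>k. 2500 * (of_nat (Suc k) * (9995/10000) ^ k :: real))"
    by (intro summable_mult sums_summable[OF geometric_deriv_sums]) simp
  then have sum: "summable (\<lambda>k. expectation (?f k))"
  proof (rule summable_comparison_test')
    fix k
    have "expectation (?f k) = (real k + 1) * expectation (majorant s k)" by simp
    also have "\<dots> \<le> (real k + 1) * (2500 * (9995/10000) ^ k)"
      using e by (intro mult_left_mono) auto
    finally have "expectation (?f k) \<le> 2500 * (of_nat (Suc k) * (9995/10000) ^ k)" by (simp add: algebra_simps)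
    moreover have "0 \<le> expectation (?f k)" by (intro integral_nonneg_AE) (simp add: f0)
    ultimately show "norm (expectation (?f k)) \<le> 2500 * (of_nat (Suc k) * (9995/10000) ^ k)" by simp
  qed
  have "(\<integral>\<^sup>+\<omega>. (\<Sum>k. ennreal (?f k \<omega>)) \<partial>M) = (\<Sum>k. \<integral>\<^sup>+\<omega>. ennreal (?f k \<omega>) \<partial>M)"
    by (intro nn_integral_suminf) measurable
  also have "\<dots> = (\<Sum>k. ennreal (expectation (?f k)))"
    using e f0 by (intro suminf_cong nn_integral_eq_integral) auto
  also have "\<dots> \<noteq> \<infinity>"
    unfolding infinity_ennreal_def
    by (rule ennreal_suminf_neq_top[OF sum]) (intro integral_nonneg_AE AE_I2 f0)
  finally have "AE \<omega> in M. (\<Sum>k. ennreal (?f k \<omega>)) \<noteq> \<infinity>"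
    by (intro nn_integral_PInf_AE) auto
  then show ?thesis
    by eventually_elim (rule summable_suminf_not_top[OF f0], simp)
qed

end


section \<open>Approximation along the filtration\<close>

text \<open>Only coefficients of intervals starting before a time in \<open>A\<close> are
  constrained. With \<open>A = {a..t}\<close> and \<open>N = F t\<close> this is exactly what
  adaptedness of the coefficients provides, whence progressive measurability; \<open>A = T\<close>
  and \<open>N = M\<close> give joint measurability.\<close>

lemma (in time_grid) step_fun_strongly_measurable:
  fixes c :: "nat \<Rightarrow> 'w \<Rightarrow> 'e::real_normed_vector"
  assumes c: "\<And>k t. t \<in> A \<Longrightarrow> s k < t \<Longrightarrow> strongly_measurable N (c k)"
  shows "strongly_measurable (restrict_space borel A \<Otimes>\<^sub>M N) (\<lambda>(t, \<omega>). step_fun s (\<lambda>k. c k \<omega>) t)"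
proof -
  have "\<exists>f. (\<forall>n. simple_function N (f n)) \<and>
      ((\<exists>t\<in>A. s k < t) \<longrightarrow> (\<forall>\<omega>\<in>space N. (\<lambda>n. f n \<omega>) \<longlonglongrightarrow> c k \<omega>))" for k
  proof (cases "\<exists>t\<in>A. s k < t")
    case True
    then have "strongly_measurable N (c k)" using c by blast
    then show ?thesis unfolding strongly_measurable_def by blast
  next
    \<comment> \<open>This coefficient may fail to be \<open>N\<close>-measurable, but its interval
      does not meet \<open>A\<close>, so zero can replace it.\<close>
    case False
    then show ?thesis by (intro exI[of _ "\<lambda>_ _. 0"]) auto
  qed
  then obtain f where f: "\<And>k n. simple_function N (f k n)"
    "\<And>k t \<omega>. t \<in> A \<Longrightarrow> s k < t \<Longrightarrow> \<omega> \<in> space N \<Longrightarrow> (\<lambda>n. f k n \<omega>) \<longlonglongrightarrow> c k \<omega>"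
    by metis
  let ?P = "restrict_space borel A \<Otimes>\<^sub>M N"
  define S where "S n p = (\<Sum>k<n. (indicator {s k<..s (Suc k)} (fst p) :: real) *\<^sub>R f k n (snd p))" for n p
  have "simple_function ?P (S n)" for n
    unfolding S_def[abs_def]
  proof (intro simple_function_sum simple_function_compose2[where h="(*\<^sub>R)"])
    fix k
    have "simple_function borel (indicator {s k<..s (Suc k)} :: real \<Rightarrow> real)"
      by (intro simple_function_indicator) simp
    then have "simple_function (restrict_space borel A) (indicator {s k<..s (Suc k)} :: real \<Rightarrow> real)"
      by (rule simple_function_comp[rotated, where T="\<lambda>x. x"]) (auto intro: measurable_restrict_space1)
    then show "simple_function ?P (\<lambda>p. indicator {s k<..s (Suc k)} (fst p) :: real)"
      by (rule simple_function_comp[rotated]) simp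
    show "simple_function ?P (\<lambda>p. f k n (snd p))"
      by (rule simple_function_comp[OF measurable_snd f(1)])
  qed
  moreover have "(\<lambda>n. S n p) \<longlonglongrightarrow> (case p of (t, \<omega>) \<Rightarrow> step_fun s (\<lambda>k. c k \<omega>) t)" if "p \<in> space ?P" for p
  proof -
    obtain t \<omega> where p: "p = (t, \<omega>)" "t \<in> A" "\<omega> \<in> space N"
      using \<open>p \<in> space ?P\<close> by (auto simp: space_pair_measure space_restrict_space)
    have S: "S n p = step_fun s (\<lambda>k. if k < n then f k n \<omega> else 0) t" for n
      unfolding S_def p(1) by (subst step_fun_finite[of n]) (auto intro: sum.cong)
    show ?thesis
    proof (cases "\<exists>j. s j < t \<and> t \<le> s (Suc j)")
      case True
      then obtain j where j: "s j < t" "t \<le> s (Suc j)" by blast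
      have "\<forall>\<^sub>F n in sequentially. f j n \<omega> = S n p"
        using eventually_gt_at_top[of j] by eventually_elim (simp add: S step_fun_eq[OF j])
      from Lim_transform_eventually[OF f(2)[OF p(2) j(1) p(3)] this] show ?thesis
        by (simp add: p(1) step_fun_eq[OF j])
    next
      case False
      then show ?thesis unfolding S by (simp add: p(1) step_fun_eq_0)
    qed
  qed
  ultimately show ?thesis unfolding strongly_measurable_def by (intro exI[of _ S]) auto
qed

context complete_filtration
begin

lemma space_sigma_before: "space (sigma_before M F b) = space M"
  unfolding sigma_before_def by (rule space_measure_of) (use sets.sets_into_space sets_F in blast)

lemma sets_sigma_before:
  "sets (sigma_before M F b) = sigma_sets (space M) (\<Union>t\<in>{t. 0 \<le> t \<and> ereal t < b}. sets (F t))"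
  unfolding sigma_before_def by (rule sets_measure_of) (use sets.sets_into_space sets_F in blast)

lemma sets_sigma_before_M: "sets (sigma_before M F b) \<subseteq> sets M"
  unfolding sets_sigma_before by (rule sets.sigma_sets_subset) (use sets_F in blast)

lemma sets_F_sigma_before: "0 \<le> t \<Longrightarrow> ereal t < b \<Longrightarrow> sets (F t) \<subseteq> sets (sigma_before M F b)"
  unfolding sets_sigma_before by blast

text \<open>The approximable events form a \<sigma>-algebra: a countable union is nearly a finite
  one, and finitely many approximations live at a common time because the filtration
  increases.\<close>

lemma approximating_event:
  assumes "A \<in> sets (sigma_before M F b)" "0 < b" "0 < \<delta>"
  shows "\<exists>t B. 0 \<le> t \<and> ereal t < b \<and> B \<in> sets (F t) \<and> prob (sym_diff A B) < \<delta>"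
  using assms(1,3) unfolding sets_sigma_before
proof (induction arbitrary: \<delta> rule: sigma_sets.induct)
  case (Basic A)
  then obtain t where "0 \<le> t" "ereal t < b" "A \<in> sets (F t)" by blast
  then show ?case using Basic by (intro exI[of _ t] exI[of _ A]) simp
next
  case Empty
  then show ?case using \<open>0 < b\<close> by (intro exI[of _ 0] exI[of _ "{}"]) (simp add: zero_ereal_def)
next
  case (Compl A)
  then obtain t B where t: "0 \<le> t" "ereal t < b" "B \<in> sets (F t)" "prob (sym_diff A B) < \<delta>" by blast
  have "A \<in> sets M" using Compl(1) sets_sigma_before_M unfolding sets_sigma_before by blast
  then have "sym_diff (space M - A) (space M - B) = sym_diff A B"
    using sets.sets_into_space t(1,3) sets_F[OF t(1)] by blast
  moreover have "space M - B \<in> sets (F t)"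
    using sets.compl_sets[OF t(3)] space_F[OF t(1)] by simp
  ultimately show ?case using t by (intro exI[of _ t] exI[of _ "space M - B"]) simp
next
  case (Union A)
  have A: "A i \<in> sets M" for i using Union(1) sets_sigma_before_M unfolding sets_sigma_before by blast
  have "(\<lambda>n. prob (\<Union>i<n. A i)) \<longlonglongrightarrow> prob (\<Union>n. \<Union>i<n. A i)"
  proof (rule finite_Lim_measure_incseq)
    show "incseq (\<lambda>n. \<Union>i<n. A i)" unfolding incseq_def by (intro allI impI UN_mono) auto
  qed (use A in auto)
  moreover have "(\<Union>n. \<Union>i<n. A i) = (\<Union>i. A i)" by auto
  ultimately have "(\<lambda>n. prob (\<Union>i<n. A i)) \<longlonglongrightarrow> prob (\<Union>i. A i)" by simp
  from order_tendstoD(1)[OF this, of "prob (\<Union>i. A i) - \<delta> / 2"] Union(3) obtain n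
    where n: "prob (\<Union>i. A i) - \<delta> / 2 < prob (\<Union>i<n. A i)" by (auto simp: eventually_sequentially)
  \<comment> \<open>The n approximations together cost at most \<delta> / 2; n + 1 instead of n
    avoids a zero denominator when the partial union is empty.\<close>
  define e where "e = \<delta> / (2 * (real n + 1))"
  have e: "0 < e" using Union(3) by (simp add: e_def)
  obtain t B where tB: "\<And>i. 0 \<le> t i" "\<And>i. ereal (t i) < b" "\<And>i. B i \<in> sets (F (t i))"
      "\<And>i. prob (sym_diff (A i) (B i)) < e"
    using Union(2)[OF e] by metis
  \<comment> \<open>Inserting 0 covers the empty family. A finite maximum stays strictly below
    \<open>b\<close>.\<close>
  define u where "u = Max (insert 0 (t ` {..<n}))"
  have u: "0 \<le> u" "\<And>i. i < n \<Longrightarrow> t i \<le> u" unfolding u_def by auto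
  have "u \<in> insert 0 (t ` {..<n})" unfolding u_def by (rule Max_in) auto
  then have ub: "ereal u < b" using tB(2) \<open>0 < b\<close> by (auto simp: zero_ereal_def)
  have BF: "(\<Union>i<n. B i) \<in> sets (F u)"
    using tB(1,3) u sets_F_mono by (intro sets.finite_UN) blast+
  have B: "B i \<in> sets M" for i using tB(1,3) sets_F by blast
  have "prob (sym_diff (\<Union>i. A i) (\<Union>i<n. B i)) \<le>
      prob (((\<Union>i. A i) - (\<Union>i<n. A i)) \<union> (\<Union>i<n. sym_diff (A i) (B i)))"
    using A B by (intro finite_measure_mono) auto
  also have "\<dots> \<le> prob ((\<Union>i. A i) - (\<Union>i<n. A i)) + prob (\<Union>i<n. sym_diff (A i) (B i))"
    using A B by (intro measure_Un_le) auto
  also have "prob ((\<Union>i. A i) - (\<Union>i<n. A i)) = prob (\<Union>i. A i) - prob (\<Union>i<n. A i)"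
    using A by (intro finite_measure_Diff) auto
  also have "\<dots> < \<delta> / 2" using n by simp
  also have "prob (\<Union>i<n. sym_diff (A i) (B i)) \<le> (\<Sum>i<n. prob (sym_diff (A i) (B i)))"
    using A B by (intro finite_measure_subadditive_finite) auto
  also have "\<dots> \<le> (\<Sum>i<n. e)" using tB(4) by (intro sum_mono less_imp_le)
  also have "\<dots> \<le> \<delta> / 2" using Union(3) by (simp add: e_def field_simps)
  finally have "prob (sym_diff (\<Union>i. A i) (\<Union>i<n. B i)) < \<delta>" by simp
  with u(1) ub BF show ?case by blast
qed

text \<open>Strong measurability yields a simple \<open>g\<close> near \<xi>, but its level sets
  belong only to \<open>M\<close>. Just its finitely many values are kept: the preimages under \<xi>
  of balls around them lie in \<open>sigma_before M F b\<close> and can be approximated at an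
  earlier time.\<close>

lemma approximating_simple_function:
  fixes \<xi> :: "'w \<Rightarrow> 'e::real_normed_vector"
  assumes \<xi>: "\<xi> \<in> borel_measurable (sigma_before M F b)" and sm: "strongly_measurable M \<xi>"
    and "0 < b" and \<epsilon>: "0 < \<epsilon>"
  shows "\<exists>t y. 0 \<le> t \<and> ereal t < b \<and> simple_function (F t) y \<and>
    prob {\<omega>\<in>space M. \<epsilon> < norm (y \<omega> - \<xi> \<omega>)} < \<epsilon>"
proof -
  have \<xi>M [measurable]: "\<xi> \<in> borel_measurable M" by (rule strongly_measurable_borel[OF sm])
  \<comment> \<open>The induction over the centres \<open>V\<close> controls only those points where
    \<xi> is near some centre; being near none of them is excluded at the end by the choice of
    \<open>g\<close>.\<close>
  define bad where "bad V y = {\<omega>\<in>space M. (\<exists>v\<in>V. norm (\<xi> \<omega> - v) < \<epsilon>) \<and> \<epsilon> < norm (y \<omega> - \<xi> \<omega>)}"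
    for V :: "'e set" and y
  have bad_sets: "bad V y \<in> sets M" if "finite V" "simple_function (F t) y" "0 \<le> t" for V y t
  proof -
    have 1: "(\<lambda>\<omega>. norm (y \<omega> - \<xi> \<omega>)) \<in> borel_measurable M"
      using that F_strongly_measurable_M strongly_measurable_simple sm
      by (intro strongly_measurable_norm_diff) blast+
    have 2: "(\<lambda>\<omega>. norm (\<xi> \<omega> - v)) \<in> borel_measurable M" for v
      by (intro strongly_measurable_norm_diff sm strongly_measurable_const)
    have "bad V y = (\<Union>v\<in>V. {\<omega>\<in>space M. norm (\<xi> \<omega> - v) < \<epsilon>}) \<inter> {\<omega>\<in>space M. \<epsilon> < norm (y \<omega> - \<xi> \<omega>)}"
      by (auto simp: bad_def)
    also have "\<dots> \<in> sets M"
      using 1 2 that(1) by (intro sets.Int sets.finite_UN borel_measurable_less) auto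
    finally show ?thesis .
  qed
  have approx: "\<exists>t y. 0 \<le> t \<and> ereal t < b \<and> simple_function (F t) y \<and> prob (bad V y) < \<delta>"
    if "finite V" "0 < \<delta>" for V \<delta>
    using that
  proof (induction V arbitrary: \<delta> rule: finite_induct)
    case empty
    then show ?case using \<open>0 < b\<close>
      by (intro exI[of _ 0] exI[of _ "\<lambda>_. 0"]) (simp add: bad_def zero_ereal_def)
  next
    case (insert v V)
    then obtain t y where t: "0 \<le> t" "ereal t < b" "simple_function (F t) y" "prob (bad V y) < \<delta> / 2"
      by (meson half_gt_zero)
    define C where "C = {\<omega>\<in>space M. norm (\<xi> \<omega> - v) < \<epsilon>}"
    have C: "C \<in> sets (sigma_before M F b)"
    proof -
      have "C = \<xi> -` ball v \<epsilon> \<inter> space (sigma_before M F b)"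
        by (auto simp: C_def space_sigma_before dist_norm norm_minus_commute)
      also have "\<dots> \<in> sets (sigma_before M F b)" by (rule measurable_sets[OF \<xi>]) simp
      finally show ?thesis .
    qed
    obtain r B where r: "0 \<le> r" "ereal r < b" "B \<in> sets (F r)" "prob (sym_diff C B) < \<delta> / 2"
      using approximating_event[OF C \<open>0 < b\<close>, of "\<delta> / 2"] insert.prems by auto
    define u where "u = max t r"
    have u: "0 \<le> u" "ereal u < b" using t r by (auto simp: u_def max_def)
    have tu: "sets (F t) \<subseteq> sets (F u)" "sets (F r) \<subseteq> sets (F u)"
      using t r by (simp_all add: sets_F_mono u_def)
    \<comment> \<open>On \<open>B\<close> the value is overwritten by the new centre. Outside
      \<open>sym_diff C B\<close> this is correct on \<open>C\<close>, and nothing changes off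
      \<open>C\<close>, so the new error adds only that difference to the old bad event.\<close>
    define y' where "y' \<omega> = (if \<omega> \<in> B then v else y \<omega>)" for \<omega>
    have y': "simple_function (F u) y'"
      unfolding y'_def[abs_def]
    proof (rule simple_function_If_set)
      show "simple_function (F u) y"
        by (rule simple_function_mono_sets[OF t(3)]) (use tu space_F t u in auto)
      show "B \<inter> space (F u) \<in> sets (F u)" using r(3) tu by blast
    qed simp
    have BM: "B \<in> sets M" using r sets_F by blast
    have CM: "C \<in> sets M" using C sets_sigma_before_M by blast
    have bad_y: "bad V y \<in> sets M" by (rule bad_sets) (use insert t in auto)
    have "bad (insert v V) y' \<subseteq> sym_diff C B \<union> bad V y"
      using \<epsilon> by (auto simp: bad_def C_def y'_def norm_minus_commute split: if_splits)
    then have "prob (bad (insert v V) y') \<le> prob (sym_diff C B \<union> bad V y)"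
      using BM CM bad_y by (intro finite_measure_mono) auto
    also have "\<dots> \<le> prob (sym_diff C B) + prob (bad V y)"
      using BM CM bad_y by (intro measure_Un_le) auto
    also have "\<dots> < \<delta>" using r t by simp
    finally show ?case using u y' by blast
  qed
  obtain g where g: "simple_function M g" "prob {\<omega>\<in>space M. norm (g \<omega> - \<xi> \<omega>) > \<epsilon> / 2} < \<epsilon> / 2"
    using simple_approx[OF sm, of "\<epsilon> / 2" "\<epsilon> / 2"] \<epsilon> by auto
  have "finite (g ` space M)" using g(1) by (simp add: simple_function_def)
  from approx[OF this, of "\<epsilon> / 2"] \<epsilon> obtain t y where t: "0 \<le> t" "ereal t < b" "simple_function (F t) y"
    "prob (bad (g ` space M) y) < \<epsilon> / 2" by auto
  have [measurable]: "(\<lambda>\<omega>. norm (g \<omega> - \<xi> \<omega>)) \<in> borel_measurable M"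
    by (intro strongly_measurable_norm_diff strongly_measurable_simple sm g(1))
  have by_sets: "bad (g ` space M) y \<in> sets M" by (rule bad_sets) (use t \<open>finite (g ` space M)\<close> in auto)
  have "{\<omega>\<in>space M. \<epsilon> < norm (y \<omega> - \<xi> \<omega>)} \<subseteq>
      {\<omega>\<in>space M. norm (g \<omega> - \<xi> \<omega>) > \<epsilon> / 2} \<union> bad (g ` space M) y"
  proof
    fix \<omega> assume w: "\<omega> \<in> {\<omega>\<in>space M. \<epsilon> < norm (y \<omega> - \<xi> \<omega>)}"
    show "\<omega> \<in> {\<omega>\<in>space M. norm (g \<omega> - \<xi> \<omega>) > \<epsilon> / 2} \<union> bad (g ` space M) y"
    proof (cases "norm (\<xi> \<omega> - g \<omega>) < \<epsilon>")
      case True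
      then show ?thesis using w by (auto simp: bad_def)
    next
      case False
      then show ?thesis using w \<epsilon> by (simp add: norm_minus_commute)
    qed
  qed
  then have "prob {\<omega>\<in>space M. \<epsilon> < norm (y \<omega> - \<xi> \<omega>)} \<le>
      prob ({\<omega>\<in>space M. norm (g \<omega> - \<xi> \<omega>) > \<epsilon> / 2} \<union> bad (g ` space M) y)"
    by (intro finite_measure_mono) (auto intro: by_sets)
  also have "\<dots> \<le> prob {\<omega>\<in>space M. norm (g \<omega> - \<xi> \<omega>) > \<epsilon> / 2} + prob (bad (g ` space M) y)"
    by (intro measure_Un_le) (auto intro: by_sets)
  also have "\<dots> < \<epsilon>" using g(2) t(4) by simp
  finally show ?thesis using t by blast
qed

end

lemma cofinal_sequence:
  assumes "ereal a < b"
  shows "\<exists>e::nat \<Rightarrow> real. (\<forall>n. ereal (e n) < b) \<and> (\<forall>t. ereal t < b \<longrightarrow> (\<exists>n. t < e n))"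
proof (cases b)
  case (real r)
  have "\<exists>n. t < r - 1 / real (Suc n)" if "t < r" for t
  proof -
    obtain n where "inverse (real (Suc n)) < r - t" using reals_Archimedean[of "r - t"] \<open>t < r\<close> by auto
    then show ?thesis by (intro exI[of _ n]) (simp add: inverse_eq_divide)
  qed
  then show ?thesis using real by (intro exI[of _ "\<lambda>n. r - 1 / real (Suc n)"]) auto
next
  case PInf
  then show ?thesis using reals_Archimedean2 by (intro exI[of _ real]) auto
qed (use assms in simp)

text \<open>The rate \<open>(1/4) ^ n\<close> is fitted to the majorant: its square root is the
  inhomogeneity \<open>(1/2) ^ n\<close> there.\<close>

lemma (in complete_filtration) approximating_grid:
  fixes \<xi> :: "'w \<Rightarrow> 'e::real_normed_vector"
  assumes \<xi>: "\<xi> \<in> borel_measurable (sigma_before M F b)" and sm: "strongly_measurable M \<xi>"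
    and a: "0 \<le> a" "ereal a < b"
  shows "\<exists>s y. time_grid s a b \<and> (\<forall>n. simple_function (F (s n)) (y n)) \<and>
    (AE \<omega> in M. \<forall>\<^sub>F n in sequentially. norm (y n \<omega> - \<xi> \<omega>) \<le> (1/4) ^ n)"
proof -
  obtain e :: "nat \<Rightarrow> real" where e: "\<And>n. ereal (e n) < b" "\<And>t. ereal t < b \<Longrightarrow> \<exists>n. t < e n"
    using cofinal_sequence[OF a(2)] by blast
  have b0: "0 < b" using a by (metis ereal_less_eq(5) le_less_trans)
  define P where "P n p \<longleftrightarrow> (case p of (t, y) \<Rightarrow> a \<le> t \<and> e n \<le> t \<and> ereal t < b \<and> simple_function (F t) y \<and>
      prob {\<omega>\<in>space M. (1/4) ^ n < norm (y \<omega> - \<xi> \<omega>)} < (1/4) ^ n)" for n and p :: "real \<times> ('w \<Rightarrow> 'e)"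
  have ex: "\<exists>p. P n p \<and> r < fst p" if "ereal r < b" for n r
  proof -
    obtain t y where t: "0 \<le> t" "ereal t < b" "simple_function (F t) y"
        "prob {\<omega>\<in>space M. (1/4) ^ n < norm (y \<omega> - \<xi> \<omega>)} < (1/4) ^ n"
      using approximating_simple_function[OF \<xi> sm b0, of "(1/4) ^ n"] by auto
    \<comment> \<open>The next time must exceed four bounds: the time at which \<open>y\<close>
      becomes measurable, the previous grid time, \<open>a\<close>, and the n-th member of a cofinal
      sequence. Moving it to the right keeps \<open>y\<close> measurable.\<close>
    have "ereal (max (max t r) (max a (e n))) < b"
      using t(2) that a(2) e(1)[of n] by (simp add: max_def)
    then obtain u where u: "ereal (max (max t r) (max a (e n))) < ereal u" "ereal u < b"
      using ereal_dense2 by blast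
    then have "simple_function (F u) y"
      using t sets_F_mono[of t u] space_F[of t] space_F[of u] by (intro simple_function_mono_sets[OF t(3)]) auto
    with t u show ?thesis by (intro exI[of _ "(u, y)"]) (auto simp: P_def)
  qed
  have "\<exists>f. \<forall>n. P n (f n) \<and> fst (f n) < fst (f (Suc n))"
  proof (rule dependent_nat_choice[of P "\<lambda>_ p q. fst p < fst q"])
    show "\<exists>p. P 0 p" using ex[OF a(2)] by blast
    fix p n assume "P n p"
    then have "ereal (fst p) < b" by (auto simp: P_def)
    from ex[OF this] show "\<exists>q. P (Suc n) q \<and> fst p < fst q" .
  qed
  then obtain f where f: "\<And>n. P n (f n)" "\<And>n. fst (f n) < fst (f (Suc n))" by blast
  define s where "s n = fst (f n)" for n
  define y where "y n = snd (f n)" for n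
  have sy: "a \<le> s n" "e n \<le> s n" "ereal (s n) < b" "simple_function (F (s n)) (y n)"
      "prob {\<omega>\<in>space M. (1/4) ^ n < norm (y n \<omega> - \<xi> \<omega>)} < (1/4) ^ n" for n
    using f(1)[of n] by (auto simp: P_def s_def y_def split: prod.splits)
  have "time_grid s a b"
  proof
    show "strict_mono s" using f(2) by (simp add: strict_mono_Suc_iff s_def)
    show "\<exists>n. t < s n" if "ereal t < b" for t
      using e(2)[OF that] sy(2) by (meson less_le_trans)
  qed (use sy a in auto)
  moreover have "AE \<omega> in M. \<forall>\<^sub>F n in sequentially. norm (y n \<omega> - \<xi> \<omega>) \<le> (1/4) ^ n"
  proof -
    let ?A = "\<lambda>n. {\<omega>\<in>space M. (1/4) ^ n < norm (y n \<omega> - \<xi> \<omega>)}"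
    have [measurable]: "(\<lambda>\<omega>. norm (y n \<omega> - \<xi> \<omega>)) \<in> borel_measurable M" for n
      using sy(1,4)[of n] a(1) F_strongly_measurable_M[of "s n"] strongly_measurable_simple sm
      by (intro strongly_measurable_norm_diff) auto
    have "summable (\<lambda>n. prob (?A n))"
      by (rule summable_comparison_test'[OF summable_geometric[of "1/4"]])
        (use sy(5) less_imp_le in auto)
    then have "AE \<omega> in M. \<forall>\<^sub>F n in sequentially. \<omega> \<in> space M - ?A n"
      by (intro borel_cantelli_AE1) (auto simp: emeasure_eq_measure)
    then show ?thesis
      by eventually_elim (auto elim!: eventually_mono)
  qed
  ultimately show ?thesis using sy(4) by blast
qed


section \<open>The tracking strategy\<close>

context brownian_motion
begin

primrec tracking_integral ::
    "(nat \<Rightarrow> real) \<Rightarrow> (nat \<Rightarrow> 'w \<Rightarrow> 'e::real_normed_vector) \<Rightarrow> nat \<Rightarrow> 'w \<Rightarrow> 'e" where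
  "tracking_integral s y 0 \<omega> = 0"
| "tracking_integral s y (Suc k) \<omega> = tracking_integral s y k \<omega> +
     (W (s (Suc k)) \<omega> - W (s k) \<omega>) *\<^sub>R
       ((1 / 10 / sqrt (s (Suc k) - s k)) *\<^sub>R (tracking_integral s y k \<omega> - y k \<omega>))"

text \<open>Division by the square root of the mesh makes the gain over the interval the current
  error times a standard normal variable over 10, whatever the interval length; hence no condition
  on the speed of the grid arises.\<close>

definition stake ::
    "(nat \<Rightarrow> real) \<Rightarrow> (nat \<Rightarrow> 'w \<Rightarrow> 'e::real_normed_vector) \<Rightarrow> nat \<Rightarrow> 'w \<Rightarrow> 'e" where
  "stake s y k \<omega> = (1 / 10 / sqrt (s (Suc k) - s k)) *\<^sub>R (tracking_integral s y k \<omega> - y k \<omega>)"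

lemma tracking_integral_measurable:
  assumes "time_grid s a b" and y: "\<And>k. strongly_measurable (F (s k)) (y k)"
  shows "strongly_measurable (F (s k)) (tracking_integral s y k)"
proof -
  interpret time_grid s a b by fact
  show ?thesis
  proof (induction k)
    case 0 then show ?case by (simp add: strongly_measurable_const)
  next
    case (Suc k)
    have le: "0 \<le> s k" "s k \<le> s (Suc k)" using s_nonneg s_le by auto
    note up = F_strongly_measurable_mono[OF _ le]
    have "strongly_measurable (F (s (Suc k))) (\<lambda>\<omega>. tracking_integral s y k \<omega> +
     (W (s (Suc k)) \<omega> - W (s k) \<omega>) *\<^sub>R
       ((1 / 10 / sqrt (s (Suc k) - s k)) *\<^sub>R (tracking_integral s y k \<omega> - y k \<omega>)))"
      using le W_measurable_F[OF s_nonneg] s_nonneg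
      by (intro strongly_measurable_add strongly_measurable_scaleR strongly_measurable_diff
          up[OF Suc] up[OF y] borel_measurable_diff) auto
    then show ?case by simp
  qed
qed

lemma stake_measurable:
  assumes "time_grid s a b" and y: "\<And>k. strongly_measurable (F (s k)) (y k)"
  shows "strongly_measurable (F (s k)) (stake s y k)"
  unfolding stake_def[abs_def]
  by (intro strongly_measurable_scaleR strongly_measurable_diff
      tracking_integral_measurable[OF assms] y) simp

lemma step_path_stake:
  assumes "time_grid s a b"
  shows "step_path s (\<lambda>u. W u \<omega>) (\<lambda>k. stake s y k \<omega>) (s n) = tracking_integral s y n \<omega>"
  unfolding time_grid.step_path_grid[OF assms] by (induction n) (auto simp: stake_def)

lemma tracking_error_Suc:
  "tracking_integral s y (Suc k) \<omega> - y (Suc k) \<omega> =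
    (1 + (W (s (Suc k)) \<omega> - W (s k) \<omega>) / sqrt (s (Suc k) - s k) / 10) *\<^sub>R (tracking_integral s y k \<omega> - y k \<omega>) +
    (y k \<omega> - y (Suc k) \<omega>)"
  by (simp add: algebra_simps)

text \<open>The targets move geometrically little only from a random index on. The constant C
  therefore depends on the path and absorbs the earlier moves; since the recursion for the square
  root is subadditive, a common factor is enough.\<close>

lemma tracking_error_majorant:
  fixes y :: "nat \<Rightarrow> 'w \<Rightarrow> 'e::real_normed_vector"
  assumes lim: "\<forall>\<^sub>F n in sequentially. norm (y n \<omega> - x) \<le> (1/4) ^ n"
  shows "\<exists>C\<ge>0. \<forall>k. sqrt (norm (tracking_integral s y k \<omega> - y k \<omega>)) \<le> C * majorant s k \<omega>"
proof -
  let ?u = "\<lambda>k. norm (y k \<omega> - y (Suc k) \<omega>)"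
  let ?D = "\<lambda>k. tracking_integral s y k \<omega> - y k \<omega>"
  obtain N where N: "\<And>n. N \<le> n \<Longrightarrow> norm (y n \<omega> - x) \<le> (1/4) ^ n"
    using lim unfolding eventually_sequentially by blast
  \<comment> \<open>The three terms serve the late moves (1/4 to the k plus the next power is at
    most twice the former), the initial error, as the majorant starts at 1, and the finitely many
    early moves rescaled by \<open>4 ^ k\<close>.\<close>
  define B where "B = 2 + norm (?D 0) + (\<Sum>k<N. 4 ^ k * ?u k)"
  have sum0: "0 \<le> (\<Sum>k<N. 4 ^ k * ?u k)" by (intro sum_nonneg) simp
  have uB: "?u k \<le> B * (1/4) ^ k" for k
  proof (cases "k < N")
    case True
    then have "4 ^ k * ?u k \<le> (\<Sum>k<N. 4 ^ k * ?u k)"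
      by (intro member_le_sum) auto
    also have "\<dots> \<le> B" by (simp add: B_def)
    finally show ?thesis by (simp add: field_simps power_divide)
  next
    case False
    have "?u k \<le> norm (y k \<omega> - x) + norm (y (Suc k) \<omega> - x)"
      by (metis dist_norm dist_triangle2)
    also have "\<dots> \<le> (1/4) ^ k + (1/4) ^ Suc k" using N False by (intro add_mono N) (simp_all del: power_Suc)
    also have "\<dots> \<le> 2 * (1/4) ^ k" by simp
    also have "\<dots> \<le> B * (1/4) ^ k" using sum0 by (intro mult_right_mono) (auto simp: B_def)
    finally show ?thesis .
  qed
  have B: "0 \<le> B" "norm (?D 0) \<le> B" using sum0 by (auto simp: B_def)
  have "sqrt (norm (?D k)) \<le> sqrt B * majorant s k \<omega>" for k
  proof (induction k)
    case 0 then show ?case using B by simp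
  next
    case (Suc k)
    let ?g = "1 + (W (s (Suc k)) \<omega> - W (s k) \<omega>) / sqrt (s (Suc k) - s k) / 10"
    have "norm (?D (Suc k)) \<le> \<bar>?g\<bar> * norm (?D k) + ?u k"
      unfolding tracking_error_Suc by (rule norm_triangle_le) simp
    then have "sqrt (norm (?D (Suc k))) \<le> sqrt (\<bar>?g\<bar> * norm (?D k) + ?u k)" by (rule real_sqrt_le_mono)
    also have "\<dots> \<le> sqrt (\<bar>?g\<bar> * norm (?D k)) + sqrt (?u k)"
      by (rule sqrt_add_le_add_sqrt) auto
    also have "\<dots> \<le> sqrt \<bar>?g\<bar> * (sqrt B * majorant s k \<omega>) + sqrt B * (1/2) ^ k"
    proof (rule add_mono)
      show "sqrt (\<bar>?g\<bar> * norm (?D k)) \<le> sqrt \<bar>?g\<bar> * (sqrt B * majorant s k \<omega>)"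
        unfolding real_sqrt_mult by (intro mult_left_mono Suc) simp
      have "sqrt ((1/4) ^ k) = (1/2) ^ k" by (simp add: real_sqrt_power real_sqrt_divide)
      then show "sqrt (?u k) \<le> sqrt B * (1/2) ^ k"
        using real_sqrt_le_mono[OF uB[of k]] by (simp add: real_sqrt_mult)
    qed
    also have "\<dots> = sqrt B * majorant s (Suc k) \<omega>" by (simp add: algebra_simps)
    finally show ?case .
  qed
  then show ?thesis using B by (intro exI[of _ "sqrt B"]) auto
qed

text \<open>The error is bounded by the square of the majorant: one factor absorbs the weight k + 1,
  the other tends to zero. The first conclusion controls the oscillation between grid points, the
  second the square integral of the integrand.\<close>

lemma tracking_error_decay:
  fixes y :: "nat \<Rightarrow> 'w \<Rightarrow> 'e::real_normed_vector"
  assumes lim: "\<forall>\<^sub>F n in sequentially. norm (y n \<omega> - x) \<le> (1/4) ^ n"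
    and sum: "summable (\<lambda>k. (real k + 1) * majorant s k \<omega>)"
  shows "(\<lambda>k. (real k + 1) * norm (tracking_integral s y k \<omega> - y k \<omega>)) \<longlonglongrightarrow> 0"
    and "summable (\<lambda>k. (norm (tracking_integral s y k \<omega> - y k \<omega>))\<^sup>2)"
proof -
  let ?D = "\<lambda>k. norm (tracking_integral s y k \<omega> - y k \<omega>)"
  let ?m = "\<lambda>k. majorant s k \<omega>"
  obtain C where C: "0 \<le> C" "\<And>k. sqrt (?D k) \<le> C * ?m k"
    using tracking_error_majorant[where y=y and \<omega>=\<omega> and x=x, OF lim] by blast
  have D: "?D k \<le> C\<^sup>2 * (?m k)\<^sup>2" for k
    using power_mono[OF C(2), of k 2] by (simp add: power_mult_distrib)
  have km0: "(\<lambda>k. (real k + 1) * ?m k) \<longlonglongrightarrow> 0" by (rule summable_LIMSEQ_zero[OF sum])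
  have m_le: "?m k \<le> (real k + 1) * ?m k" for k
    using mult_right_mono[of 1 "real k + 1" "?m k"] by (simp add: majorant_nonneg)
  have m0: "?m \<longlonglongrightarrow> 0"
    by (rule tendsto_sandwich[OF _ _ tendsto_const km0]) (auto simp: majorant_nonneg m_le)
  show "(\<lambda>k. (real k + 1) * ?D k) \<longlonglongrightarrow> 0"
  proof (rule tendsto_sandwich[OF _ _ tendsto_const])
    show "\<forall>\<^sub>F k in sequentially. (real k + 1) * ?D k \<le> C\<^sup>2 * ((real k + 1) * ?m k) * ?m k"
    proof (intro always_eventually allI)
      fix k
      have "(real k + 1) * ?D k \<le> (real k + 1) * (C\<^sup>2 * (?m k)\<^sup>2)" by (intro mult_left_mono D) simp
      then show "(real k + 1) * ?D k \<le> C\<^sup>2 * ((real k + 1) * ?m k) * ?m k"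
        by (simp add: power2_eq_square mult_ac)
    qed
    show "(\<lambda>k. C\<^sup>2 * ((real k + 1) * ?m k) * ?m k) \<longlonglongrightarrow> 0"
      using tendsto_mult[OF tendsto_mult_left[OF km0] m0] by simp
  qed auto
  have "summable (\<lambda>k. (C\<^sup>2)\<^sup>2 * ((real k + 1) * ?m k))" by (intro summable_mult sum)
  moreover have "\<forall>\<^sub>F k in sequentially. norm ((?D k)\<^sup>2) \<le> (C\<^sup>2)\<^sup>2 * ((real k + 1) * ?m k)"
    \<comment> \<open>Once the majorant is below 1, its fourth power is below the majorant
      itself.\<close>
    using order_tendstoD(2)[OF m0 zero_less_one]
  proof eventually_elim
    case (elim k)
    have "(?D k)\<^sup>2 \<le> (C\<^sup>2 * (?m k)\<^sup>2)\<^sup>2" by (intro power_mono D) simp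
    also have "\<dots> = (C\<^sup>2)\<^sup>2 * ?m k ^ 4" by (simp add: power_mult_distrib)
    also have "\<dots> \<le> (C\<^sup>2)\<^sup>2 * ?m k"
      using power_decreasing[of 1 4 "?m k"] elim majorant_nonneg[of s k \<omega>]
      by (intro mult_left_mono) auto
    also have "\<dots> \<le> (C\<^sup>2)\<^sup>2 * ((real k + 1) * ?m k)" by (intro mult_left_mono m_le) simp
    finally show ?case by simp
  qed
  ultimately show "summable (\<lambda>k. (?D k)\<^sup>2)" by (rule summable_comparison_test_ev[rotated])
qed

text \<open>The mesh cancels twice: the squared stake times the interval length is the squared error
  over 100, and the oscillation bound times the stake is \<open>(real k + 3) / 10\<close> times the
  error.\<close>

lemma stake_path_limits:
  fixes y :: "nat \<Rightarrow> 'w \<Rightarrow> 'e::real_normed_vector"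
  assumes "time_grid s a b"
    and lim: "\<forall>\<^sub>F n in sequentially. norm (y n \<omega> - x) \<le> (1/4) ^ n"
    and sum: "summable (\<lambda>k. (real k + 1) * majorant s k \<omega>)"
    and osc: "\<forall>\<^sub>F k in sequentially. \<forall>v\<in>{s k..s (Suc k)}.
      \<bar>W v \<omega> - W (s k) \<omega>\<bar> \<le> (real k + 3) * sqrt (s (Suc k) - s k)"
  shows "summable (\<lambda>k. (norm (stake s y k \<omega>))\<^sup>2 * (s (Suc k) - s k))"
    and "time_grid.tail_limit s a b
      (time_grid.closed_path s b (\<lambda>u. W u \<omega>) (\<lambda>k. stake s y k \<omega>) x) x"
proof -
  interpret time_grid s a b by fact
  let ?D = "\<lambda>k. norm (tracking_integral s y k \<omega> - y k \<omega>)"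
  note D0 = tracking_error_decay(1)[where y=y and \<omega>=\<omega> and x=x, OF lim sum]
  have norm_stake: "norm (stake s y k \<omega>) = ?D k / 10 / sqrt (mesh k)" for k
    using mesh_pos[of k] by (simp add: stake_def)
  have "(norm (stake s y k \<omega>))\<^sup>2 * mesh k = (1/100) * (?D k)\<^sup>2" for k
  proof -
    have "(d / 10 / sqrt m)\<^sup>2 * m = (1/100) * d\<^sup>2" if "0 < m" for d m :: real
      using that by (simp add: power_divide)
    from this[OF mesh_pos] show ?thesis by (simp only: norm_stake)
  qed
  then show "summable (\<lambda>k. (norm (stake s y k \<omega>))\<^sup>2 * mesh k)"
    using summable_mult[OF tracking_error_decay(2)[where y=y and \<omega>=\<omega> and x=x, OF lim sum], of "1/100"] by (simp only:)
  have "?D \<longlonglongrightarrow> 0"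
    by (rule tendsto_sandwich[OF _ _ tendsto_const D0])
       (auto intro!: always_eventually simp: mult_le_cancel_right1)
  then have "(\<lambda>k. tracking_integral s y k \<omega> - y k \<omega>) \<longlonglongrightarrow> 0" by (rule tendsto_norm_zero_cancel)
  moreover have "(\<lambda>n. y n \<omega>) \<longlonglongrightarrow> x"
  proof (rule LIM_zero_cancel, rule Lim_null_comparison)
    show "\<forall>\<^sub>F n in sequentially. norm (y n \<omega> - x) \<le> (1/4) ^ n" by (rule lim)
    show "(\<lambda>n. (1/4) ^ n :: real) \<longlonglongrightarrow> 0" by (rule LIMSEQ_realpow_zero) auto
  qed
  ultimately have "(\<lambda>k. (tracking_integral s y k \<omega> - y k \<omega>) + y k \<omega>) \<longlonglongrightarrow> 0 + x"
    by (intro tendsto_add) auto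
  then have I: "(\<lambda>n. step_path s (\<lambda>u. W u \<omega>) (\<lambda>k. stake s y k \<omega>) (s n)) \<longlonglongrightarrow> x"
    by (simp add: step_path_stake[OF assms(1)])
  show "tail_limit (closed_path (\<lambda>u. W u \<omega>) (\<lambda>k. stake s y k \<omega>) x) x"
  proof (rule closed_path_tail_limit[OF I])
    \<comment> \<open>The 3/10 comes from \<open>real n + 3 \<le> 3 * (real n + 1)\<close> and the
      factor 1/10 of the stake.\<close>
    show "(\<lambda>k. 3/10 * ((real k + 1) * ?D k)) \<longlonglongrightarrow> 0"
      using tendsto_mult_left[OF D0, of "3/10"] by simp
    show "\<forall>\<^sub>F n in sequentially. \<forall>t\<in>{s n..s (Suc n)}.
        norm ((W t \<omega> - W (s n) \<omega>) *\<^sub>R stake s y n \<omega>) \<le> 3/10 * ((real n + 1) * ?D n)"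
      using osc
    proof eventually_elim
      case (elim n)
      show ?case
      proof
        fix t assume "t \<in> {s n..s (Suc n)}"
        then have "\<bar>W t \<omega> - W (s n) \<omega>\<bar> * norm (stake s y n \<omega>) \<le>
            ((real n + 3) * sqrt (mesh n)) * norm (stake s y n \<omega>)"
          using elim by (intro mult_right_mono) auto
        also have "\<dots> = (real n + 3) * ?D n / 10"
          using mesh_pos[of n] unfolding norm_stake by simp
        also have "\<dots> \<le> (3 * (real n + 1)) * ?D n / 10"
          by (intro divide_right_mono mult_right_mono) auto
        also have "\<dots> = 3/10 * ((real n + 1) * ?D n)" by simp
        finally show "norm ((W t \<omega> - W (s n) \<omega>) *\<^sub>R stake s y n \<omega>) \<le> 3/10 * ((real n + 1) * ?D n)"
          by (simp only: norm_scaleR)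
      qed
    qed
  qed
qed

text \<open>The integrand has infinitely many steps accumulating at \<open>b\<close>; its
  truncations are the step processes of the definition. Both required convergences even hold almost
  surely: one is the vanishing of the tails of a convergent series, the other the convergence of the
  path frozen at \<open>s n\<close>.\<close>

lemma integral_representation:
  fixes \<xi> :: "'w \<Rightarrow> 'e::banach"
  assumes a: "0 \<le> a" "ereal a < b" and sm: "strongly_measurable M \<xi>"
    and \<xi>: "\<xi> \<in> borel_measurable (sigma_before M F b)"
  shows "\<exists>\<phi> \<zeta>. strongly_progressively_measurable F a b \<phi> \<and> is_integral_process M F W a b \<phi> \<zeta> \<and>
    (AE \<omega> in M. if b = \<infinity> then (\<zeta> \<omega> \<longlongrightarrow> \<xi> \<omega>) at_top else \<zeta> \<omega> (real_of_ereal b) = \<xi> \<omega>)"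
proof -
  obtain s y where grid: "time_grid s a b" and y: "\<And>n. simple_function (F (s n)) (y n)"
    and lim: "AE \<omega> in M. \<forall>\<^sub>F n in sequentially. norm (y n \<omega> - \<xi> \<omega>) \<le> (1/4) ^ n"
    using approximating_grid[OF \<xi> sm a] by blast
  interpret time_grid s a b by (rule grid)
  define \<eta> where "\<eta> = stake s y"
  define \<phi> where "\<phi> t \<omega> = step_fun s (\<lambda>k. \<eta> k \<omega>) t" for t \<omega>
  define \<zeta> where "\<zeta> \<omega> = closed_path (\<lambda>u. W u \<omega>) (\<lambda>k. \<eta> k \<omega>) (\<xi> \<omega>)" for \<omega>
  define S where "S n = map (\<lambda>k. (s k, s (Suc k), \<eta> k)) [0..<n]" for n
  have \<eta>F: "strongly_measurable (F (s k)) (\<eta> k)" for k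
    unfolding \<eta>_def by (intro stake_measurable[OF grid] strongly_measurable_simple y)
  have \<eta>M: "strongly_measurable M (\<eta> k)" for k
    by (rule F_strongly_measurable_M[OF \<eta>F s_nonneg])
  have sum_tail: "AE \<omega> in M. summable (\<lambda>k. (norm (\<eta> k \<omega>))\<^sup>2 * mesh k) \<and> tail_limit (\<zeta> \<omega>) (\<xi> \<omega>)"
    using lim majorant_summable[of s, OF s_nonneg s_less[OF lessI]]
      oscillation_eventually_le[of s, OF s_nonneg s_less[OF lessI]]
    unfolding \<zeta>_def \<eta>_def by eventually_elim (intro conjI stake_path_limits[OF grid])
  have cont: "AE \<omega> in M. \<forall>n. continuous_on {a..s n} (\<zeta> \<omega>)"
    using continuous_W unfolding \<zeta>_def by eventually_elim (intro allI closed_path_continuous)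
  have blin: "blinfun_apply x (\<phi> t \<omega>) = step_fun s (\<lambda>k. blinfun_apply x (\<eta> k \<omega>)) t"
    for x :: "'e \<Rightarrow>\<^sub>L real" and t \<omega>
    by (simp add: \<phi>_def step_fun_blinfun)
  have sum_x: "AE \<omega> in M. summable (\<lambda>k. (blinfun_apply x (\<eta> k \<omega>))\<^sup>2 * mesh k)" for x :: "'e \<Rightarrow>\<^sub>L real"
    using sum_tail
  proof eventually_elim
    case (elim \<omega>)
    then have "summable (\<lambda>k. (norm x)\<^sup>2 * ((norm (\<eta> k \<omega>))\<^sup>2 * mesh k))" by (intro summable_mult) simp
    then show ?case
    proof (rule summable_comparison_test')
      fix k
      have "\<bar>blinfun_apply x (\<eta> k \<omega>)\<bar> \<le> norm x * norm (\<eta> k \<omega>)"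
        using norm_blinfun[of x "\<eta> k \<omega>"] by simp
      then have "(blinfun_apply x (\<eta> k \<omega>))\<^sup>2 \<le> (norm x * norm (\<eta> k \<omega>))\<^sup>2"
        by (metis abs_ge_zero power2_abs power_mono)
      then show "norm ((blinfun_apply x (\<eta> k \<omega>))\<^sup>2 * mesh k) \<le> (norm x)\<^sup>2 * ((norm (\<eta> k \<omega>))\<^sup>2 * mesh k)"
        using mesh_pos[of k] by (simp add: power_mult_distrib abs_mult mult_right_mono flip: mult.assoc)
    qed
  qed
  have progressive: "strongly_progressively_measurable F a b \<phi>"
    unfolding strongly_progressively_measurable_def \<phi>_def
  proof
    fix t assume "t \<in> T"
    show "strongly_measurable (restrict_space borel {a..t} \<Otimes>\<^sub>M F t) (\<lambda>(u, \<omega>). step_fun s (\<lambda>k. \<eta> k \<omega>) u)"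
    proof (rule step_fun_strongly_measurable)
      fix k u assume "u \<in> {a..t}" "s k < u"
      then show "strongly_measurable (F t) (\<eta> k)"
        by (intro F_strongly_measurable_mono[OF \<eta>F s_nonneg]) simp
    qed
  qed
  have process: "strongly_measurable_process M a b \<phi>"
    unfolding strongly_measurable_process_def \<phi>_def by (rule step_fun_strongly_measurable[OF \<eta>M])
  have adapted: "strongly_adapted F a b \<phi>"
    unfolding strongly_adapted_def
  proof
    fix t assume "t \<in> T"
    show "strongly_measurable (F t) (\<phi> t)"
    proof (cases "\<exists>j. s j < t \<and> t \<le> s (Suc j)")
      case True
      then obtain j where j: "s j < t" "t \<le> s (Suc j)" by blast
      then have "\<phi> t = \<eta> j" by (simp add: \<phi>_def fun_eq_iff step_fun_eq[OF j])
      then show ?thesis using F_strongly_measurable_mono[OF \<eta>F s_nonneg] j by simp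
    next
      case False
      then have "\<phi> t = (\<lambda>_. 0)" by (simp add: \<phi>_def fun_eq_iff step_fun_eq_0)
      then show ?thesis by (simp add: strongly_measurable_const)
    qed
  qed
  have weakly: "weakly_L0_L2 M a b \<phi>"
    unfolding weakly_L0_L2_def blin
    by (intro allI step_fun_L0_L2[OF grid] strongly_measurable_borel strongly_measurable_blinfun \<eta>M sum_x)
  have \<zeta>_L0: "\<zeta> \<in> L0 M (Cb a b) (Cb_dist a b)"
  proof (rule L0_Cb[OF grid])
    fix t assume "t \<in> T"
    then have t0: "0 \<le> t" using a by (simp add: time_interval_def)
    show "strongly_measurable M (\<lambda>\<omega>. \<zeta> \<omega> t)"
    proof (cases "ereal t < b")
      case True
      then obtain n where n: "t < s n" using s_cofinal by blast
      have "strongly_measurable M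
          (\<lambda>\<omega>. \<Sum>k<n. (W (min (s (Suc k)) t) \<omega> - W (min (s k) t) \<omega>) *\<^sub>R \<eta> k \<omega>)"
        using t0 s_nonneg
        by (intro strongly_measurable_sum strongly_measurable_scaleR borel_measurable_diff W_measurable \<eta>M) auto
      then show ?thesis using n True by (simp add: \<zeta>_def closed_path_def step_path_finite[of t n])
    next
      case False
      then show ?thesis using sm by (simp add: \<zeta>_def closed_path_def)
    qed
  next
    show "AE \<omega> in M. tail_limit (\<zeta> \<omega>) (\<xi> \<omega>)" using sum_tail by eventually_elim simp
  qed (rule cont)
  have adapted_S: "adapted_step F a b (S n)" for n
    using a_le_s s_less[OF lessI] less_imp_le[OF s_less_b] \<eta>F by (auto simp: adapted_step_def S_def)
  have L2_conv: "tends_in_prob M (L2_dist a b) (\<lambda>n \<omega> t. blinfun_apply x (step_process (S n) t \<omega>))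
      (\<lambda>\<omega> t. blinfun_apply x (\<phi> t \<omega>))" for x :: "'e \<Rightarrow>\<^sub>L real"
  proof (rule tends_in_prob_AE)
    show "AE \<omega> in M. (\<lambda>n. L2_dist a b (\<lambda>t. blinfun_apply x (step_process (S n) t \<omega>))
        (\<lambda>t. blinfun_apply x (\<phi> t \<omega>))) \<longlonglongrightarrow> 0"
      using sum_x[of x]
    proof eventually_elim
      case (elim \<omega>)
      let ?c = "\<lambda>k. blinfun_apply x (\<eta> k \<omega>)"
      have "blinfun_apply x (step_process (S n) t \<omega>) = step_fun s (\<lambda>k. if k < n then ?c k else 0) t" for n t
        unfolding S_def step_process_eq step_fun_blinfun
        by (rule arg_cong[where f="\<lambda>c. step_fun s c t"]) (auto simp: blinfun.zero_right)
      then have "L2_dist a b (\<lambda>t. blinfun_apply x (step_process (S n) t \<omega>)) (\<lambda>t. blinfun_apply x (\<phi> t \<omega>)) =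
          sqrt (\<Sum>k. (?c (k + n))\<^sup>2 * mesh (k + n))" for n
        using L2_dist_truncation[OF elim, of n ?c] by (simp add: blin)
      moreover have "(\<lambda>n. sqrt (\<Sum>k. (?c (k + n))\<^sup>2 * mesh (k + n))) \<longlonglongrightarrow> sqrt 0"
        using suminf_exist_split2[OF elim] by (intro tendsto_real_sqrt) simp
      ultimately show ?case by simp
    qed
  qed
  have Cb_conv: "tends_in_prob M (Cb_dist a b) (\<lambda>n \<omega> t. step_integral W (S n) t \<omega>) \<zeta>"
  proof (rule tends_in_prob_AE)
    have eq: "(\<lambda>t. step_integral W (S n) t \<omega>) = (\<lambda>t. \<zeta> \<omega> (min t (s n)))" for n \<omega>
      by (simp add: S_def step_integral_eq \<zeta>_def closed_path_min)
    show "AE \<omega> in M. (\<lambda>n. Cb_dist a b (\<lambda>t. step_integral W (S n) t \<omega>) (\<zeta> \<omega>)) \<longlonglongrightarrow> 0"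
      using sum_tail unfolding eq by eventually_elim (blast intro: tail_limit_stopped)
  qed
  have "is_integral_process M F W a b \<phi> \<zeta>"
    unfolding is_integral_process_def
    using process adapted weakly \<zeta>_L0 adapted_S L2_conv Cb_conv by blast
  moreover have "AE \<omega> in M. if b = \<infinity> then (\<zeta> \<omega> \<longlongrightarrow> \<xi> \<omega>) at_top else \<zeta> \<omega> (real_of_ereal b) = \<xi> \<omega>"
    using sum_tail by eventually_elim (rule tail_limit_end, simp)
  ultimately show ?thesis using progressive by blast
qed

end


section \<open>Measurability of the integral\<close>

context complete_filtration
begin

text \<open>Completeness at work: a null set containing all points of failed convergence belongs to
  \<open>G\<close>, so setting everything to zero there leaves an everywhere convergent
  \<open>G\<close>-measurable sequence.\<close>

lemma AE_limit_measurable: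
  fixes f :: "nat \<Rightarrow> 'w \<Rightarrow> 'e::{metric_space, zero}"
  assumes G: "null_sets M \<subseteq> sets G" "space G = space M"
    and f: "\<And>n. f n \<in> borel_measurable G" and lim: "AE \<omega> in M. (\<lambda>n. f n \<omega>) \<longlonglongrightarrow> g \<omega>"
  shows "\<exists>h\<in>borel_measurable G. AE \<omega> in M. g \<omega> = h \<omega>"
proof -
  obtain N where N: "{\<omega>\<in>space M. \<not> (\<lambda>n. f n \<omega>) \<longlonglongrightarrow> g \<omega>} \<subseteq> N" "N \<in> null_sets M"
    using lim by (auto elim!: AE_E simp: null_sets_def)
  define h where "h \<omega> = (if \<omega> \<in> N then 0 else g \<omega>)" for \<omega>
  have [measurable]: "N \<in> sets G" using N(2) G(1) by blast
  have "h \<in> borel_measurable G"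
  proof (rule borel_measurable_LIMSEQ_metric)
    show "(\<lambda>\<omega>. if \<omega> \<in> N then 0 else f n \<omega>) \<in> borel_measurable G" for n
      using f[of n] by measurable
    show "(\<lambda>n. if \<omega> \<in> N then 0 else f n \<omega>) \<longlonglongrightarrow> h \<omega>" if "\<omega> \<in> space G" for \<omega>
      using that N(1) G(2) by (auto simp: h_def)
  qed
  moreover have "AE \<omega> in M. g \<omega> = h \<omega>"
    using AE_not_in[OF N(2)] by eventually_elim (simp add: h_def)
  ultimately show ?thesis by blast
qed

text \<open>Off a null set in \<open>G\<close> the preimages under \<open>f\<close> and
  \<open>h\<close> agree; the part inside is a null set because \<open>f\<close> is
  \<open>M\<close>-measurable, hence again belongs to \<open>G\<close>.\<close>

lemma AE_eq_measurable:
  assumes G: "null_sets M \<subseteq> sets G" "space G = space M"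
    and f: "f \<in> measurable M A" and h: "h \<in> measurable G A" and eq: "AE \<omega> in M. f \<omega> = h \<omega>"
  shows "f \<in> measurable G A"
proof (rule measurableI)
  show "f \<omega> \<in> space A" if "\<omega> \<in> space G" for \<omega> using f that G(2) by (auto simp: measurable_def)
  fix B assume B: "B \<in> sets A"
  obtain N where N: "{\<omega>\<in>space M. f \<omega> \<noteq> h \<omega>} \<subseteq> N" "N \<in> null_sets M"
    using eq by (auto elim!: AE_E simp: null_sets_def)
  have "(f -` B \<inter> space M) \<inter> N \<in> null_sets M"
    using null_set_Int1[OF N(2) measurable_sets[OF f B]] by (simp add: Int_commute)
  moreover have "f -` B \<inter> space G = ((h -` B \<inter> space G) - N) \<union> ((f -` B \<inter> space M) \<inter> N)"
    using N(1) by (auto simp: G(2))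
  ultimately show "f -` B \<inter> space G \<in> sets G"
    using G(1) N(2) measurable_sets[OF h B] by (simp add: sets.Un sets.Diff subset_iff)
qed

end

section \<open>Measurable versions of the events in the convergence of paths\<close>

lemma Cb_dist_upper:
  assumes "f \<in> Cb a b" "g \<in> Cb a b"
  shows "bdd_above ((\<lambda>t. norm (f t - g t)) ` time_interval a b)"
    and "t \<in> time_interval a b \<Longrightarrow> norm (f t - g t) \<le> Cb_dist a b f g"
proof -
  obtain C where C: "\<And>t. t \<in> time_interval a b \<Longrightarrow> norm (f t) \<le> C"
    using assms(1) by (auto simp: Cb_def bounded_iff)
  obtain D where D: "\<And>t. t \<in> time_interval a b \<Longrightarrow> norm (g t) \<le> D"
    using assms(2) by (auto simp: Cb_def bounded_iff)
  show *: "bdd_above ((\<lambda>t. norm (f t - g t)) ` time_interval a b)"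
    by (rule bdd_aboveI[of _ "C + D"]) (auto intro!: order_trans[OF norm_triangle_ineq4] add_mono C D)
  show "norm (f t - g t) \<le> Cb_dist a b f g" if "t \<in> time_interval a b"
    unfolding Cb_dist_def by (rule cSUP_upper[OF that *])
qed

text \<open>By continuity, the supremum over \<open>time_interval a b\<close> may be taken over a countable dense subset.\<close>

lemma (in prob_space) Cb_dist_event:
  fixes X :: "'a \<Rightarrow> real \<Rightarrow> 'e::real_normed_vector"
  assumes ne: "time_interval a b \<noteq> {}" and \<zeta>: "\<zeta> \<in> L0 M (Cb a b) (Cb_dist a b)"
    and X: "AE \<omega> in M. X \<omega> \<in> Cb a b"
    and Xm: "\<And>t. t \<in> time_interval a b \<Longrightarrow> strongly_measurable M (\<lambda>\<omega>. X \<omega> t)"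
  shows "\<exists>B\<in>sets M. AE \<omega> in M. \<epsilon> < Cb_dist a b (X \<omega>) (\<zeta> \<omega>) \<longleftrightarrow> \<omega> \<in> B"
proof -
  let ?T = "time_interval a b"
  obtain \<sigma> where \<sigma>: "\<And>n. simple_function M (\<sigma> n)" "\<And>n. \<sigma> n ` space M \<subseteq> Cb a b"
    and \<sigma>_lim: "AE \<omega> in M. (\<lambda>n. Cb_dist a b (\<sigma> n \<omega>) (\<zeta> \<omega>)) \<longlonglongrightarrow> 0" and \<zeta>Cb: "AE \<omega> in M. \<zeta> \<omega> \<in> Cb a b"
    using \<zeta> unfolding L0_def by blast
  obtain D :: "real set" where D: "countable D" "D \<subseteq> ?T" "?T \<subseteq> closure D"
    using separable by metis
  \<comment> \<open>\<zeta> is given only up to almost sure equality, so its value at a fixed time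
    may lack measurability. The limit of the simple approximants is measurable everywhere and gives
    the right value almost surely.\<close>
  define G where "G t \<omega> = lim (\<lambda>n. norm (X \<omega> t - \<sigma> n \<omega> t))" for t \<omega>
  have G: "G t \<in> borel_measurable M" if "t \<in> ?T" for t
  proof -
    have "strongly_measurable M (\<lambda>\<omega>. \<sigma> n \<omega> t)" for n
      by (intro strongly_measurable_simple simple_function_compose1[OF \<sigma>(1)])
    then have "(\<lambda>\<omega>. norm (X \<omega> t - \<sigma> n \<omega> t)) \<in> borel_measurable M" for n
      by (intro strongly_measurable_norm_diff Xm that)
    then show ?thesis unfolding G_def[abs_def] by (rule borel_measurable_lim_metric)
  qed
  define B where "B = (\<Union>t\<in>D. {\<omega>\<in>space M. \<epsilon> < G t \<omega>})"
  have "B \<in> sets M"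
    unfolding B_def using G D(1,2) by (intro sets.countable_UN' borel_measurable_less) auto
  moreover have "AE \<omega> in M. \<epsilon> < Cb_dist a b (X \<omega>) (\<zeta> \<omega>) \<longleftrightarrow> \<omega> \<in> B"
    using \<sigma>_lim \<zeta>Cb X AE_space
  proof eventually_elim
    case (elim \<omega>)
    have \<sigma>Cb: "\<sigma> n \<omega> \<in> Cb a b" for n using \<sigma>(2) elim(4) by blast
    have G_eq: "G t \<omega> = norm (X \<omega> t - \<zeta> \<omega> t)" if "t \<in> ?T" for t
    proof -
      have "(\<lambda>n. norm (\<sigma> n \<omega> t - \<zeta> \<omega> t)) \<longlonglongrightarrow> 0"
      proof (rule tendsto_sandwich[OF _ _ tendsto_const elim(1)])
        show "\<forall>\<^sub>F n in sequentially. norm (\<sigma> n \<omega> t - \<zeta> \<omega> t) \<le> Cb_dist a b (\<sigma> n \<omega>) (\<zeta> \<omega>)"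
          by (intro always_eventually allI Cb_dist_upper(2)[OF \<sigma>Cb elim(2) that])
      qed simp
      then have "(\<lambda>n. \<sigma> n \<omega> t) \<longlonglongrightarrow> \<zeta> \<omega> t" by (rule LIM_zero_cancel[OF tendsto_norm_zero_cancel])
      then have "(\<lambda>n. norm (X \<omega> t - \<sigma> n \<omega> t)) \<longlonglongrightarrow> norm (X \<omega> t - \<zeta> \<omega> t)" by (intro tendsto_intros)
      then show ?thesis unfolding G_def by (rule limI)
    qed
    have "\<epsilon> < Cb_dist a b (X \<omega>) (\<zeta> \<omega>) \<longleftrightarrow> (\<exists>t\<in>?T. \<epsilon> < norm (X \<omega> t - \<zeta> \<omega> t))"
      unfolding Cb_dist_def by (intro less_cSUP_iff ne Cb_dist_upper elim)
    also have "\<dots> \<longleftrightarrow> (\<exists>t\<in>D. \<epsilon> < norm (X \<omega> t - \<zeta> \<omega> t))"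
    proof
      assume "\<exists>t\<in>?T. \<epsilon> < norm (X \<omega> t - \<zeta> \<omega> t)"
      then obtain t where t: "t \<in> ?T" "\<epsilon> < norm (X \<omega> t - \<zeta> \<omega> t)" by blast
      obtain u where u: "\<And>n. u n \<in> D" "u \<longlonglongrightarrow> t"
        using subsetD[OF D(3) t(1)] by (auto simp: closure_sequential)
      have "continuous_on ?T (\<lambda>t. norm (X \<omega> t - \<zeta> \<omega> t))"
        using elim by (intro continuous_intros) (auto simp: Cb_def)
      then have "(\<lambda>n. norm (X \<omega> (u n) - \<zeta> \<omega> (u n))) \<longlonglongrightarrow> norm (X \<omega> t - \<zeta> \<omega> t)"
        by (rule continuous_on_tendsto_compose[OF _ u(2) t(1)])
          (intro always_eventually allI subsetD[OF D(2) u(1)])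
      from order_tendstoD(1)[OF this t(2)] obtain n where "\<epsilon> < norm (X \<omega> (u n) - \<zeta> \<omega> (u n))"
        by (auto simp: eventually_sequentially)
      then show "\<exists>t\<in>D. \<epsilon> < norm (X \<omega> t - \<zeta> \<omega> t)" using u(1) by blast
    qed (use D(2) in blast)
    also have "\<dots> \<longleftrightarrow> (\<exists>t\<in>D. \<epsilon> < G t \<omega>)"
      by (intro bex_cong refl) (simp add: G_eq subsetD[OF D(2)])
    also have "\<dots> \<longleftrightarrow> \<omega> \<in> B" using elim(4) by (auto simp: B_def)
    finally show ?case .
  qed
  ultimately show ?thesis by blast
qed

text \<open>Replaces the events of \<open>tends_in_prob\<close> by genuine events of
  \<open>M\<close>, to which Borel-Cantelli applies.\<close>

lemma (in prob_space) measure_completion_AE_eq: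
  assumes "B \<in> sets M" "AE \<omega> in M. P \<omega> \<longleftrightarrow> \<omega> \<in> B"
  shows "measure (completion M) {\<omega>\<in>space M. P \<omega>} = prob B"
proof -
  have ae: "AE \<omega> in completion M. \<omega> \<in> {\<omega>\<in>space M. P \<omega>} \<longleftrightarrow> \<omega> \<in> B"
    using AE_completion[OF assms(2)] AE_space by eventually_elim auto
  have B: "B \<in> sets (completion M)" using assms(1) by (rule sets_completionI_sets)
  have "{\<omega>\<in>space M. P \<omega>} \<in> sets (completion M)"
    by (rule completion.in_sets_AE[OF _ B]) (use ae in auto)
  from measure_eq_AE[OF ae this B] show ?thesis using assms(1) by simp
qed

context brownian_motion
begin

lemma step_integral_measurable:
  fixes S :: "('w, 'e::real_normed_vector) step"
  assumes S: "adapted_step F a b S" and a: "0 \<le> a" "a \<le> t"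
  shows "strongly_measurable (F t) (step_integral W S t)"
proof -
  have "strongly_measurable (F t) (\<lambda>\<omega>. case x of (c, d, \<eta>) \<Rightarrow> (W (min d t) \<omega> - W (min c t) \<omega>) *\<^sub>R \<eta> \<omega>)"
    if x: "x \<in> set S" for x
  proof (cases x)
    case (fields c d \<eta>)
    then have cd: "a \<le> c" "c < d" "strongly_measurable (F c) \<eta>"
      using S x unfolding adapted_step_def by auto
    show ?thesis
    proof (cases "c \<le> t")
      case True
      have "W (min d t) \<in> borel_measurable (F t)" "W (min c t) \<in> borel_measurable (F t)"
        using a cd by (auto intro!: W_measurable_F)
      moreover have "strongly_measurable (F t) \<eta>"
        using F_strongly_measurable_mono[OF cd(3)] a cd True by auto
      ultimately show ?thesis unfolding fields prod.case
        by (auto intro!: strongly_measurable_scaleR)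
    next
      \<comment> \<open>\<eta> is then not known to be \<open>F t\<close>-measurable, but both
        stopped times equal \<open>t\<close> and the summand vanishes.\<close>
      case False
      then show ?thesis using cd by (simp add: fields strongly_measurable_const)
    qed
  qed
  then show ?thesis unfolding step_integral_def[abs_def] by (rule strongly_measurable_sum_list)
qed

lemma step_integral_Cb:
  fixes S :: "('w, 'e::real_normed_vector) step"
  assumes "adapted_step F a b S" and a: "0 \<le> a" and W: "continuous_on {0..} (\<lambda>t. W t \<omega>)"
  shows "(\<lambda>t. step_integral W S t \<omega>) \<in> Cb a b"
  using assms(1)
proof (induction S)
  case Nil
  then show ?case by (auto simp: Cb_def step_integral_def bounded_iff)
next
  case (Cons x S)
  let ?T = "time_interval a b"
  obtain c d \<eta> where x: "x = (c, d, \<eta>)" by (cases x)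
  have cd: "a \<le> c" "c < d" using Cons.prems by (auto simp: adapted_step_def x)
  \<comment> \<open>The stopped path is bounded even on an infinite time interval, since all its
    values are taken on the compact \<open>{a..r}\<close>.\<close>
  have stopped: "continuous_on ?T (\<lambda>t. W (min r t) \<omega>) \<and> bounded ((\<lambda>t. W (min r t) \<omega>) ` ?T)" if "a \<le> r" for r
  proof
    show "continuous_on ?T (\<lambda>t. W (min r t) \<omega>)"
      by (rule continuous_on_compose2[OF W])
         (use that a in \<open>auto intro!: continuous_intros simp: time_interval_def\<close>)
    have "bounded ((\<lambda>t. W t \<omega>) ` {a..r})"
      by (intro compact_imp_bounded compact_continuous_image continuous_on_subset[OF W]) (use a in auto)
    then show "bounded ((\<lambda>t. W (min r t) \<omega>) ` ?T)"
      by (rule bounded_subset) (use that in \<open>auto simp: time_interval_def\<close>)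
  qed
  let ?f = "\<lambda>t. (W (min d t) \<omega> - W (min c t) \<omega>) *\<^sub>R \<eta> \<omega>"
  have IH: "(\<lambda>t. step_integral W S t \<omega>) \<in> Cb a b"
    using Cons by (auto simp: adapted_step_def)
  have "continuous_on ?T ?f"
    using stopped[of c] stopped[of d] cd by (intro continuous_intros) auto
  moreover have "bounded (?f ` ?T)"
  proof -
    obtain A where A: "\<forall>t\<in>?T. \<bar>W (min d t) \<omega>\<bar> \<le> A" using stopped[of d] cd by (auto simp: bounded_iff)
    obtain B where B: "\<forall>t\<in>?T. \<bar>W (min c t) \<omega>\<bar> \<le> B" using stopped[of c] cd by (auto simp: bounded_iff)
    have "norm (?f t) \<le> (A + B) * norm (\<eta> \<omega>)" if "t \<in> ?T" for t
    proof -
      have "\<bar>W (min d t) \<omega> - W (min c t) \<omega>\<bar> \<le> A + B" using A B that by fastforce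
      then show ?thesis by (simp add: mult_right_mono)
    qed
    then show ?thesis by (auto simp: bounded_iff)
  qed
  ultimately have "continuous_on ?T (\<lambda>t. ?f t + step_integral W S t \<omega>)"
    and "bounded ((\<lambda>t. ?f t + step_integral W S t \<omega>) ` ?T)"
    using IH by (auto simp: Cb_def intro!: continuous_intros bounded_plus_comp)
  then show ?case by (simp add: Cb_def step_integral_def x)
qed

text \<open>Convergence in probability gives, along a subsequence, almost sure uniform convergence
  of the paths; evaluation at \<open>t\<close> then produces an almost sure limit of
  \<open>F t\<close>-measurable functions, and completeness of \<open>F t\<close> finishes.\<close>

lemma integral_process_adapted:
  fixes \<phi> :: "real \<Rightarrow> 'w \<Rightarrow> 'e::banach"
  assumes I: "is_integral_process M F W a b \<phi> \<zeta>" and a: "0 \<le> a" and t: "t \<in> time_interval a b"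
  shows "\<exists>h\<in>borel_measurable (F t). AE \<omega> in M. \<zeta> \<omega> t = h \<omega>"
proof -
  have at: "a \<le> t" using t by (simp add: time_interval_def)
  obtain S where S: "\<And>n. adapted_step F a b (S n)"
    and conv: "tends_in_prob M (Cb_dist a b) (\<lambda>n \<omega> t. step_integral W (S n) t \<omega>) \<zeta>"
    and \<zeta>: "\<zeta> \<in> L0 M (Cb a b) (Cb_dist a b)"
    using I unfolding is_integral_process_def by blast
  have \<zeta>Cb: "AE \<omega> in M. \<zeta> \<omega> \<in> Cb a b" using \<zeta> by (simp add: L0_def)
  let ?d = "\<lambda>n \<omega>. Cb_dist a b (\<lambda>t. step_integral W (S n) t \<omega>) (\<zeta> \<omega>)"
  \<comment> \<open>\<open>B\<close> stands in for the exceedance event, which is measurable only up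
    to a null set.\<close>
  define exceeds where "exceeds j n B \<longleftrightarrow> (AE \<omega> in M. (1/2) ^ j < ?d n \<omega> \<longleftrightarrow> \<omega> \<in> B)" for j n B
  have "\<exists>n. \<exists>B\<in>sets M. prob B < (1/2) ^ j \<and> exceeds j n B" for j
  proof -
    have ev: "\<exists>B\<in>sets M. AE \<omega> in M. (1/2) ^ j < ?d n \<omega> \<longleftrightarrow> \<omega> \<in> B" for n
    proof (rule Cb_dist_event[OF _ \<zeta>])
      show "AE \<omega> in M. (\<lambda>t. step_integral W (S n) t \<omega>) \<in> Cb a b"
        using continuous_W by eventually_elim (rule step_integral_Cb[OF S a])
      fix u assume "u \<in> time_interval a b"
      then have "a \<le> u" by (simp add: time_interval_def)
      then show "strongly_measurable M (\<lambda>\<omega>. step_integral W (S n) u \<omega>)"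
        using F_strongly_measurable_M[OF step_integral_measurable[OF S a]] a by simp
    qed (use t in blast)
    have "(\<lambda>n. measure (completion M) {\<omega>\<in>space M. (1/2) ^ j < ?d n \<omega>}) \<longlonglongrightarrow> 0"
      using conv unfolding tends_in_prob_def by simp
    from order_tendstoD(2)[OF this, of "(1/2) ^ j"] obtain n where
      n: "measure (completion M) {\<omega>\<in>space M. (1/2) ^ j < ?d n \<omega>} < (1/2) ^ j"
      by (auto simp: eventually_sequentially)
    obtain B where B: "B \<in> sets M" "AE \<omega> in M. (1/2) ^ j < ?d n \<omega> \<longleftrightarrow> \<omega> \<in> B" using ev by blast
    show ?thesis using n B measure_completion_AE_eq[OF B] unfolding exceeds_def by (intro exI[of _ n] bexI[of _ B]) auto
  qed
  then obtain n B where B: "\<And>j. B j \<in> sets M" "\<And>j. prob (B j) < (1/2) ^ j"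
    and dB: "\<And>j. exceeds j (n j) (B j)"
    by metis
  have "summable (\<lambda>j. prob (B j))"
    by (rule summable_comparison_test'[OF summable_geometric[of "1/2"]])
      (use B(2) less_imp_le in auto)
  then have "AE \<omega> in M. \<forall>\<^sub>F j in sequentially. \<omega> \<in> space M - B j"
    using B(1) by (intro borel_cantelli_AE1) (auto simp: emeasure_eq_measure)
  moreover have "AE \<omega> in M. \<forall>j. (1/2) ^ j < ?d (n j) \<omega> \<longleftrightarrow> \<omega> \<in> B j"
    using dB unfolding exceeds_def by (simp add: AE_all_countable)
  ultimately have "AE \<omega> in M. (\<lambda>j. step_integral W (S (n j)) t \<omega>) \<longlonglongrightarrow> \<zeta> \<omega> t"
    using \<zeta>Cb continuous_W
  proof eventually_elim
    case (elim \<omega>)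
    show ?case
    proof (rule LIM_zero_cancel, rule Lim_null_comparison)
      show "(\<lambda>j. (1/2) ^ j :: real) \<longlonglongrightarrow> 0" by (rule LIMSEQ_realpow_zero) auto
      show "\<forall>\<^sub>F j in sequentially. norm (step_integral W (S (n j)) t \<omega> - \<zeta> \<omega> t) \<le> (1/2) ^ j"
        using elim(1)
      proof eventually_elim
        fix j assume "\<omega> \<in> space M - B j"
        then have "?d (n j) \<omega> \<le> (1/2) ^ j" using elim(2) not_less by blast
        moreover have "norm (step_integral W (S (n j)) t \<omega> - \<zeta> \<omega> t) \<le> ?d (n j) \<omega>"
          by (rule Cb_dist_upper(2)[OF step_integral_Cb[OF S a elim(4)] elim(3) t])
        ultimately show "norm (step_integral W (S (n j)) t \<omega> - \<zeta> \<omega> t) \<le> (1/2) ^ j" by simp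
      qed
    qed
  qed
  then show ?thesis
  proof (rule AE_limit_measurable[rotated -1])
    show "null_sets M \<subseteq> sets (F t)" using null_sets_F a at by simp
    show "space (F t) = space M" using space_F a at by simp
    show "step_integral W (S (n j)) t \<in> borel_measurable (F t)" for j
      by (rule strongly_measurable_borel[OF step_integral_measurable[OF S a at]])
  qed
qed

text \<open>Path continuity at \<open>b\<close> is what gives the \<sigma>-algebra before
  \<open>b\<close> instead of \<open>F b\<close>: the final value is the limit along times strictly
  below \<open>b\<close>. Since \<open>sigma_before M F b\<close> contains all null sets, the
  measurability passes from an almost surely equal function to \<xi> itself.\<close>

lemma integral_measurable:
  fixes \<phi> :: "real \<Rightarrow> 'w \<Rightarrow> 'e::banach"
  assumes I: "has_stochastic_integral M F W a b \<phi> \<xi>" and a: "0 \<le> a" "ereal a < b"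
    and \<xi>: "\<xi> \<in> borel_measurable M"
  shows "\<xi> \<in> borel_measurable (sigma_before M F b)"
proof -
  obtain \<zeta> where \<zeta>: "is_integral_process M F W a b \<phi> \<zeta>"
    and fin: "AE \<omega> in M. if b = \<infinity> then (\<zeta> \<omega> \<longlongrightarrow> \<xi> \<omega>) at_top else \<zeta> \<omega> (real_of_ereal b) = \<xi> \<omega>"
    using I unfolding has_stochastic_integral_def by blast
  have \<zeta>Cb: "AE \<omega> in M. \<zeta> \<omega> \<in> Cb a b"
    using \<zeta> by (simp add: is_integral_process_def L0_def)
  have "\<exists>t :: nat \<Rightarrow> real. (\<forall>k. a \<le> t k \<and> ereal (t k) < b) \<and>
      (if b = \<infinity> then filterlim t at_top sequentially else t \<longlonglongrightarrow> real_of_ereal b)"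
  proof (cases b)
    case (real r)
    then have ar: "a < r" using a by simp
    have "(\<lambda>k. r - (r - a) * inverse (real (Suc k))) \<longlonglongrightarrow> r - (r - a) * 0"
      by (intro tendsto_intros LIMSEQ_inverse_real_of_nat)
    moreover have "a \<le> r - (r - a) * inverse (real (Suc k))" for k
    proof -
      have "(r - a) * inverse (real (Suc k)) \<le> (r - a) * 1"
        using ar by (intro mult_left_mono) (auto simp: inverse_le_1_iff)
      then show ?thesis by simp
    qed
    ultimately show ?thesis using real ar
      by (intro exI[of _ "\<lambda>k. r - (r - a) * inverse (real (Suc k))"]) auto
  next
    case PInf
    have "filterlim (\<lambda>k. a + real k) at_top sequentially"
      by (intro filterlim_tendsto_add_at_top[OF tendsto_const] filterlim_real_sequentially)
    then show ?thesis using PInf by (intro exI[of _ "\<lambda>k. a + real k"]) auto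
  qed (use a in simp)
  then obtain t where t: "\<And>k. a \<le> t k" "\<And>k. ereal (t k) < b"
    and t_lim: "if b = \<infinity> then filterlim t at_top sequentially else t \<longlonglongrightarrow> real_of_ereal b"
    by blast
  have tT: "t k \<in> time_interval a b" for k
    using t[of k] by (simp add: time_interval_def)
  let ?G = "sigma_before M F b"
  have null: "null_sets M \<subseteq> sets ?G"
    using null_sets_F[of a] sets_F_sigma_before[of a b] a by blast
  obtain h where h: "\<And>k. h k \<in> borel_measurable (F (t k))" "\<And>k. AE \<omega> in M. \<zeta> \<omega> (t k) = h k \<omega>"
    using integral_process_adapted[OF \<zeta> a(1) tT] by metis
  have "h k \<in> borel_measurable ?G" for k
    using h(1)[of k] t[of k] a(1) sets_F_sigma_before[of "t k" b] space_F[of "t k"]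
    by (auto simp: measurable_def space_sigma_before)
  moreover have "AE \<omega> in M. \<forall>k. \<zeta> \<omega> (t k) = h k \<omega>" using h(2) by (simp add: AE_all_countable)
  then have "AE \<omega> in M. (\<lambda>k. h k \<omega>) \<longlonglongrightarrow> \<xi> \<omega>"
    using fin \<zeta>Cb
  proof eventually_elim
    case (elim \<omega>)
    have "(\<lambda>k. \<zeta> \<omega> (t k)) \<longlonglongrightarrow> \<xi> \<omega>"
    proof (cases "b = \<infinity>")
      case True
      then show ?thesis using elim(2) t_lim by (auto intro: filterlim_compose)
    next
      case False
      then obtain r where r: "b = ereal r" using a by (cases b) auto
      have "(\<lambda>k. \<zeta> \<omega> (t k)) \<longlonglongrightarrow> \<zeta> \<omega> r"
      proof (rule continuous_on_tendsto_compose[where f="\<zeta> \<omega>"])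
        show "continuous_on (time_interval a b) (\<zeta> \<omega>)" using elim(3) by (simp add: Cb_def)
        show "t \<longlonglongrightarrow> r" using t_lim r by simp
        show "r \<in> time_interval a b" using a r by (simp add: time_interval_def)
      qed (use tT in simp)
      then show ?thesis using elim(2) r by simp
    qed
    then show ?case using elim(1) by simp
  qed
  ultimately obtain g where g: "g \<in> borel_measurable ?G" "AE \<omega> in M. \<xi> \<omega> = g \<omega>"
    using AE_limit_measurable[OF null space_sigma_before, of h \<xi>] by blast
  show ?thesis by (rule AE_eq_measurable[OF null space_sigma_before \<xi> g])
qed

end

theorem theorem3p1:
  fixes M :: "'w measure" and F :: "real \<Rightarrow> 'w measure" and W :: "real \<Rightarrow> 'w \<Rightarrow> real"
    and a :: real and b :: ereal and \<xi> :: "'w \<Rightarrow> 'e::banach"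
  assumes "brownian_motion M F W"
    and "0 \<le> a" and "ereal a < b"
    and "strongly_measurable M \<xi>"
  shows "(\<exists>\<phi> :: real \<Rightarrow> 'w \<Rightarrow> 'e.
            strongly_progressively_measurable F a b \<phi> \<and>
            stochastically_integrable M F W a b \<phi> \<and>
            has_stochastic_integral M F W a b \<phi> \<xi>)
         \<longleftrightarrow> \<xi> \<in> borel_measurable (sigma_before M F b)"
proof -
  interpret brownian_motion M F W by fact
  show ?thesis
  proof
    assume "\<xi> \<in> borel_measurable (sigma_before M F b)"
    from integral_representation[OF assms(2-4) this] show "\<exists>\<phi> :: real \<Rightarrow> 'w \<Rightarrow> 'e.
        strongly_progressively_measurable F a b \<phi> \<and> stochastically_integrable M F W a b \<phi> \<and>
        has_stochastic_integral M F W a b \<phi> \<xi>"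
      unfolding stochastically_integrable_def has_stochastic_integral_def by blast
  qed (use integral_measurable assms(2,3) strongly_measurable_borel[OF assms(4)] in blast)
qed

end
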